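(* Let $r\ge 0$ and let $S\subseteq\{0,1,\ldots,r\}$ be a subset containing $r$. The monoidal model category $(f\mathcal{C})_S$ satisfies the monoid axiom of Schwede and Shipley.
   Context: Fix a commutative unital ring $R$. $f\mathcal{C}$ is the category of filtered chain complexes: an object is an unbounded, cohomologically graded chain complex $A$ of $R$-modules (differential $d$ of degree $+1$) with subcomplexes $F_pA$, $p\in\mathbb{Z}$, such that $F_pA\subseteq F_{p+1}A\subseteq A$; a morphism is a chain map $f$ with $f(F_pA)\subseteq F_pB$ for all $p$. For $k\ge 0$ put $Z_k^{p,p+n}(A)=F_pA^n\cap d^{-1}F_{p-k}A^{n+1}$, $B_0^{p,p+n}(A)=F_{p-1}A^n$, and for $k\ge1$, $B_k^{p,p+n}(A)=d\,Z_{k-1}^{p+k-1,p+k-1+n-1}(A)+Z_{k-1}^{p-1,p-1+n}(A)$. The $k$-page is $E_k^{p,p+n}(A)=Z_k^{p,p+n}(A)/B_k^{p,p+n}(A)$. An $r$-quasi-isomorphism is a morphism inducing an isomorphism on $E_{r+1}$. $R_{(p)}^n$ is the filtered chain complex with a copy of $R$ in degree $n$ and $0$ elsewhere, with $F_q=0$ for $q<p$ and $F_q=R$ for $q\ge p$. Set $\mathcal{Z}_k(p,n)=\bigl(R_{(p)}^n\xrightarrow{1}R_{(p-k)}^{n+1}\bigr)$, and for $k\ge 1$, $\mathcal{B}_k(p,n)=\mathcal{Z}_{k-1}(p+k-1,n-1)\oplus\mathcal{Z}_{k-1}(p-1,n)$, with $\varphi_k\colon\mathcal{Z}_k(p,n)\to\mathcal{B}_k(p,n)$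 the diagonal $R_{(p)}^n\to R_{(p)}^n\oplus R_{(p-1)}^n$ in degree $n$ and the identity in degree $n+1$. Let $I_r=\{\varphi_{r+1}\colon\mathcal{Z}_{r+1}(p,n)\to\mathcal{B}_{r+1}(p,n)\}_{p,n\in\mathbb{Z}}$, $J_k=\{0\to\mathcal{Z}_k(p,n)\}_{p,n\in\mathbb{Z}}$, $I_S=I_r\cup\bigcup_{s\in S}J_s$, $J_S=\bigcup_{s\in S}J_s$. $(f\mathcal{C})_S$ is the cofibrantly generated model structure on $f\mathcal{C}$ with weak equivalences the $r$-quasi-isomorphisms, generating cofibrations $I_S$ and generating acyclic cofibrations $J_S$. The monoidal product is the usual tensor product of complexes (Koszul signs) with $F_p(A\otimes B)=\sum_i\operatorname{im}(F_iA\otimes F_{p-i}B\to A\otimes B)$ and unit $R_{(0)}^0$. The monoid axiom for a monoidal model category $\mathcal{M}$: every transfinite composition of pushouts of morphisms of the form $g\otimes\mathrm{id}_M$, with $g$ an acyclic cofibration and $M$ an object of $\mathcal{M}$, is a weak equivalence. *)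

theory Defs
  imports "HOL-Algebra.Module" "HOL-Algebra.AbelCoset" "HOL.Hull"
begin

section \<open>Modules: linear maps, quotients, free modules\<close>

definition linear_map ::
    "('r, 'm) ring_scheme \<Rightarrow> ('r, 'a) module \<Rightarrow> ('r, 'b) module \<Rightarrow> ('a \<Rightarrow> 'b) \<Rightarrow> bool" where
  "linear_map R M N f \<longleftrightarrow>
     f \<in> carrier M \<rightarrow> carrier N \<and>
     (\<forall>x\<in>carrier M. \<forall>y\<in>carrier M. f (x \<oplus>\<^bsub>M\<^esub> y) = f x \<oplus>\<^bsub>N\<^esub> f y) \<and>
     (\<forall>a\<in>carrier R. \<forall>x\<in>carrier M. f (a \<odot>\<^bsub>M\<^esub> x) = a \<odot>\<^bsub>N\<^esub> f x)"

definition module_iso ::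
    "('r, 'm) ring_scheme \<Rightarrow> ('r, 'a) module \<Rightarrow> ('r, 'b) module \<Rightarrow> ('a \<Rightarrow> 'b) \<Rightarrow> bool" where
  "module_iso R M N f \<longleftrightarrow> linear_map R M N f \<and> bij_betw f (carrier M) (carrier N)"

abbreviation submodule_span :: "('r, 'm) ring_scheme \<Rightarrow> ('r, 'a) module \<Rightarrow> 'a set \<Rightarrow> 'a set" where
  "submodule_span R M X \<equiv> (\<lambda>N. submodule N R M) hull X"

text \<open>Module records inherit the fields \<^const>\<open>mult\<close> and \<^const>\<open>one\<close> from rings; a module
  does not use them, so they are left undefined below.\<close>

definition quot_module :: "('r, 'a) module \<Rightarrow> 'a set \<Rightarrow> ('r, 'a set) module" where
  "quot_module M N =
     \<lparr>carrier = a_rcosets\<^bsub>M\<^esub> N, mult = undefined, one = undefined,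
      zero = N, add = set_add M,
      smult = (\<lambda>a C. \<Union>x\<in>C. N +>\<^bsub>M\<^esub> (a \<odot>\<^bsub>M\<^esub> x))\<rparr>"

text \<open>The map \<open>x + N' \<mapsto> h x + N\<close> into \<open>M / N\<close>, for \<open>h\<close> carrying \<open>N'\<close> into \<open>N\<close>.\<close>

definition quot_map :: "('r, 'b) module \<Rightarrow> 'b set \<Rightarrow> ('a \<Rightarrow> 'b) \<Rightarrow> 'a set \<Rightarrow> 'b set" where
  "quot_map M N h C = (\<Union>x\<in>C. N +>\<^bsub>M\<^esub> h x)"

definition ring_as_module :: "('r, 'm) ring_scheme \<Rightarrow> ('r, 'r) module" where
  "ring_as_module R =
     \<lparr>carrier = carrier R, mult = mult R, one = one R, zero = zero R, add = add R,
      smult = mult R\<rparr>"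

definition prod_module :: "('r, 'a) module \<Rightarrow> ('r, 'b) module \<Rightarrow> ('r, 'a \<times> 'b) module" where
  "prod_module M N =
     \<lparr>carrier = carrier M \<times> carrier N, mult = undefined, one = undefined,
      zero = (\<zero>\<^bsub>M\<^esub>, \<zero>\<^bsub>N\<^esub>),
      add = (\<lambda>x y. (fst x \<oplus>\<^bsub>M\<^esub> fst y, snd x \<oplus>\<^bsub>N\<^esub> snd y)),
      smult = (\<lambda>a x. (a \<odot>\<^bsub>M\<^esub> fst x, a \<odot>\<^bsub>N\<^esub> snd x))\<rparr>"

definition free_module :: "('r, 'm) ring_scheme \<Rightarrow> 'g set \<Rightarrow> ('r, 'g \<Rightarrow> 'r) module" where
  "free_module R G =
     \<lparr>carrier = {\<phi>. (\<forall>g\<in>G. \<phi> g \<in> carrier R) \<and> (\<forall>g. g \<notin> G \<longrightarrow> \<phi> g = \<zero>\<^bsub>R\<^esub>) \<and>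
                     finite {g. \<phi> g \<noteq> \<zero>\<^bsub>R\<^esub>}},
      mult = undefined, one = undefined,
      zero = (\<lambda>_. \<zero>\<^bsub>R\<^esub>),
      add = (\<lambda>\<phi> \<psi> g. \<phi> g \<oplus>\<^bsub>R\<^esub> \<psi> g),
      smult = (\<lambda>a \<phi> g. a \<otimes>\<^bsub>R\<^esub> \<phi> g)\<rparr>"

definition free_gen :: "('r, 'm) ring_scheme \<Rightarrow> 'g \<Rightarrow> 'g \<Rightarrow> 'r" where
  "free_gen R g = (\<lambda>h. if h = g then \<one>\<^bsub>R\<^esub> else \<zero>\<^bsub>R\<^esub>)"

definition free_lift ::
    "('r, 'm) ring_scheme \<Rightarrow> ('r, 'a) module \<Rightarrow> ('g \<Rightarrow> 'a) \<Rightarrow> ('g \<Rightarrow> 'r) \<Rightarrow> 'a" where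
  "free_lift R M h \<phi> = (\<Oplus>\<^bsub>M\<^esub>g\<in>{g. \<phi> g \<noteq> \<zero>\<^bsub>R\<^esub>}. \<phi> g \<odot>\<^bsub>M\<^esub> h g)"


section \<open>The category of filtered chain complexes\<close>

text \<open>\<open>cx_mod A n\<close> is $A^n$, \<open>cx_d A n\<close> is $d \colon A^n \to A^{n+1}$ and \<open>cx_F A p n\<close> is
  $F_p A^n$.\<close>

record ('r, 'a) fcomplex =
  cx_mod :: "int \<Rightarrow> ('r, 'a) module"
  cx_d :: "int \<Rightarrow> 'a \<Rightarrow> 'a"
  cx_F :: "int \<Rightarrow> int \<Rightarrow> 'a set"

abbreviation cx_carrier :: "('r, 'a) fcomplex \<Rightarrow> int \<Rightarrow> 'a set" where
  "cx_carrier A n \<equiv> carrier (cx_mod A n)"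

locale filtered_complex =
  fixes R :: "('r, 'm) ring_scheme" and A :: "('r, 'a) fcomplex"
  assumes module_cx: "module R (cx_mod A n)"
    and linear_d: "linear_map R (cx_mod A n) (cx_mod A (n + 1)) (cx_d A n)"
    and d_d: "x \<in> cx_carrier A n \<Longrightarrow> cx_d A (n + 1) (cx_d A n x) = \<zero>\<^bsub>cx_mod A (n + 1 + 1)\<^esub>"
    and submodule_F: "submodule (cx_F A p n) R (cx_mod A n)"
    and F_mono: "cx_F A p n \<subseteq> cx_F A (p + 1) n"
    and d_F: "x \<in> cx_F A p n \<Longrightarrow> cx_d A n x \<in> cx_F A p (n + 1)"

text \<open>Morphisms are families of functions that only matter on the carriers, so they are compared
  with \<open>mor_eq\<close>.\<close>

definition fmor ::
    "('r, 'm) ring_scheme \<Rightarrow> ('r, 'a) fcomplex \<Rightarrow> ('r, 'b) fcomplex \<Rightarrow> (int \<Rightarrow> 'a \<Rightarrow> 'b) \<Rightarrow> bool" where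
  "fmor R A B f \<longleftrightarrow>
     filtered_complex R A \<and> filtered_complex R B \<and>
     (\<forall>n. linear_map R (cx_mod A n) (cx_mod B n) (f n)) \<and>
     (\<forall>n. \<forall>x\<in>cx_carrier A n. f (n + 1) (cx_d A n x) = cx_d B n (f n x)) \<and>
     (\<forall>p n. f n ` cx_F A p n \<subseteq> cx_F B p n)"

definition mor_eq :: "('r, 'a) fcomplex \<Rightarrow> (int \<Rightarrow> 'a \<Rightarrow> 'b) \<Rightarrow> (int \<Rightarrow> 'a \<Rightarrow> 'b) \<Rightarrow> bool" where
  "mor_eq A f g \<longleftrightarrow> (\<forall>n. \<forall>x\<in>cx_carrier A n. f n x = g n x)"

definition mor_comp ::
    "(int \<Rightarrow> 'b \<Rightarrow> 'c) \<Rightarrow> (int \<Rightarrow> 'a \<Rightarrow> 'b) \<Rightarrow> int \<Rightarrow> 'a \<Rightarrow> 'c" (infixl \<open>\<circ>\<^sub>m\<close> 55) where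
  "(g \<circ>\<^sub>m f) n x = g n (f n x)"

definition mor_id :: "int \<Rightarrow> 'a \<Rightarrow> 'a" where
  "mor_id n x = x"

definition direct_sum ::
    "('r, 'a) fcomplex \<Rightarrow> ('r, 'b) fcomplex \<Rightarrow> ('r, 'a \<times> 'b) fcomplex" where
  "direct_sum A B =
     \<lparr>cx_mod = (\<lambda>n. prod_module (cx_mod A n) (cx_mod B n)),
      cx_d = (\<lambda>n x. (cx_d A n (fst x), cx_d B n (snd x))),
      cx_F = (\<lambda>p n. cx_F A p n \<times> cx_F B p n)\<rparr>"


section \<open>Pages of the spectral sequence\<close>

text \<open>The second index is the cohomological degree: \<open>Zcyc k A p n\<close>, \<open>Bbdry k A p n\<close> and
  \<open>page k A p n\<close> are $Z_k^{p,p+m}(A)$, $B_k^{p,p+m}(A)$ and $E_k^{p,p+m}(A)$ with $m = n$.\<close>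

definition Zcyc :: "nat \<Rightarrow> ('r, 'a) fcomplex \<Rightarrow> int \<Rightarrow> int \<Rightarrow> 'a set" where
  "Zcyc k A p n = {x \<in> cx_F A p n. cx_d A n x \<in> cx_F A (p - int k) (n + 1)}"

fun Bbdry :: "nat \<Rightarrow> ('r, 'a) fcomplex \<Rightarrow> int \<Rightarrow> int \<Rightarrow> 'a set" where
  "Bbdry 0 A p n = cx_F A (p - 1) n"
| "Bbdry (Suc k) A p n =
     (cx_d A (n - 1) ` Zcyc k A (p + int k) (n - 1)) <+>\<^bsub>cx_mod A n\<^esub> Zcyc k A (p - 1) n"

definition page :: "nat \<Rightarrow> ('r, 'a) fcomplex \<Rightarrow> int \<Rightarrow> int \<Rightarrow> ('r, 'a set) module" where
  "page k A p n = quot_module (cx_mod A n\<lparr>carrier := Zcyc k A p n\<rparr>) (Bbdry k A p n)"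

definition page_map ::
    "nat \<Rightarrow> ('r, 'b) fcomplex \<Rightarrow> (int \<Rightarrow> 'a \<Rightarrow> 'b) \<Rightarrow> int \<Rightarrow> int \<Rightarrow> 'a set \<Rightarrow> 'b set" where
  "page_map k B f p n = quot_map (cx_mod B n\<lparr>carrier := Zcyc k B p n\<rparr>) (Bbdry k B p n) (f n)"

definition quasi_iso ::
    "('r, 'm) ring_scheme \<Rightarrow> nat \<Rightarrow> ('r, 'a) fcomplex \<Rightarrow> ('r, 'b) fcomplex \<Rightarrow>
     (int \<Rightarrow> 'a \<Rightarrow> 'b) \<Rightarrow> bool" where
  "quasi_iso R r A B f \<longleftrightarrow>
     fmor R A B f \<and>
     (\<forall>p n. module_iso R (page (r + 1) A p n) (page (r + 1) B p n) (page_map (r + 1) B f p n))"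


section \<open>The generating (acyclic) cofibrations and the model structure\<close>

text \<open>\<open>rank_one R c\<close> is the graded module with a copy of \<open>R\<close> in each degree where \<open>c\<close> holds
  and $0$ elsewhere.\<close>

definition rank_one :: "('r, 'm) ring_scheme \<Rightarrow> (int \<Rightarrow> bool) \<Rightarrow> int \<Rightarrow> ('r, 'r) module" where
  "rank_one R c m = (ring_as_module R)\<lparr>carrier := if c m then carrier R else {\<zero>\<^bsub>R\<^esub>}\<rparr>"

definition zero_cx :: "('r, 'm) ring_scheme \<Rightarrow> ('r, 'r) fcomplex" where
  "zero_cx R =
     \<lparr>cx_mod = rank_one R (\<lambda>_. False), cx_d = (\<lambda>_ _. \<zero>\<^bsub>R\<^esub>), cx_F = (\<lambda>_ _. {\<zero>\<^bsub>R\<^esub>})\<rparr>"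

text \<open>$\mathcal{Z}_k(p,n) = (R_{(p)}^n \xrightarrow{1} R_{(p-k)}^{n+1})$.\<close>

definition ZZ :: "('r, 'm) ring_scheme \<Rightarrow> nat \<Rightarrow> int \<Rightarrow> int \<Rightarrow> ('r, 'r) fcomplex" where
  "ZZ R k p n =
     \<lparr>cx_mod = rank_one R (\<lambda>m. m = n \<or> m = n + 1),
      cx_d = (\<lambda>m x. if m = n then x else \<zero>\<^bsub>R\<^esub>),
      cx_F = (\<lambda>q m. if m = n \<and> p \<le> q \<or> m = n + 1 \<and> p - int k \<le> q
                     then carrier R else {\<zero>\<^bsub>R\<^esub>})\<rparr>"

text \<open>\<open>BB R k p n\<close> and \<open>phi R n\<close> are $\mathcal{B}_{k}(p,n)$ and
  $\varphi_{k} \colon \mathcal{Z}_{k}(p,n) \to \mathcal{B}_{k}(p,n)$; they are used for $k \ge 1$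
  only.  The identity of $R$ in degree $n+1$ lands in the second summand, since the first one
  lives in degrees $n-1$ and $n$.\<close>

definition BB :: "('r, 'm) ring_scheme \<Rightarrow> nat \<Rightarrow> int \<Rightarrow> int \<Rightarrow> ('r, 'r \<times> 'r) fcomplex" where
  "BB R k p n =
     direct_sum (ZZ R (k - 1) (p + int k - 1) (n - 1)) (ZZ R (k - 1) (p - 1) n)"

definition phi :: "('r, 'm) ring_scheme \<Rightarrow> int \<Rightarrow> int \<Rightarrow> 'r \<Rightarrow> 'r \<times> 'r" where
  "phi R n m x = (if m = n then (x, x) else if m = n + 1 then (\<zero>\<^bsub>R\<^esub>, x) else (\<zero>\<^bsub>R\<^esub>, \<zero>\<^bsub>R\<^esub>))"

text \<open>\<open>i\<close> has the left lifting property with respect to \<open>q\<close>.\<close>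

definition lifts ::
    "('r, 'm) ring_scheme \<Rightarrow> ('r, 'a) fcomplex \<Rightarrow> ('r, 'b) fcomplex \<Rightarrow> (int \<Rightarrow> 'a \<Rightarrow> 'b) \<Rightarrow>
     ('r, 'x) fcomplex \<Rightarrow> ('r, 'y) fcomplex \<Rightarrow> (int \<Rightarrow> 'x \<Rightarrow> 'y) \<Rightarrow> bool" where
  "lifts R A B i X Y q \<longleftrightarrow>
     (\<forall>f g. fmor R A X f \<and> fmor R B Y g \<and> mor_eq A (g \<circ>\<^sub>m i) (q \<circ>\<^sub>m f) \<longrightarrow>
       (\<exists>h. fmor R B X h \<and> mor_eq A (h \<circ>\<^sub>m i) f \<and> mor_eq B (q \<circ>\<^sub>m h) g))"

text \<open>The morphisms with the right lifting property with respect to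
  $I_S = I_r \cup \bigcup_{s \in S} J_s$, that is, the acyclic fibrations of the model structure
  cofibrantly generated by $I_S$ and $J_S$.\<close>

definition acyclic_fibration ::
    "('r, 'm) ring_scheme \<Rightarrow> nat \<Rightarrow> nat set \<Rightarrow> ('r, 'x) fcomplex \<Rightarrow> ('r, 'y) fcomplex \<Rightarrow>
     (int \<Rightarrow> 'x \<Rightarrow> 'y) \<Rightarrow> bool" where
  "acyclic_fibration R r S X Y q \<longleftrightarrow>
     fmor R X Y q \<and>
     (\<forall>p n. lifts R (ZZ R (r + 1) p n) (BB R (r + 1) p n) (phi R n) X Y q) \<and>
     (\<forall>s\<in>S. \<forall>p n. lifts R (zero_cx R) (ZZ R s p n) (\<lambda>_ _. \<zero>\<^bsub>R\<^esub>) X Y q)"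

text \<open>From here on the type \<open>'u\<close> plays the role of the universe: the objects of the category are
  the filtered complexes whose modules have their elements in \<open>'u\<close>, and lifting problems and
  universal properties are tested against these objects.  When \<open>'u\<close> is infinite and at least as
  large as \<open>R\<close>, this category contains, up to isomorphism, the complexes $\mathcal{Z}_k(p,n)$
  and $\mathcal{B}_k(p,n)$, and it is closed under tensor products, pushouts and colimits
  indexed by sets no larger than \<open>'u\<close>.\<close>

definition cofibration ::
    "('r, 'm) ring_scheme \<Rightarrow> nat \<Rightarrow> nat set \<Rightarrow> ('r, 'u) fcomplex \<Rightarrow> ('r, 'u) fcomplex \<Rightarrow>
     (int \<Rightarrow> 'u \<Rightarrow> 'u) \<Rightarrow> bool" where
  "cofibration R r S A B g \<longleftrightarrow>
     fmor R A B g \<and>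
     (\<forall>(X :: ('r, 'u) fcomplex) (Y :: ('r, 'u) fcomplex) q.
        acyclic_fibration R r S X Y q \<longrightarrow> lifts R A B g X Y q)"

definition acyclic_cofibration ::
    "('r, 'm) ring_scheme \<Rightarrow> nat \<Rightarrow> nat set \<Rightarrow> ('r, 'u) fcomplex \<Rightarrow> ('r, 'u) fcomplex \<Rightarrow>
     (int \<Rightarrow> 'u \<Rightarrow> 'u) \<Rightarrow> bool" where
  "acyclic_cofibration R r S A B g \<longleftrightarrow> cofibration R r S A B g \<and> quasi_iso R r A B g"


section \<open>The tensor product\<close>

text \<open>$(A \otimes B)^n = \bigoplus_i A^i \otimes_R B^{n-i}$ is presented by generators
  \<open>(i, a, b)\<close>, standing for $a \otimes b \in A^i \otimes B^{n-i}$, modulo bilinearity in each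
  degree \<open>i\<close>.\<close>

definition tensor_gens ::
    "('r, 'a) fcomplex \<Rightarrow> ('r, 'b) fcomplex \<Rightarrow> int \<Rightarrow> (int \<times> 'a \<times> 'b) set" where
  "tensor_gens A B n = {(i, a, b). a \<in> cx_carrier A i \<and> b \<in> cx_carrier B (n - i)}"

abbreviation tensor_free ::
    "('r, 'm) ring_scheme \<Rightarrow> ('r, 'a) fcomplex \<Rightarrow> ('r, 'b) fcomplex \<Rightarrow> int \<Rightarrow>
     ('r, int \<times> 'a \<times> 'b \<Rightarrow> 'r) module" where
  "tensor_free R A B n \<equiv> free_module R (tensor_gens A B n)"

definition tensor_rels ::
    "('r, 'm) ring_scheme \<Rightarrow> ('r, 'a) fcomplex \<Rightarrow> ('r, 'b) fcomplex \<Rightarrow> int \<Rightarrow>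
     (int \<times> 'a \<times> 'b \<Rightarrow> 'r) set" where
  "tensor_rels R A B n = submodule_span R (tensor_free R A B n)
     (let F = tensor_free R A B n; \<delta> = (\<lambda>i a b. free_gen R (i, a, b)) in
       {\<delta> i (a \<oplus>\<^bsub>cx_mod A i\<^esub> a') b \<ominus>\<^bsub>F\<^esub> (\<delta> i a b \<oplus>\<^bsub>F\<^esub> \<delta> i a' b) | i a a' b.
          a \<in> cx_carrier A i \<and> a' \<in> cx_carrier A i \<and> b \<in> cx_carrier B (n - i)} \<union>
       {\<delta> i a (b \<oplus>\<^bsub>cx_mod B (n - i)\<^esub> b') \<ominus>\<^bsub>F\<^esub> (\<delta> i a b \<oplus>\<^bsub>F\<^esub> \<delta> i a b') | i a b b'.
          a \<in> cx_carrier A i \<and> b \<in> cx_carrier B (n - i) \<and> b' \<in> cx_carrier B (n - i)} \<union>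
       {\<delta> i (c \<odot>\<^bsub>cx_mod A i\<^esub> a) b \<ominus>\<^bsub>F\<^esub> c \<odot>\<^bsub>F\<^esub> \<delta> i a b | c i a b.
          c \<in> carrier R \<and> a \<in> cx_carrier A i \<and> b \<in> cx_carrier B (n - i)} \<union>
       {\<delta> i a (c \<odot>\<^bsub>cx_mod B (n - i)\<^esub> b) \<ominus>\<^bsub>F\<^esub> c \<odot>\<^bsub>F\<^esub> \<delta> i a b | c i a b.
          c \<in> carrier R \<and> a \<in> cx_carrier A i \<and> b \<in> cx_carrier B (n - i)})"

definition tensor_mod ::
    "('r, 'm) ring_scheme \<Rightarrow> ('r, 'a) fcomplex \<Rightarrow> ('r, 'b) fcomplex \<Rightarrow> int \<Rightarrow>
     ('r, (int \<times> 'a \<times> 'b \<Rightarrow> 'r) set) module" where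
  "tensor_mod R A B n = quot_module (tensor_free R A B n) (tensor_rels R A B n)"

definition pure_tensor ::
    "('r, 'm) ring_scheme \<Rightarrow> ('r, 'a) fcomplex \<Rightarrow> ('r, 'b) fcomplex \<Rightarrow> int \<Rightarrow>
     int \<Rightarrow> 'a \<Rightarrow> 'b \<Rightarrow> (int \<times> 'a \<times> 'b \<Rightarrow> 'r) set" where
  "pure_tensor R A B n i a b = tensor_rels R A B n +>\<^bsub>tensor_free R A B n\<^esub> free_gen R (i, a, b)"

definition koszul_sign :: "('r, 'm) ring_scheme \<Rightarrow> int \<Rightarrow> 'r" where
  "koszul_sign R i = (if even i then \<one>\<^bsub>R\<^esub> else \<ominus>\<^bsub>R\<^esub> \<one>\<^bsub>R\<^esub>)"

text \<open>The differential is $d(a \otimes b) = da \otimes b + (-1)^{i} a \otimes db$ for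
  $a \in A^i$.  The submodule $\sum_q \mathrm{im}(F_q A \otimes F_{p-q} B)$ is spanned by the pure
  tensors \<open>a \<otimes> b\<close> with $a \in F_q A$ and $b \in F_{p-q} B$ for some \<open>q\<close>.\<close>

definition tensor ::
    "('r, 'm) ring_scheme \<Rightarrow> ('r, 'a) fcomplex \<Rightarrow> ('r, 'b) fcomplex \<Rightarrow>
     ('r, (int \<times> 'a \<times> 'b \<Rightarrow> 'r) set) fcomplex" where
  "tensor R A B =
     \<lparr>cx_mod = tensor_mod R A B,
      cx_d = (\<lambda>n. let F = tensor_free R A B (n + 1) in
        quot_map F (tensor_rels R A B (n + 1))
          (free_lift R F (\<lambda>(i, a, b).
             free_gen R (i + 1, cx_d A i a, b) \<oplus>\<^bsub>F\<^esub>
             koszul_sign R i \<odot>\<^bsub>F\<^esub> free_gen R (i, a, cx_d B (n - i) b)))),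
      cx_F = (\<lambda>p n. submodule_span R (tensor_mod R A B n)
        {pure_tensor R A B n i a b | i a b q. a \<in> cx_F A q i \<and> b \<in> cx_F B (p - q) (n - i)})\<rparr>"

text \<open>\<open>tensor_mor R A' B' f g\<close> is $f \otimes g$ into $A' \otimes B'$.\<close>

definition tensor_mor ::
    "('r, 'm) ring_scheme \<Rightarrow> ('r, 'c) fcomplex \<Rightarrow> ('r, 'd) fcomplex \<Rightarrow>
     (int \<Rightarrow> 'a \<Rightarrow> 'c) \<Rightarrow> (int \<Rightarrow> 'b \<Rightarrow> 'd) \<Rightarrow>
     int \<Rightarrow> (int \<times> 'a \<times> 'b \<Rightarrow> 'r) set \<Rightarrow> (int \<times> 'c \<times> 'd \<Rightarrow> 'r) set" where
  "tensor_mor R A' B' f g n =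
     quot_map (tensor_free R A' B' n) (tensor_rels R A' B' n)
       (free_lift R (tensor_free R A' B' n) (\<lambda>(i, a, b). free_gen R (i, f i a, g (n - i) b)))"


section \<open>Pushouts, transfinite compositions and the monoid axiom\<close>

text \<open>The square with sides \<open>i : A \<rightarrow> B\<close>, \<open>f : A \<rightarrow> X\<close>, \<open>j : X \<rightarrow> Y\<close>, \<open>g : B \<rightarrow> Y\<close> is a
  pushout.\<close>

definition is_pushout ::
    "('r, 'm) ring_scheme \<Rightarrow> ('r, 'a) fcomplex \<Rightarrow> ('r, 'b) fcomplex \<Rightarrow>
     ('r, 'u) fcomplex \<Rightarrow> ('r, 'u) fcomplex \<Rightarrow>
     (int \<Rightarrow> 'a \<Rightarrow> 'b) \<Rightarrow> (int \<Rightarrow> 'a \<Rightarrow> 'u) \<Rightarrow> (int \<Rightarrow> 'u \<Rightarrow> 'u) \<Rightarrow> (int \<Rightarrow> 'b \<Rightarrow> 'u) \<Rightarrow> bool" where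
  "is_pushout R A B X Y i f j g \<longleftrightarrow>
     fmor R A B i \<and> fmor R A X f \<and> fmor R X Y j \<and> fmor R B Y g \<and>
     mor_eq A (j \<circ>\<^sub>m f) (g \<circ>\<^sub>m i) \<and>
     (\<forall>(T :: ('r, 'u) fcomplex) x b.
        fmor R X T x \<and> fmor R B T b \<and> mor_eq A (x \<circ>\<^sub>m f) (b \<circ>\<^sub>m i) \<longrightarrow>
        (\<exists>t. fmor R Y T t \<and> mor_eq X (t \<circ>\<^sub>m j) x \<and> mor_eq B (t \<circ>\<^sub>m g) b \<and>
          (\<forall>t'. fmor R Y T t' \<and> mor_eq X (t' \<circ>\<^sub>m j) x \<and> mor_eq B (t' \<circ>\<^sub>m g) b \<longrightarrow>
             mor_eq Y t' t)))"

text \<open>Ordinals are represented by well-order relations \<open>\<Lambda>\<close>; a diagram over a subset \<open>D\<close> of the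
  field of \<open>\<Lambda>\<close> has transition morphisms \<open>\<xi> i j : X i \<rightarrow> X j\<close> for \<open>(i, j) \<in> \<Lambda>\<close>.\<close>

definition is_cocone ::
    "('r, 'm) ring_scheme \<Rightarrow> 'i rel \<Rightarrow> 'i set \<Rightarrow> ('i \<Rightarrow> ('r, 'u) fcomplex) \<Rightarrow>
     ('i \<Rightarrow> 'i \<Rightarrow> int \<Rightarrow> 'u \<Rightarrow> 'u) \<Rightarrow> ('r, 'u) fcomplex \<Rightarrow> ('i \<Rightarrow> int \<Rightarrow> 'u \<Rightarrow> 'u) \<Rightarrow> bool" where
  "is_cocone R \<Lambda> D X \<xi> Y c \<longleftrightarrow>
     filtered_complex R Y \<and>
     (\<forall>i\<in>D. fmor R (X i) Y (c i)) \<and>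
     (\<forall>i\<in>D. \<forall>j\<in>D. (i, j) \<in> \<Lambda> \<longrightarrow> mor_eq (X i) (c j \<circ>\<^sub>m \<xi> i j) (c i))"

definition is_colimit ::
    "('r, 'm) ring_scheme \<Rightarrow> 'i rel \<Rightarrow> 'i set \<Rightarrow> ('i \<Rightarrow> ('r, 'u) fcomplex) \<Rightarrow>
     ('i \<Rightarrow> 'i \<Rightarrow> int \<Rightarrow> 'u \<Rightarrow> 'u) \<Rightarrow> ('r, 'u) fcomplex \<Rightarrow> ('i \<Rightarrow> int \<Rightarrow> 'u \<Rightarrow> 'u) \<Rightarrow> bool" where
  "is_colimit R \<Lambda> D X \<xi> Y c \<longleftrightarrow>
     is_cocone R \<Lambda> D X \<xi> Y c \<and>
     (\<forall>T b. is_cocone R \<Lambda> D X \<xi> T b \<longrightarrow>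
        (\<exists>t. fmor R Y T t \<and> (\<forall>i\<in>D. mor_eq (X i) (t \<circ>\<^sub>m c i) (b i)) \<and>
          (\<forall>t'. fmor R Y T t' \<and> (\<forall>i\<in>D. mor_eq (X i) (t' \<circ>\<^sub>m c i) (b i)) \<longrightarrow> mor_eq Y t' t)))"

definition is_succ :: "'i rel \<Rightarrow> 'i \<Rightarrow> 'i \<Rightarrow> bool" where
  "is_succ \<Lambda> i j \<longleftrightarrow> j \<in> aboveS \<Lambda> i \<and> (\<forall>k\<in>aboveS \<Lambda> i. (j, k) \<in> \<Lambda>)"

definition is_limit :: "'i rel \<Rightarrow> 'i \<Rightarrow> bool" where
  "is_limit \<Lambda> j \<longleftrightarrow> underS \<Lambda> j \<noteq> {} \<and> (\<forall>i. \<not> is_succ \<Lambda> i j)"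

text \<open>A \<open>\<Lambda>\<close>-sequence (a colimit-preserving functor out of the ordinal \<open>\<Lambda>\<close>) whose successor steps
  satisfy \<open>P\<close>.\<close>

definition transfinite_sequence ::
    "('r, 'm) ring_scheme \<Rightarrow>
     (('r, 'u) fcomplex \<Rightarrow> ('r, 'u) fcomplex \<Rightarrow> (int \<Rightarrow> 'u \<Rightarrow> 'u) \<Rightarrow> bool) \<Rightarrow> 'i rel \<Rightarrow>
     ('i \<Rightarrow> ('r, 'u) fcomplex) \<Rightarrow> ('i \<Rightarrow> 'i \<Rightarrow> int \<Rightarrow> 'u \<Rightarrow> 'u) \<Rightarrow> bool" where
  "transfinite_sequence R P \<Lambda> X \<xi> \<longleftrightarrow>
     (\<forall>i\<in>Field \<Lambda>. filtered_complex R (X i) \<and> mor_eq (X i) (\<xi> i i) mor_id) \<and>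
     (\<forall>i j. (i, j) \<in> \<Lambda> \<longrightarrow> fmor R (X i) (X j) (\<xi> i j)) \<and>
     (\<forall>i j k. (i, j) \<in> \<Lambda> \<and> (j, k) \<in> \<Lambda> \<longrightarrow> mor_eq (X i) (\<xi> j k \<circ>\<^sub>m \<xi> i j) (\<xi> i k)) \<and>
     (\<forall>i j. is_succ \<Lambda> i j \<longrightarrow> P (X i) (X j) (\<xi> i j)) \<and>
     (\<forall>j\<in>Field \<Lambda>. is_limit \<Lambda> j \<longrightarrow> is_colimit R \<Lambda> (underS \<Lambda> j) X \<xi> (X j) (\<lambda>i. \<xi> i j))"

text \<open>\<open>h\<close> is the pushout of some $g \otimes \mathrm{id}_M$ with \<open>g\<close> an acyclic cofibration.\<close>

definition pushout_of_acof_tensor ::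
    "('r, 'm) ring_scheme \<Rightarrow> nat \<Rightarrow> nat set \<Rightarrow> ('r, 'u) fcomplex \<Rightarrow> ('r, 'u) fcomplex \<Rightarrow>
     (int \<Rightarrow> 'u \<Rightarrow> 'u) \<Rightarrow> bool" where
  "pushout_of_acof_tensor R r S X Y h \<longleftrightarrow>
     (\<exists>(A :: ('r, 'u) fcomplex) (B :: ('r, 'u) fcomplex) g (M :: ('r, 'u) fcomplex) f f'.
        acyclic_cofibration R r S A B g \<and> filtered_complex R M \<and>
        is_pushout R (tensor R A M) (tensor R B M) X Y (tensor_mor R B M g mor_id) f h f')"

text \<open>\<open>'u\<close> is the universe and \<open>'i\<close> hosts the ordinals indexing transfinite compositions.  The
  composite of a \<open>\<Lambda>\<close>-sequence \<open>X\<close> with colimit \<open>(Y, c)\<close> is \<open>c o : X o \<rightarrow> Y\<close> for the least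
  element \<open>o\<close> of \<open>\<Lambda>\<close>.\<close>

definition monoid_axiom ::
    "('r, 'm) ring_scheme \<Rightarrow> nat \<Rightarrow> nat set \<Rightarrow> 'u itself \<Rightarrow> 'i itself \<Rightarrow> bool" where
  "monoid_axiom R r S (_ :: 'u itself) (_ :: 'i itself) \<longleftrightarrow>
     (\<forall>(\<Lambda> :: 'i rel) (X :: 'i \<Rightarrow> ('r, 'u) fcomplex) \<xi> Y c bot.
        Well_order \<Lambda> \<and> bot \<in> Field \<Lambda> \<and> (\<forall>i\<in>Field \<Lambda>. (bot, i) \<in> \<Lambda>) \<and>
        transfinite_sequence R (pushout_of_acof_tensor R r S) \<Lambda> X \<xi> \<and>
        is_colimit R \<Lambda> (Field \<Lambda>) X \<xi> Y c \<longrightarrow>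
        quasi_iso R r (X bot) Y (c bot))"

end

(* The idea is to see monoid-axiom maps as strong deformation retracts. The mapping path complex W
   of g : A \<rightarrow> B, with homotopies allowed to raise the filtration by r, is a factorisation
   A \<rightarrow> W \<rightarrow> B of g in which W \<rightarrow> B is onto on Z_s for all s \<le> r. If g is an
   r-quasi-isomorphism, then W \<rightarrow> B is even an acyclic fibration, so a cofibration g lifts against
   it; the lift is a retraction \<rho> of g together with a homotopy h from g \<rho> to the identity of B, with
   h g = 0 and h (F_p) \<subseteq> F_(p+r). The pair (\<rho>, h) survives tensoring with any M. Conversely, a map with
   such a pair lifts against the projection of every mapping path complex, and maps with this lifting
   property are closed under pushouts and transfinite compositions. Lifting a composite against
   its own mapping path complex gives (\<rho>, h) again, and the pair forces an isomorphism on E_(r+1). *)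

theory Submission
  imports Defs
begin


text \<open>Two descriptions of one class of maps are needed because each closure property is easy
  in only one of them. The pair (\<rho>, h) consists of linear maps subject to equations, so it can
  be tensored with M; a lifting property of A \<rightarrow> B gives no direct access to lifting
  problems out of B \<otimes> M. In a pushout or a colimit, on the other hand, lifts are glued by
  the universal property, whereas retractions and homotopies chosen separately for the steps of a
  sequence need not fit together. The shift r suits both directions. If y is in Z_(r+1) at level p,
  then d y is in F_(p-r-1), so h y and h d y lie in F_(p+r) and F_(p-1), the levels of the two
  summands of B_(r+1). For y in Z_s at level p, the triple (0, y, 0) lies in Z_s of W as soon as y
  is in F_(p-s+r), which holds for every s \<le> r. Objects are complexes over the fixed universe,
  while W lives on triples; hence lifting problems against W are moved along an injection, and
  equalities of maps into the base come from the uniqueness half of the universal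
  properties.\<close>

no_notation map_comp (infixl \<open>\<circ>\<^sub>m\<close> 55)

section \<open>Modules\<close>

lemma (in abelian_group) a_inv_zero [simp]: "\<ominus> \<zero> = \<zero>"
  by (rule minus_equality) auto

lemma (in abelian_group) minus_zero_right [simp]: "x \<in> carrier G \<Longrightarrow> x \<ominus> \<zero> = x"
  by (simp add: a_minus_def)

lemma (in abelian_group) minus_self [simp]: "x \<in> carrier G \<Longrightarrow> x \<ominus> x = \<zero>"
  by (simp add: a_minus_def r_neg)

lemma (in abelian_group) minus_eq_zero_iff:
  assumes "x \<in> carrier G" "y \<in> carrier G"
  shows "x \<ominus> y = \<zero> \<longleftrightarrow> x = y"
proof
  assume "x \<ominus> y = \<zero>"
  moreover have "x \<ominus> y \<oplus> y = x"
    using assms by (simp add: a_minus_def a_assoc l_neg)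
  ultimately show "x = y" using assms by simp
qed (use assms in simp)

lemma (in abelian_group) r_neg1: "x \<in> carrier G \<Longrightarrow> y \<in> carrier G \<Longrightarrow> \<ominus> x \<oplus> (x \<oplus> y) = y"
  by (simp add: l_neg flip: a_assoc)

lemma (in abelian_group) r_neg2: "x \<in> carrier G \<Longrightarrow> y \<in> carrier G \<Longrightarrow> x \<oplus> (\<ominus> x \<oplus> y) = y"
  by (simp add: r_neg flip: a_assoc)

lemma (in abelian_group) r_neg3: "x \<in> carrier G \<Longrightarrow> y \<in> carrier G \<Longrightarrow> x \<oplus> (y \<oplus> \<ominus> x) = y"
  by (simp add: a_comm[of y] r_neg2)

text \<open>The library sets up the method \<open>algebra\<close> for rings only.\<close>

lemmas (in abelian_group) abelian_group_simprules
  [algebra abelian_group "zero G" "add G" "a_inv G" "a_minus G"] =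
  a_closed zero_closed a_inv_closed minus_closed a_assoc l_zero l_neg a_comm minus_eq
  r_zero r_neg r_neg2 r_neg1 r_neg3 minus_add minus_minus a_inv_zero a_lcomm

section \<open>Linear maps, products and submodules\<close>

lemma linear_mapI:
  assumes "\<And>x. x \<in> carrier M \<Longrightarrow> f x \<in> carrier N"
    and "\<And>x y. x \<in> carrier M \<Longrightarrow> y \<in> carrier M \<Longrightarrow> f (x \<oplus>\<^bsub>M\<^esub> y) = f x \<oplus>\<^bsub>N\<^esub> f y"
    and "\<And>a x. a \<in> carrier R \<Longrightarrow> x \<in> carrier M \<Longrightarrow> f (a \<odot>\<^bsub>M\<^esub> x) = a \<odot>\<^bsub>N\<^esub> f x"
  shows "linear_map R M N f"
  using assms by (auto simp: linear_map_def)

lemma linear_map_closed: "linear_map R M N f \<Longrightarrow> x \<in> carrier M \<Longrightarrow> f x \<in> carrier N"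
  by (auto simp: linear_map_def)

lemma linear_map_add:
  "linear_map R M N f \<Longrightarrow> x \<in> carrier M \<Longrightarrow> y \<in> carrier M \<Longrightarrow> f (x \<oplus>\<^bsub>M\<^esub> y) = f x \<oplus>\<^bsub>N\<^esub> f y"
  by (auto simp: linear_map_def)

lemma linear_map_smult:
  "linear_map R M N f \<Longrightarrow> a \<in> carrier R \<Longrightarrow> x \<in> carrier M \<Longrightarrow> f (a \<odot>\<^bsub>M\<^esub> x) = a \<odot>\<^bsub>N\<^esub> f x"
  by (auto simp: linear_map_def)

context
  fixes R :: "('r, 'm) ring_scheme" and M :: "('r, 'a) module" and N :: "('r, 'b) module"
  assumes M: "module R M" and N: "module R N"
begin

interpretation M: module R M by (rule M)
interpretation N: module R N by (rule N)

lemma linear_map_hom: "linear_map R M N f \<Longrightarrow> abelian_group_hom M N f"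
  by (intro abelian_group_homI M.abelian_group_axioms N.abelian_group_axioms)
    (auto intro!: group_hom.intro M.a_group N.a_group group_hom_axioms.intro homI
      simp: linear_map_closed linear_map_add)

lemma linear_map_zero: "linear_map R M N f \<Longrightarrow> f \<zero>\<^bsub>M\<^esub> = \<zero>\<^bsub>N\<^esub>"
  by (rule abelian_group_hom.hom_zero[OF linear_map_hom])

lemma linear_map_a_inv: "linear_map R M N f \<Longrightarrow> x \<in> carrier M \<Longrightarrow> f (\<ominus>\<^bsub>M\<^esub> x) = \<ominus>\<^bsub>N\<^esub> f x"
  by (rule abelian_group_hom.hom_a_inv[OF linear_map_hom])

lemma linear_map_minus:
  "linear_map R M N f \<Longrightarrow> x \<in> carrier M \<Longrightarrow> y \<in> carrier M \<Longrightarrow> f (x \<ominus>\<^bsub>M\<^esub> y) = f x \<ominus>\<^bsub>N\<^esub> f y"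
  by (simp add: a_minus_def linear_map_a_inv linear_map_add)

lemma linear_map_fun_add:
  assumes "linear_map R M N f" "linear_map R M N g"
  shows "linear_map R M N (\<lambda>x. f x \<oplus>\<^bsub>N\<^esub> g x)"
  using linear_map_closed[OF assms(1)] linear_map_closed[OF assms(2)]
  by (intro linear_mapI)
    (auto simp: linear_map_add[OF assms(1)] linear_map_add[OF assms(2)] linear_map_smult[OF assms(1)]
      linear_map_smult[OF assms(2)] N.smult_r_distr N.a_ac)

lemma linear_map_fun_a_inv:
  assumes "linear_map R M N f"
  shows "linear_map R M N (\<lambda>x. \<ominus>\<^bsub>N\<^esub> f x)"
  using linear_map_closed[OF assms(1)]
  by (intro linear_mapI)
    (auto simp: linear_map_add[OF assms(1)] linear_map_smult[OF assms(1)] N.smult_r_minus N.minus_add)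

lemma linear_map_fun_minus:
  "linear_map R M N f \<Longrightarrow> linear_map R M N g \<Longrightarrow> linear_map R M N (\<lambda>x. f x \<ominus>\<^bsub>N\<^esub> g x)"
  by (simp add: a_minus_def linear_map_fun_add linear_map_fun_a_inv)

lemma linear_map_const_zero: "linear_map R M N (\<lambda>_. \<zero>\<^bsub>N\<^esub>)"
  by (intro linear_mapI) auto

text \<open>Preimages serve as test submodules: that two linear maps agree, or that a linear map
  respects a filtration, can then be checked on generators of the source.\<close>

lemma submodule_vimage:
  assumes f: "linear_map R M N f" and K: "submodule K R N"
  shows "submodule {x \<in> carrier M. f x \<in> K} R M"
  using N.submoduleE[OF K]
  by (intro M.submoduleI) (auto simp: linear_map_zero[OF f] linear_map_a_inv[OF f] linear_map_add[OF f]
    linear_map_smult[OF f] submodule.smult_closed[OF K] subgroup.one_closed[OF submodule.axioms(1)[OF K], simplified])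

lemma submodule_image:
  assumes f: "linear_map R M N f" and K: "submodule K R M"
  shows "submodule (f ` K) R N"
proof (rule N.submoduleI)
  note KE = M.submoduleE[OF K]
  show "f ` K \<subseteq> carrier N" using KE(1) linear_map_closed[OF f] by auto
  show "\<zero>\<^bsub>N\<^esub> \<in> f ` K"
    using subgroup.one_closed[OF submodule.axioms(1)[OF K]] by (auto intro!: image_eqI[where x = "\<zero>\<^bsub>M\<^esub>"] simp: linear_map_zero[OF f])
  show "\<ominus>\<^bsub>N\<^esub> a \<in> f ` K" if "a \<in> f ` K" for a
  proof -
    from that obtain k where k: "k \<in> K" "a = f k" by auto
    then show ?thesis using KE(1,3) by (intro image_eqI[where x = "\<ominus>\<^bsub>M\<^esub> k"]) (auto simp: linear_map_a_inv[OF f])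
  qed
  show "a \<oplus>\<^bsub>N\<^esub> b \<in> f ` K" if "a \<in> f ` K" "b \<in> f ` K" for a b
  proof -
    from that obtain k l where k: "k \<in> K" "a = f k" "l \<in> K" "b = f l" by auto
    then show ?thesis using KE(1,5) by (intro image_eqI[where x = "k \<oplus>\<^bsub>M\<^esub> l"]) (auto simp: linear_map_add[OF f] subset_iff)
  qed
  show "c \<odot>\<^bsub>N\<^esub> b \<in> f ` K" if "c \<in> carrier R" "b \<in> f ` K" for c b
  proof -
    from that obtain k where k: "k \<in> K" "b = f k" by auto
    then show ?thesis using that KE(1,4) by (intro image_eqI[where x = "c \<odot>\<^bsub>M\<^esub> k"]) (auto simp: linear_map_smult[OF f] subset_iff)
  qed
qed

end

lemma linear_map_comp:
  "linear_map R M N f \<Longrightarrow> linear_map R N P g \<Longrightarrow> linear_map R M P (\<lambda>x. g (f x))"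
  by (intro linear_mapI) (simp_all add: linear_map_closed linear_map_add linear_map_smult)

lemma prod_module_simps [simp]:
  "carrier (prod_module M N) = carrier M \<times> carrier N"
  "\<zero>\<^bsub>prod_module M N\<^esub> = (\<zero>\<^bsub>M\<^esub>, \<zero>\<^bsub>N\<^esub>)"
  "x \<oplus>\<^bsub>prod_module M N\<^esub> y = (fst x \<oplus>\<^bsub>M\<^esub> fst y, snd x \<oplus>\<^bsub>N\<^esub> snd y)"
  "a \<odot>\<^bsub>prod_module M N\<^esub> x = (a \<odot>\<^bsub>M\<^esub> fst x, a \<odot>\<^bsub>N\<^esub> snd x)"
  by (simp_all add: prod_module_def)

lemma module_prod_module:
  assumes "module R M" and "module R N"
  shows "module R (prod_module M N)"
proof -
  interpret M: module R M by fact
  interpret N: module R N by fact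
  have "abelian_group (prod_module M N)"
  proof (rule abelian_groupI)
    fix x assume "x \<in> carrier (prod_module M N)"
    then show "\<exists>y\<in>carrier (prod_module M N). y \<oplus>\<^bsub>prod_module M N\<^esub> x = \<zero>\<^bsub>prod_module M N\<^esub>"
      by (intro bexI[where x = "(\<ominus>\<^bsub>M\<^esub> fst x, \<ominus>\<^bsub>N\<^esub> snd x)"]) (auto simp: M.l_neg N.l_neg)
  qed (auto simp: M.a_ac N.a_ac)
  then show ?thesis
    by (intro moduleI M.R.is_cring)
      (auto simp: M.smult_l_distr N.smult_l_distr M.smult_r_distr N.smult_r_distr M.smult_assoc1 N.smult_assoc1)
qed

lemma a_inv_prod_module:
  assumes "module R M" and "module R N" and "x \<in> carrier M" "y \<in> carrier N"
  shows "\<ominus>\<^bsub>prod_module M N\<^esub> (x, y) = (\<ominus>\<^bsub>M\<^esub> x, \<ominus>\<^bsub>N\<^esub> y)"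
proof -
  interpret M: module R M by fact
  interpret N: module R N by fact
  interpret P: module R "prod_module M N" by (rule module_prod_module) fact+
  show ?thesis
    by (rule P.minus_equality) (use assms in \<open>auto simp: M.l_neg N.l_neg\<close>)
qed

lemma submodule_Times:
  assumes M: "module R M" and N: "module R N" and H: "submodule H R M" and K: "submodule K R N"
  shows "submodule (H \<times> K) R (prod_module M N)"
proof -
  interpret M: module R M by fact
  interpret N: module R N by fact
  interpret P: module R "prod_module M N" by (rule module_prod_module) fact+
  have 0: "\<zero>\<^bsub>M\<^esub> \<in> H" "\<zero>\<^bsub>N\<^esub> \<in> K"
    using subgroup.one_closed[OF submodule.axioms(1)[OF H]] subgroup.one_closed[OF submodule.axioms(1)[OF K]]
    by auto
  show ?thesis
    using M.submoduleE[OF H] N.submoduleE[OF K] 0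
    by (intro P.submoduleI) (auto simp: a_inv_prod_module[OF M N] subset_iff)
qed

lemma linear_map_pair:
  "linear_map R L M f \<Longrightarrow> linear_map R L N g \<Longrightarrow> linear_map R L (prod_module M N) (\<lambda>x. (f x, g x))"
  by (intro linear_mapI) (auto simp: linear_map_closed linear_map_add linear_map_smult)

lemma linear_map_fst: "linear_map R (prod_module M N) M fst"
  by (intro linear_mapI) auto

lemma linear_map_snd: "linear_map R (prod_module M N) N snd"
  by (intro linear_mapI) auto

lemma linear_map_id: "linear_map R M M (\<lambda>x. x)"
  by (intro linear_mapI) auto

context module
begin

lemma submodule_zero: "submodule H R M \<Longrightarrow> \<zero>\<^bsub>M\<^esub> \<in> H"
  using subgroup.one_closed[OF submodule.axioms(1)] by fastforce

lemma submodule_minus: "submodule H R M \<Longrightarrow> x \<in> H \<Longrightarrow> y \<in> H \<Longrightarrow> x \<ominus>\<^bsub>M\<^esub> y \<in> H"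
  by (simp add: a_minus_def submoduleE(3,5))

lemma submodule_Int: "submodule H R M \<Longrightarrow> submodule K R M \<Longrightarrow> submodule (H \<inter> K) R M"
  using submoduleE[of H] submoduleE[of K] by (intro submoduleI) (simp_all add: submodule_zero le_infI1)

lemma submodule_set_add:
  assumes H: "submodule H R M" and K: "submodule K R M"
  shows "submodule (H <+>\<^bsub>M\<^esub> K) R M"
proof (rule submoduleI)
  note HE = submoduleE[OF H] and KE = submoduleE[OF K]
  have mem: "z \<in> H <+>\<^bsub>M\<^esub> K \<longleftrightarrow> (\<exists>x\<in>H. \<exists>y\<in>K. z = x \<oplus>\<^bsub>M\<^esub> y)" for z
    by (auto simp: set_add_def')
  show "H <+>\<^bsub>M\<^esub> K \<subseteq> carrier M" using HE(1) KE(1) by (auto simp: mem subset_iff)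
  show "\<zero>\<^bsub>M\<^esub> \<in> H <+>\<^bsub>M\<^esub> K" unfolding mem
    by (rule bexI[of _ "\<zero>\<^bsub>M\<^esub>"], rule bexI[of _ "\<zero>\<^bsub>M\<^esub>"]) (auto simp: submodule_zero H K)
  show "\<ominus>\<^bsub>M\<^esub> z \<in> H <+>\<^bsub>M\<^esub> K" if z: "z \<in> H <+>\<^bsub>M\<^esub> K" for z
  proof -
    from z obtain x y where xy: "x \<in> H" "y \<in> K" "z = x \<oplus>\<^bsub>M\<^esub> y" unfolding mem by auto
    then have "\<ominus>\<^bsub>M\<^esub> z = \<ominus>\<^bsub>M\<^esub> x \<oplus>\<^bsub>M\<^esub> \<ominus>\<^bsub>M\<^esub> y" using HE(1) KE(1) by (auto simp: M.minus_add subset_iff)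
    then show ?thesis unfolding mem using xy HE(3) KE(3) by blast
  qed
  show "z \<oplus>\<^bsub>M\<^esub> w \<in> H <+>\<^bsub>M\<^esub> K" if zw: "z \<in> H <+>\<^bsub>M\<^esub> K" "w \<in> H <+>\<^bsub>M\<^esub> K" for z w
  proof -
    from zw obtain x y x' y' where xy: "x \<in> H" "y \<in> K" "z = x \<oplus>\<^bsub>M\<^esub> y"
      "x' \<in> H" "y' \<in> K" "w = x' \<oplus>\<^bsub>M\<^esub> y'" unfolding mem by blast
    then have "z \<oplus>\<^bsub>M\<^esub> w = (x \<oplus>\<^bsub>M\<^esub> x') \<oplus>\<^bsub>M\<^esub> (y \<oplus>\<^bsub>M\<^esub> y')"
      using HE(1) KE(1) by (auto simp: M.a_ac subset_iff)
    then show ?thesis unfolding mem using xy HE(5) KE(5) by blast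
  qed
  show "a \<odot>\<^bsub>M\<^esub> z \<in> H <+>\<^bsub>M\<^esub> K" if z: "a \<in> carrier R" "z \<in> H <+>\<^bsub>M\<^esub> K" for a z
  proof -
    from z obtain x y where xy: "x \<in> H" "y \<in> K" "z = x \<oplus>\<^bsub>M\<^esub> y" unfolding mem by auto
    then have "a \<odot>\<^bsub>M\<^esub> z = a \<odot>\<^bsub>M\<^esub> x \<oplus>\<^bsub>M\<^esub> a \<odot>\<^bsub>M\<^esub> y"
      using HE(1) KE(1) z by (auto simp: smult_r_distr subset_iff)
    then show ?thesis unfolding mem using xy HE(4) KE(4) z by blast
  qed
qed

text \<open>A page is a quotient of the record whose carrier is \<open>Zcyc\<close>, so
  \<open>Bbdry\<close> has to be a submodule of that record. The inverse needs an argument: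
  \<open>a_inv\<close> is determined through the carrier and could change when the carrier
  shrinks.\<close>

lemma submodule_of_submodule:
  assumes H: "submodule H R M" and K: "submodule K R M" and "H \<subseteq> K"
  shows "submodule H R (M\<lparr>carrier := K\<rparr>)"
proof -
  interpret K: module R "M\<lparr>carrier := K\<rparr>"
    by (rule submodule.submodule_is_module[OF K module_axioms])
  have inv: "\<ominus>\<^bsub>M\<lparr>carrier := K\<rparr>\<^esub> x = \<ominus>\<^bsub>M\<^esub> x" if "x \<in> H" for x
    by (rule K.minus_equality) (use that assms submoduleE[OF H] submoduleE[OF K] in \<open>auto simp: M.l_neg subset_iff\<close>)
  show ?thesis
    by (rule K.submoduleI) (use assms submoduleE[OF H] in \<open>auto simp: inv submodule_zero\<close>)
qed

end

subsection \<open>Quotient modules\<close>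

context
  fixes R :: "('r, 'm) ring_scheme" and M :: "('r, 'a) module" and N :: "'a set"
  assumes M: "module R M" and N: "submodule N R M"
begin

interpretation M: module R M by (rule M)

interpretation N: abelian_subgroup N M
  by (rule abelian_subgroupI3)
    (auto intro: additive_subgroupI submodule.axioms(1)[OF N] M.abelian_group_axioms)

lemma quot_carrier: "carrier (quot_module M N) = (\<lambda>x. N +>\<^bsub>M\<^esub> x) ` carrier M"
  by (auto simp: quot_module_def A_RCOSETS_def')

lemma coset_self: "x \<in> carrier M \<Longrightarrow> x \<in> N +>\<^bsub>M\<^esub> x"
  by (rule N.a_rcos_self)

lemma coset_nonempty: "x \<in> carrier M \<Longrightarrow> N +>\<^bsub>M\<^esub> x \<noteq> {}"
  using coset_self by blast

lemma coset_eq_iff: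
  assumes "x \<in> carrier M" "y \<in> carrier M"
  shows "N +>\<^bsub>M\<^esub> x = N +>\<^bsub>M\<^esub> y \<longleftrightarrow> x \<ominus>\<^bsub>M\<^esub> y \<in> N"
proof -
  have "N +>\<^bsub>M\<^esub> x = N +>\<^bsub>M\<^esub> y \<longleftrightarrow> x \<in> N +>\<^bsub>M\<^esub> y"
    using assms N.a_rcos_self N.a_repr_independence' by blast
  also have "\<dots> \<longleftrightarrow> x \<ominus>\<^bsub>M\<^esub> y \<in> N"
    using assms N.a_rcos_module by (simp add: a_minus_def)
  finally show ?thesis .
qed

lemma coset_repr: "y \<in> carrier M \<Longrightarrow> x \<in> N +>\<^bsub>M\<^esub> y \<Longrightarrow> x \<in> carrier M \<and> N +>\<^bsub>M\<^esub> x = N +>\<^bsub>M\<^esub> y"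
  using N.a_repr_independence' N.a_subset M.a_r_coset_subset_G by blast

lemma quot_add:
  "x \<in> carrier M \<Longrightarrow> y \<in> carrier M \<Longrightarrow>
    (N +>\<^bsub>M\<^esub> x) \<oplus>\<^bsub>quot_module M N\<^esub> (N +>\<^bsub>M\<^esub> y) = N +>\<^bsub>M\<^esub> (x \<oplus>\<^bsub>M\<^esub> y)"
  by (simp add: quot_module_def N.a_rcos_sum)

lemma quot_smult:
  assumes a: "a \<in> carrier R" and x: "x \<in> carrier M"
  shows "a \<odot>\<^bsub>quot_module M N\<^esub> (N +>\<^bsub>M\<^esub> x) = N +>\<^bsub>M\<^esub> (a \<odot>\<^bsub>M\<^esub> x)"
proof -
  have "N +>\<^bsub>M\<^esub> (a \<odot>\<^bsub>M\<^esub> y) = N +>\<^bsub>M\<^esub> (a \<odot>\<^bsub>M\<^esub> x)" if y: "y \<in> N +>\<^bsub>M\<^esub> x" for y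
  proof -
    have yc: "y \<in> carrier M" "y \<ominus>\<^bsub>M\<^esub> x \<in> N"
      using coset_repr[OF x y] coset_eq_iff x by auto
    have "a \<odot>\<^bsub>M\<^esub> y \<ominus>\<^bsub>M\<^esub> a \<odot>\<^bsub>M\<^esub> x = a \<odot>\<^bsub>M\<^esub> (y \<ominus>\<^bsub>M\<^esub> x)"
      using a x yc by (simp add: a_minus_def M.smult_r_distr M.smult_r_minus)
    then show ?thesis using M.submoduleE(4)[OF N a yc(2)] a x yc by (simp add: coset_eq_iff)
  qed
  then show ?thesis using coset_nonempty[OF x] by (simp add: quot_module_def)
qed

lemma quot_proj: "linear_map R M (quot_module M N) (\<lambda>x. N +>\<^bsub>M\<^esub> x)"
  by (intro linear_mapI) (auto simp: quot_carrier quot_add quot_smult)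

end

text \<open>\<open>quot_map\<close> is a union over all representatives of a coset; the hypothesis
  \<open>hN\<close> makes all members of that union equal.\<close>

lemma quot_map_coset:
  assumes M: "module R M" and N: "submodule N R M" and M': "module R M'" and N': "submodule N' R M'"
    and h: "linear_map R M M' h" and hN: "h ` N \<subseteq> N'" and x: "x \<in> carrier M"
  shows "quot_map M' N' h (N +>\<^bsub>M\<^esub> x) = N' +>\<^bsub>M'\<^esub> h x"
proof -
  have "N' +>\<^bsub>M'\<^esub> h y = N' +>\<^bsub>M'\<^esub> h x" if y: "y \<in> N +>\<^bsub>M\<^esub> x" for y
  proof -
    have yc: "y \<in> carrier M" "y \<ominus>\<^bsub>M\<^esub> x \<in> N"
      using coset_repr[OF M N x y] coset_eq_iff[OF M N] x by auto
    then have "h y \<ominus>\<^bsub>M'\<^esub> h x \<in> N'"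
      using hN linear_map_minus[OF M M' h yc(1) x] by auto
    then show ?thesis
      using linear_map_closed[OF h] yc x by (simp add: coset_eq_iff[OF M' N'])
  qed
  then show ?thesis using coset_nonempty[OF M N x] by (simp add: quot_map_def)
qed

text \<open>Trades an isomorphism of pages for vanishing of kernel and cokernel, stated with
  representatives. All later arguments about E_(r+1) are carried out on elements in this
  form.\<close>

lemma module_iso_quot_map_iff:
  assumes M: "module R M" and N: "submodule N R M" and M': "module R M'" and N': "submodule N' R M'"
    and h: "linear_map R M M' h" and hN: "h ` N \<subseteq> N'"
  shows "module_iso R (quot_module M N) (quot_module M' N') (quot_map M' N' h) \<longleftrightarrow>
    (\<forall>x\<in>carrier M. h x \<in> N' \<longrightarrow> x \<in> N) \<and> (\<forall>y\<in>carrier M'. \<exists>x\<in>carrier M. y \<ominus>\<^bsub>M'\<^esub> h x \<in> N')"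
proof -
  interpret M: module R M by fact
  interpret M': module R M' by fact
  note hc = linear_map_closed[OF h]
  note qm = quot_map_coset[OF assms]
  have lin: "linear_map R (quot_module M N) (quot_module M' N') (quot_map M' N' h)"
    by (rule linear_mapI)
      (auto simp: quot_carrier[OF M N] quot_carrier[OF M' N'] qm hc quot_add[OF M N] quot_add[OF M' N']
        quot_smult[OF M N] quot_smult[OF M' N'] linear_map_add[OF h] linear_map_smult[OF h])
  have inj: "inj_on (quot_map M' N' h) (carrier (quot_module M N)) \<longleftrightarrow>
      (\<forall>x\<in>carrier M. h x \<in> N' \<longrightarrow> x \<in> N)" (is "?L \<longleftrightarrow> ?R")
  proof
    assume L: ?L
    show ?R
    proof (intro ballI impI)
      fix x assume x: "x \<in> carrier M" "h x \<in> N'"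
      have "quot_map M' N' h (N +>\<^bsub>M\<^esub> x) = quot_map M' N' h (N +>\<^bsub>M\<^esub> \<zero>\<^bsub>M\<^esub>)"
        using x by (simp add: qm coset_eq_iff[OF M' N'] hc linear_map_zero[OF M M' h] a_minus_def M'.a_inv_zero)
      then have "N +>\<^bsub>M\<^esub> x = N +>\<^bsub>M\<^esub> \<zero>\<^bsub>M\<^esub>"
        using L x by (auto simp: inj_on_def quot_carrier[OF M N])
      then show "x \<in> N" using x by (simp add: coset_eq_iff[OF M N] a_minus_def M.a_inv_zero)
    qed
  next
    assume R: ?R
    show ?L
    proof (rule inj_onI)
      fix C D assume "C \<in> carrier (quot_module M N)" "D \<in> carrier (quot_module M N)"
        and eq: "quot_map M' N' h C = quot_map M' N' h D"
      then obtain x y where x: "x \<in> carrier M" "C = N +>\<^bsub>M\<^esub> x" and y: "y \<in> carrier M" "D = N +>\<^bsub>M\<^esub> y"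
        by (auto simp: quot_carrier[OF M N])
      have "h (x \<ominus>\<^bsub>M\<^esub> y) \<in> N'"
        using eq x y by (simp add: qm coset_eq_iff[OF M' N'] hc linear_map_minus[OF M M' h])
      then show "C = D" using R x y by (simp add: coset_eq_iff[OF M N])
    qed
  qed
  have surj: "quot_map M' N' h ` carrier (quot_module M N) = carrier (quot_module M' N') \<longleftrightarrow>
      (\<forall>y\<in>carrier M'. \<exists>x\<in>carrier M. y \<ominus>\<^bsub>M'\<^esub> h x \<in> N')" (is "?L \<longleftrightarrow> ?R")
  proof -
    have "?L \<longleftrightarrow> (\<forall>y\<in>carrier M'. N' +>\<^bsub>M'\<^esub> y \<in> quot_map M' N' h ` carrier (quot_module M N))"
    proof -
      have "quot_map M' N' h ` carrier (quot_module M N) \<subseteq> carrier (quot_module M' N')"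
        using linear_map_closed[OF lin] by blast
      then show ?thesis unfolding quot_carrier[OF M' N'] by blast
    qed
    also have "\<dots> \<longleftrightarrow> (\<forall>y\<in>carrier M'. \<exists>x\<in>carrier M. N' +>\<^bsub>M'\<^esub> y = N' +>\<^bsub>M'\<^esub> h x)"
      by (simp add: quot_carrier[OF M N] image_image qm image_iff)
    also have "\<dots> \<longleftrightarrow> ?R"
      by (simp add: coset_eq_iff[OF M' N'] hc)
    finally show ?thesis .
  qed
  show ?thesis unfolding module_iso_def bij_betw_def inj surj using lin by simp
qed


section \<open>Filtered complexes\<close>

sublocale filtered_complex \<subseteq> cx: module R "cx_mod A n" for n
  by (rule module_cx)

context filtered_complex
begin

lemma d_closed [simp]: "x \<in> cx_carrier A n \<Longrightarrow> cx_d A n x \<in> cx_carrier A (n + 1)"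
  by (rule linear_map_closed[OF linear_d])

text \<open>Homotopies lower the degree, so d is often applied in degree \<open>n - 1\<close>.
  Instances of the general facts would speak of degree \<open>n - 1 + 1\<close>, which is not
  syntactically \<open>n\<close>; the \<open>pred\<close> variants settle this once.\<close>

lemma linear_d_pred: "linear_map R (cx_mod A (n - 1)) (cx_mod A n) (cx_d A (n - 1))"
  using linear_d[of "n - 1"] by simp

lemma d_pred_closed [simp]: "x \<in> cx_carrier A (n - 1) \<Longrightarrow> cx_d A (n - 1) x \<in> cx_carrier A n"
  by (rule linear_map_closed[OF linear_d_pred])

lemmas d_add = linear_map_add[OF linear_d]
  and d_smult = linear_map_smult[OF linear_d]
  and d_zero [simp] = linear_map_zero[OF module_cx module_cx linear_d]
  and d_minus = linear_map_minus[OF module_cx module_cx linear_d]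
  and d_pred_add = linear_map_add[OF linear_d_pred]
  and d_pred_zero [simp] = linear_map_zero[OF module_cx module_cx linear_d_pred]
  and d_pred_a_inv = linear_map_a_inv[OF module_cx module_cx linear_d_pred]
  and d_pred_minus = linear_map_minus[OF module_cx module_cx linear_d_pred]

lemma d_d_pred [simp]: "x \<in> cx_carrier A (n - 1) \<Longrightarrow> cx_d A n (cx_d A (n - 1) x) = \<zero>\<^bsub>cx_mod A (n + 1)\<^esub>"
  using d_d[of x "n - 1"] by simp

lemma F_carrier: "x \<in> cx_F A p n \<Longrightarrow> x \<in> cx_carrier A n"
  using cx.submoduleE(1)[OF submodule_F] by blast

lemma F_add [simp]: "x \<in> cx_F A p n \<Longrightarrow> y \<in> cx_F A p n \<Longrightarrow> x \<oplus>\<^bsub>cx_mod A n\<^esub> y \<in> cx_F A p n"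
  by (rule cx.submoduleE(5)[OF submodule_F])

lemma F_a_inv [simp]: "x \<in> cx_F A p n \<Longrightarrow> \<ominus>\<^bsub>cx_mod A n\<^esub> x \<in> cx_F A p n"
  by (rule cx.submoduleE(3)[OF submodule_F])

lemma F_smult [simp]: "a \<in> carrier R \<Longrightarrow> x \<in> cx_F A p n \<Longrightarrow> a \<odot>\<^bsub>cx_mod A n\<^esub> x \<in> cx_F A p n"
  by (rule cx.submoduleE(4)[OF submodule_F])

lemma F_minus [simp]: "x \<in> cx_F A p n \<Longrightarrow> y \<in> cx_F A p n \<Longrightarrow> x \<ominus>\<^bsub>cx_mod A n\<^esub> y \<in> cx_F A p n"
  by (rule cx.submodule_minus[OF submodule_F])

lemma F_zero [simp]: "\<zero>\<^bsub>cx_mod A n\<^esub> \<in> cx_F A p n"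
  by (rule cx.submodule_zero[OF submodule_F])

lemma F_le: "x \<in> cx_F A p n \<Longrightarrow> p \<le> q \<Longrightarrow> x \<in> cx_F A q n"
proof -
  assume x: "x \<in> cx_F A p n" and "p \<le> q"
  from this(2) show "x \<in> cx_F A q n"
    by (induction q rule: int_ge_induct) (use x F_mono in auto)
qed

lemma d_pred_F: "x \<in> cx_F A p (n - 1) \<Longrightarrow> cx_d A (n - 1) x \<in> cx_F A p n"
  using d_F[of x p "n - 1"] by simp

end

locale filtered_map = A: filtered_complex R A + B: filtered_complex R B
  for R :: "('r, 'm) ring_scheme" and A :: "('r, 'a) fcomplex" and B :: "('r, 'b) fcomplex" +
  fixes f :: "int \<Rightarrow> 'a \<Rightarrow> 'b"
  assumes fmor: "fmor R A B f"
begin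

lemma linear: "linear_map R (cx_mod A n) (cx_mod B n) (f n)"
  using fmor by (auto simp: fmor_def)

lemma closed [simp]: "x \<in> cx_carrier A n \<Longrightarrow> f n x \<in> cx_carrier B n"
  by (rule linear_map_closed[OF linear])

lemmas add = linear_map_add[OF linear]
  and smult = linear_map_smult[OF linear]
  and zero [simp] = linear_map_zero[OF A.module_cx B.module_cx linear]
  and minus = linear_map_minus[OF A.module_cx B.module_cx linear]

lemma d: "x \<in> cx_carrier A n \<Longrightarrow> f (n + 1) (cx_d A n x) = cx_d B n (f n x)"
  using fmor by (auto simp: fmor_def)

lemma d_pred: "x \<in> cx_carrier A (n - 1) \<Longrightarrow> f n (cx_d A (n - 1) x) = cx_d B (n - 1) (f (n - 1) x)"
  using d[of x "n - 1"] by simp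

lemma F: "x \<in> cx_F A p n \<Longrightarrow> f n x \<in> cx_F B p n"
  using fmor unfolding fmor_def by blast

end

lemma filtered_mapI: "fmor R A B f \<Longrightarrow> filtered_map R A B f"
  by (auto simp: filtered_map_def filtered_map_axioms_def fmor_def)

lemma fmor_dom: "fmor R A B f \<Longrightarrow> filtered_complex R A"
  and fmor_cod: "fmor R A B f \<Longrightarrow> filtered_complex R B"
  by (auto simp: fmor_def)

lemma fmorI:
  assumes "filtered_complex R A" "filtered_complex R B"
    and "\<And>n. linear_map R (cx_mod A n) (cx_mod B n) (f n)"
    and "\<And>n x. x \<in> cx_carrier A n \<Longrightarrow> f (n + 1) (cx_d A n x) = cx_d B n (f n x)"
    and "\<And>p n x. x \<in> cx_F A p n \<Longrightarrow> f n x \<in> cx_F B p n"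
  shows "fmor R A B f"
  using assms unfolding fmor_def by blast

lemma fmor_comp: "fmor R A B f \<Longrightarrow> fmor R B C g \<Longrightarrow> fmor R A C (g \<circ>\<^sub>m f)"
proof -
  assume f: "fmor R A B f" and g: "fmor R B C g"
  interpret f: filtered_map R A B f by (rule filtered_mapI[OF f])
  interpret g: filtered_map R B C g by (rule filtered_mapI[OF g])
  show ?thesis
    by (rule fmorI[OF f.A.filtered_complex_axioms g.B.filtered_complex_axioms])
      (auto simp: mor_comp_def f.d g.d f.F g.F linear_map_comp[OF f.linear g.linear, folded mor_comp_def])
qed

lemma fmor_id: "filtered_complex R A \<Longrightarrow> fmor R A A mor_id"
  by (rule fmorI) (auto simp: mor_id_def linear_map_def Pi_def)

subsection \<open>Mapping path complexes and strong deformation retracts\<close>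

text \<open>A morphism \<open>k\<close> into the mapping path complex of \<open>f\<close> amounts to a pair of morphisms
  \<open>a\<close>, \<open>b\<close> into \<open>A\<close>, \<open>B\<close> together with a homotopy \<open>z\<close> from \<open>f a\<close> to \<open>b\<close> that raises the
  filtration by at most \<open>r\<close>.\<close>

definition mapping_path ::
    "nat \<Rightarrow> ('r, 'a) fcomplex \<Rightarrow> ('r, 'b) fcomplex \<Rightarrow> (int \<Rightarrow> 'a \<Rightarrow> 'b) \<Rightarrow> ('r, 'a \<times> 'b \<times> 'b) fcomplex" where
  "mapping_path r A B f =
     \<lparr>cx_mod = (\<lambda>n. prod_module (cx_mod A n) (prod_module (cx_mod B n) (cx_mod B (n - 1)))),
      cx_d = (\<lambda>n x. (cx_d A n (fst x), cx_d B n (fst (snd x)),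
        fst (snd x) \<ominus>\<^bsub>cx_mod B n\<^esub> (f n (fst x) \<oplus>\<^bsub>cx_mod B n\<^esub> cx_d B (n - 1) (snd (snd x))))),
      cx_F = (\<lambda>p n. cx_F A p n \<times> cx_F B p n \<times> cx_F B (p + int r) (n - 1))\<rparr>"

lemma mapping_path_simps [simp]:
  "cx_mod (mapping_path r A B f) n =
     prod_module (cx_mod A n) (prod_module (cx_mod B n) (cx_mod B (n - 1)))"
  "cx_d (mapping_path r A B f) n (a, b, z) =
     (cx_d A n a, cx_d B n b, b \<ominus>\<^bsub>cx_mod B n\<^esub> (f n a \<oplus>\<^bsub>cx_mod B n\<^esub> cx_d B (n - 1) z))"
  "cx_F (mapping_path r A B f) p n = cx_F A p n \<times> cx_F B p n \<times> cx_F B (p + int r) (n - 1)"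
  by (simp_all add: mapping_path_def)

definition mapping_path_incl :: "('r, 'b) fcomplex \<Rightarrow> (int \<Rightarrow> 'a \<Rightarrow> 'b) \<Rightarrow> int \<Rightarrow> 'a \<Rightarrow> 'a \<times> 'b \<times> 'b" where
  "mapping_path_incl B f n a = (a, f n a, \<zero>\<^bsub>cx_mod B (n - 1)\<^esub>)"

definition mapping_path_proj :: "int \<Rightarrow> 'a \<times> 'b \<times> 'b \<Rightarrow> 'b" where
  "mapping_path_proj n x = fst (snd x)"

context filtered_map
begin

lemma filtered_complex_mapping_path: "filtered_complex R (mapping_path r A B f)"
proof (rule filtered_complex.intro)
  fix n p x
  let ?W = "mapping_path r A B f"
  show "module R (cx_mod ?W n)"
    by (simp add: module_prod_module A.module_cx B.module_cx)
  show "linear_map R (cx_mod ?W n) (cx_mod ?W (n + 1)) (cx_d ?W n)"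
  proof -
    let ?M = "cx_mod ?W n"
    have M: "module R ?M" by fact
    note a = linear_map_fst[where M = "cx_mod A n" and N = "prod_module (cx_mod B n) (cx_mod B (n - 1))" and R = R]
    note bz = linear_map_snd[where M = "cx_mod A n" and N = "prod_module (cx_mod B n) (cx_mod B (n - 1))" and R = R]
    note b = linear_map_comp[OF bz linear_map_fst]
    note z = linear_map_comp[OF bz linear_map_snd]
    note l3 = linear_map_fun_minus[OF M[simplified] B.module_cx b
        linear_map_fun_add[OF M[simplified] B.module_cx linear_map_comp[OF a linear] linear_map_comp[OF z B.linear_d_pred]]]
    show ?thesis
      using linear_map_pair[OF linear_map_comp[OF a A.linear_d] linear_map_pair[OF linear_map_comp[OF b B.linear_d] l3]]
      by (simp add: mapping_path_def)
  qed
  show "cx_d ?W (n + 1) (cx_d ?W n x) = \<zero>\<^bsub>cx_mod ?W (n + 1 + 1)\<^esub>" if "x \<in> cx_carrier ?W n"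
  proof -
    from that obtain a b z where x: "x = (a, b, z)" "a \<in> cx_carrier A n" "b \<in> cx_carrier B n"
      "z \<in> cx_carrier B (n - 1)" by auto
    have c: "cx_d B n b \<in> cx_carrier B (n + 1)" "cx_d B n (f n a) \<in> cx_carrier B (n + 1)"
      using x by simp_all
    \<comment> \<open>What is left of the third component of d d (a, b, z) once d d z = 0 and f
      commutes with d.\<close>
    have "cx_d B n b \<ominus>\<^bsub>cx_mod B (n + 1)\<^esub> (cx_d B n (f n a) \<oplus>\<^bsub>cx_mod B (n + 1)\<^esub>
        (cx_d B n b \<ominus>\<^bsub>cx_mod B (n + 1)\<^esub> cx_d B n (f n a))) = \<zero>\<^bsub>cx_mod B (n + 1)\<^esub>"
      using c by algebra
    then show ?thesis
      using x by (simp add: A.d_d B.d_d B.d_minus B.d_add d add.commute[of 1 n])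
  qed
  show "submodule (cx_F ?W p n) R (cx_mod ?W n)"
    by (simp add: submodule_Times module_prod_module A.module_cx B.module_cx A.submodule_F B.submodule_F)
  show "cx_F ?W p n \<subseteq> cx_F ?W (p + 1) n"
    using A.F_mono[of p n] B.F_mono[of p n] B.F_mono[of "p + int r" "n - 1"] by (auto simp: algebra_simps)
  show "cx_d ?W n x \<in> cx_F ?W p (n + 1)" if "x \<in> cx_F ?W p n"
  proof -
    from that obtain a b z where x: "x = (a, b, z)" "a \<in> cx_F A p n" "b \<in> cx_F B p n"
      "z \<in> cx_F B (p + int r) (n - 1)" by auto
    \<comment> \<open>The third component b - f a - d z mixes level \<open>p\<close> with level
      \<open>p + int r\<close>; as r is a natural number, all of it lies in the latter.\<close>
    have "b \<in> cx_F B (p + int r) n" "f n a \<in> cx_F B (p + int r) n"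
      using B.F_le[OF x(3)] B.F_le[OF F[OF x(2)]] by auto
    then show ?thesis using x by (simp add: A.d_F B.d_F B.d_pred_F)
  qed
qed

lemma fmor_mapping_path_incl: "fmor R A (mapping_path r A B f) (mapping_path_incl B f)"
  unfolding mapping_path_incl_def
  by (rule fmorI[OF A.filtered_complex_axioms filtered_complex_mapping_path])
    (auto intro!: linear_map_pair linear_map_id linear linear_map_const_zero A.module_cx B.module_cx
      simp: d F a_minus_def B.cx.r_neg)

lemma fmor_mapping_path_proj: "fmor R (mapping_path r A B f) B mapping_path_proj"
  unfolding mapping_path_proj_def
  by (rule fmorI[OF filtered_complex_mapping_path B.filtered_complex_axioms])
    (auto intro!: linear_map_comp[OF linear_map_snd linear_map_fst])

end

text \<open>The usual notion with a filtration shift on the homotopy. The condition that h vanishes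
  on the image of g makes the retract strong; because of it, lifts built from h restrict to the
  prescribed map on A.\<close>

definition strong_def_retract ::
    "('r, 'm) ring_scheme \<Rightarrow> nat \<Rightarrow> ('r, 'a) fcomplex \<Rightarrow> ('r, 'b) fcomplex \<Rightarrow> (int \<Rightarrow> 'a \<Rightarrow> 'b) \<Rightarrow>
     (int \<Rightarrow> 'b \<Rightarrow> 'a) \<Rightarrow> (int \<Rightarrow> 'b \<Rightarrow> 'b) \<Rightarrow> bool" where
  "strong_def_retract R r A B g \<rho> h \<longleftrightarrow>
     fmor R A B g \<and> fmor R B A \<rho> \<and> mor_eq A (\<rho> \<circ>\<^sub>m g) mor_id \<and>
     (\<forall>n. linear_map R (cx_mod B n) (cx_mod B (n - 1)) (h n)) \<and>
     (\<forall>p n. \<forall>x\<in>cx_F B p n. h n x \<in> cx_F B (p + int r) (n - 1)) \<and>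
     (\<forall>n. \<forall>x\<in>cx_carrier A n. h n (g n x) = \<zero>\<^bsub>cx_mod B (n - 1)\<^esub>) \<and>
     (\<forall>n. \<forall>x\<in>cx_carrier B n.
        g n (\<rho> n x) \<oplus>\<^bsub>cx_mod B n\<^esub> (cx_d B (n - 1) (h n x) \<oplus>\<^bsub>cx_mod B n\<^esub> h (n + 1) (cx_d B n x)) = x)"

locale def_retract = g: filtered_map R A B g + \<rho>: filtered_map R B A \<rho>
  for R :: "('r, 'm) ring_scheme" and r :: nat and A :: "('r, 'a) fcomplex" and B :: "('r, 'b) fcomplex"
    and g \<rho> and h :: "int \<Rightarrow> 'b \<Rightarrow> 'b" +
  assumes sdr: "strong_def_retract R r A B g \<rho> h"
begin

lemma \<rho>_g: "x \<in> cx_carrier A n \<Longrightarrow> \<rho> n (g n x) = x"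
  using sdr by (auto simp: strong_def_retract_def mor_eq_def mor_comp_def mor_id_def)

lemma linear_h: "linear_map R (cx_mod B n) (cx_mod B (n - 1)) (h n)"
  using sdr by (auto simp: strong_def_retract_def)

lemma h_closed [simp]: "x \<in> cx_carrier B n \<Longrightarrow> h n x \<in> cx_carrier B (n - 1)"
  by (rule linear_map_closed[OF linear_h])

lemma linear_h_succ: "linear_map R (cx_mod B (n + 1)) (cx_mod B n) (h (n + 1))"
  using linear_h[of "n + 1"] by simp

lemma h_succ_closed [simp]: "x \<in> cx_carrier B (n + 1) \<Longrightarrow> h (n + 1) x \<in> cx_carrier B n"
  by (rule linear_map_closed[OF linear_h_succ])

lemma h_F: "x \<in> cx_F B p n \<Longrightarrow> h n x \<in> cx_F B (p + int r) (n - 1)"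
  using sdr by (auto simp: strong_def_retract_def)

lemma h_succ_F: "x \<in> cx_F B p (n + 1) \<Longrightarrow> h (n + 1) x \<in> cx_F B (p + int r) n"
  using h_F[of x p "n + 1"] by simp

lemma h_g: "x \<in> cx_carrier A n \<Longrightarrow> h n (g n x) = \<zero>\<^bsub>cx_mod B (n - 1)\<^esub>"
  using sdr by (auto simp: strong_def_retract_def)

lemma homotopy: "x \<in> cx_carrier B n \<Longrightarrow>
    g n (\<rho> n x) \<oplus>\<^bsub>cx_mod B n\<^esub> (cx_d B (n - 1) (h n x) \<oplus>\<^bsub>cx_mod B n\<^esub> h (n + 1) (cx_d B n x)) = x"
  using sdr by (auto simp: strong_def_retract_def)

end

lemma def_retractI: "strong_def_retract R r A B g \<rho> h \<Longrightarrow> def_retract R r A B g \<rho> h"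
  by (auto simp: def_retract_def def_retract_axioms_def strong_def_retract_def filtered_mapI)


text \<open>A map k that is a section of the projection and extends the inclusion of A has the form
  x \<mapsto> (\<rho> x, x, h x). Compatibility with d in the third component is the homotopy
  formula, and the values on the image of g give \<rho> g = id and h g = 0.\<close>

lemma strong_def_retract_of_lift:
  assumes g: "fmor R A B g" and k: "fmor R B (mapping_path r A B g) k"
    and kg: "mor_eq A (k \<circ>\<^sub>m g) (mapping_path_incl B g)"
    and pk: "mor_eq B (mapping_path_proj \<circ>\<^sub>m k) mor_id"
  shows "\<exists>\<rho> h. strong_def_retract R r A B g \<rho> h"
proof (intro exI)
  let ?W = "mapping_path r A B g"
  interpret g: filtered_map R A B g by (rule filtered_mapI[OF g])
  interpret k: filtered_map R B ?W k by (rule filtered_mapI[OF k])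
  define \<rho> where "\<rho> n x = fst (k n x)" for n x
  define h where "h n x = snd (snd (k n x))" for n x
  have kx: "k n x = (\<rho> n x, x, h n x)" if "x \<in> cx_carrier B n" for n x
    using pk that by (auto simp: mor_eq_def mor_comp_def mor_id_def mapping_path_proj_def \<rho>_def h_def prod_eq_iff)
  have kc: "\<rho> n x \<in> cx_carrier A n" "h n x \<in> cx_carrier B (n - 1)" if "x \<in> cx_carrier B n" for n x
    using k.closed[OF that] kx[OF that] by simp_all
  have kd: "\<rho> (n + 1) (cx_d B n x) = cx_d A n (\<rho> n x)"
    "h (n + 1) (cx_d B n x) = x \<ominus>\<^bsub>cx_mod B n\<^esub> (g n (\<rho> n x) \<oplus>\<^bsub>cx_mod B n\<^esub> cx_d B (n - 1) (h n x))"
    if x: "x \<in> cx_carrier B n" for n x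
    using k.d[OF x] kx[OF x] kx[OF g.B.d_closed[OF x]] by simp_all
  have kF: "\<rho> n x \<in> cx_F A p n" "h n x \<in> cx_F B (p + int r) (n - 1)" if "x \<in> cx_F B p n" for n p x
    using k.F[OF that] kx[OF g.B.F_carrier[OF that]] by simp_all
  have lin: "linear_map R (cx_mod B n) (cx_mod A n) (\<rho> n)"
    "linear_map R (cx_mod B n) (cx_mod B (n - 1)) (h n)" for n
    unfolding \<rho>_def h_def using k.linear[of n]
    by (auto intro!: linear_map_comp[OF k.linear[simplified] linear_map_fst]
      linear_map_comp[OF linear_map_comp[OF k.linear[simplified] linear_map_snd] linear_map_snd])
  have kga: "k n (g n x) = (x, g n x, \<zero>\<^bsub>cx_mod B (n - 1)\<^esub>)" if "x \<in> cx_carrier A n" for n x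
    using kg that by (auto simp: mor_eq_def mor_comp_def mapping_path_incl_def)
  show "strong_def_retract R r A B g \<rho> h"
    unfolding strong_def_retract_def mor_eq_def mor_comp_def mor_id_def
  proof (intro conjI allI ballI g lin kF)
    show "fmor R B A \<rho>"
      by (rule fmorI[OF g.B.filtered_complex_axioms g.A.filtered_complex_axioms lin(1)]) (auto simp: kd kF)
  next
    fix n x assume x: "x \<in> cx_carrier A n"
    then show "\<rho> n (g n x) = x" "h n (g n x) = \<zero>\<^bsub>cx_mod B (n - 1)\<^esub>"
      using kga[OF x] kx[of "g n x" n] by auto
  next
    fix n x assume x: "x \<in> cx_carrier B n"
    have "g n (\<rho> n x) \<in> cx_carrier B n" "cx_d B (n - 1) (h n x) \<in> cx_carrier B n"
      using kc[OF x] by auto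
    then show "g n (\<rho> n x) \<oplus>\<^bsub>cx_mod B n\<^esub> (cx_d B (n - 1) (h n x) \<oplus>\<^bsub>cx_mod B n\<^esub> h (n + 1) (cx_d B n x)) = x"
      unfolding kd(2)[OF x] using x by algebra
  qed
qed

text \<open>A point b is joined to g \<rho> b by the homotopy h, and over A the required homotopy is
  already given; the lift concatenates the two. The test map comes from an arbitrary morphism c, not
  from g, so that it can later be the composite of a whole sequence.\<close>

lemma (in def_retract) lifts_mapping_path:
  assumes c: "fmor R X Y c"
  shows "lifts R A B g (mapping_path r X Y c) Y mapping_path_proj"
  unfolding lifts_def
proof (intro allI impI, elim conjE)
  let ?W = "mapping_path r X Y c"
  fix u v
  assume u: "fmor R A ?W u" and v: "fmor R B Y v" and eq: "mor_eq A (v \<circ>\<^sub>m g) (mapping_path_proj \<circ>\<^sub>m u)"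
  interpret c: filtered_map R X Y c by (rule filtered_mapI[OF c])
  interpret u: filtered_map R A ?W u by (rule filtered_mapI[OF u])
  interpret v: filtered_map R B Y v by (rule filtered_mapI[OF v])
  define \<alpha> where "\<alpha> n x = fst (u n x)" for n x
  define \<eta> where "\<eta> n x = snd (snd (u n x))" for n x
  \<comment> \<open>The square determines the middle component of u; the free data are \<alpha> and
    the homotopy \<eta> from c \<alpha> to v g.\<close>
  have ux: "u n x = (\<alpha> n x, v n (g n x), \<eta> n x)" if "x \<in> cx_carrier A n" for n x
    using eq that by (auto simp: mor_eq_def mor_comp_def mor_id_def mapping_path_proj_def \<alpha>_def \<eta>_def prod_eq_iff)
  have uc: "\<alpha> n x \<in> cx_carrier X n" "\<eta> n x \<in> cx_carrier Y (n - 1)" if "x \<in> cx_carrier A n" for n x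
    using u.closed[OF that] ux[OF that] by simp_all
  have ud: "\<alpha> (n + 1) (cx_d A n x) = cx_d X n (\<alpha> n x)"
    "\<eta> (n + 1) (cx_d A n x) = v n (g n x) \<ominus>\<^bsub>cx_mod Y n\<^esub> (c n (\<alpha> n x) \<oplus>\<^bsub>cx_mod Y n\<^esub> cx_d Y (n - 1) (\<eta> n x))"
    if x: "x \<in> cx_carrier A n" for n x
    using u.d[OF x] ux[OF x] ux[OF g.A.d_closed[OF x]] by simp_all
  have uF: "\<alpha> n x \<in> cx_F X p n" "\<eta> n x \<in> cx_F Y (p + int r) (n - 1)" if "x \<in> cx_F A p n" for n p x
    using u.F[OF that] ux[OF g.A.F_carrier[OF that]] by simp_all
  have lin: "linear_map R (cx_mod A n) (cx_mod X n) (\<alpha> n)"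
    "linear_map R (cx_mod A n) (cx_mod Y (n - 1)) (\<eta> n)" for n
    unfolding \<alpha>_def \<eta>_def
    by (auto intro!: linear_map_comp[OF u.linear[simplified] linear_map_fst]
      linear_map_comp[OF linear_map_comp[OF u.linear[simplified] linear_map_snd] linear_map_snd])
  \<comment> \<open>The path starts at c \<alpha> \<rho> b, follows \<eta> to v g \<rho> b and then
    v h to v b. On the image of g it reduces to \<eta>, since \<rho> g = id and h g = 0.\<close>
  define w where "w n b = (\<alpha> n (\<rho> n b), v n b, \<eta> n (\<rho> n b) \<oplus>\<^bsub>cx_mod Y (n - 1)\<^esub> v (n - 1) (h n b))" for n b
  have w: "fmor R B ?W w"
  proof (rule fmorI[OF g.B.filtered_complex_axioms c.filtered_complex_mapping_path])
    fix n
    have "linear_map R (cx_mod B n) (cx_mod Y (n - 1)) (\<lambda>b. \<eta> n (\<rho> n b) \<oplus>\<^bsub>cx_mod Y (n - 1)\<^esub> v (n - 1) (h n b))"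
      by (intro linear_map_fun_add g.B.module_cx c.B.module_cx linear_map_comp[OF \<rho>.linear lin(2)]
        linear_map_comp[OF linear_h v.linear])
    then show "linear_map R (cx_mod B n) (cx_mod ?W n) (w n)"
      unfolding w_def mapping_path_simps
      by (intro linear_map_pair linear_map_comp[OF \<rho>.linear lin(1)] v.linear)
  next
    fix n b assume b: "b \<in> cx_carrier B n"
    \<comment> \<open>The homotopy formula pushed forward along v; inserting it makes the
      intermediate point v g \<rho> b cancel.\<close>
    have db: "v n b = v n (g n (\<rho> n b)) \<oplus>\<^bsub>cx_mod Y n\<^esub> (cx_d Y (n - 1) (v (n - 1) (h n b)) \<oplus>\<^bsub>cx_mod Y n\<^esub> v n (h (n + 1) (cx_d B n b)))"
      using b by (subst homotopy[OF b, symmetric]) (simp add: v.add v.d_pred)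
    have cl: "v n (g n (\<rho> n b)) \<in> cx_carrier Y n" "cx_d Y (n - 1) (v (n - 1) (h n b)) \<in> cx_carrier Y n"
      "v n (h (n + 1) (cx_d B n b)) \<in> cx_carrier Y n" "c n (\<alpha> n (\<rho> n b)) \<in> cx_carrier Y n"
      "cx_d Y (n - 1) (\<eta> n (\<rho> n b)) \<in> cx_carrier Y n"
      using b uc[of "\<rho> n b" n] by auto
    have dd: "cx_d Y (n - 1) (\<eta> n (\<rho> n b) \<oplus>\<^bsub>cx_mod Y (n - 1)\<^esub> v (n - 1) (h n b)) =
      cx_d Y (n - 1) (\<eta> n (\<rho> n b)) \<oplus>\<^bsub>cx_mod Y n\<^esub> cx_d Y (n - 1) (v (n - 1) (h n b))"
      using b uc[of "\<rho> n b" n] by (simp add: c.B.d_pred_add)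
    have "\<eta> (n + 1) (\<rho> (n + 1) (cx_d B n b)) \<oplus>\<^bsub>cx_mod Y n\<^esub> v n (h (n + 1) (cx_d B n b)) =
      v n b \<ominus>\<^bsub>cx_mod Y n\<^esub> (c n (\<alpha> n (\<rho> n b)) \<oplus>\<^bsub>cx_mod Y n\<^esub>
        cx_d Y (n - 1) (\<eta> n (\<rho> n b) \<oplus>\<^bsub>cx_mod Y (n - 1)\<^esub> v (n - 1) (h n b)))"
      unfolding dd \<rho>.d[OF b] ud(2)[OF \<rho>.closed[OF b]] unfolding db using cl by algebra
    then show "w (n + 1) (cx_d B n b) = cx_d ?W n (w n b)"
      using b by (simp add: w_def v.d \<rho>.d ud)
  next
    fix p n b assume b: "b \<in> cx_F B p n"
    then show "w n b \<in> cx_F ?W p n"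
      using v.F[OF b] uF[OF \<rho>.F[OF b]] v.F[OF h_F[OF b]] by (simp add: w_def)
  qed
  moreover have "mor_eq A (w \<circ>\<^sub>m g) u"
    by (auto simp: mor_eq_def mor_comp_def w_def \<rho>_g h_g ux uc)
  moreover have "mor_eq B (mapping_path_proj \<circ>\<^sub>m w) v"
    by (auto simp: mor_eq_def mor_comp_def w_def mapping_path_proj_def)
  ultimately show "\<exists>w. fmor R B ?W w \<and> mor_eq A (w \<circ>\<^sub>m g) u \<and> mor_eq B (mapping_path_proj \<circ>\<^sub>m w) v"
    by blast
qed

section \<open>Quasi-isomorphisms\<close>

lemma (in module) a_minus_submodule:
  assumes H: "submodule H R M" and x: "x \<in> H" "y \<in> H"
  shows "x \<ominus>\<^bsub>M\<lparr>carrier := H\<rparr>\<^esub> y = x \<ominus>\<^bsub>M\<^esub> y"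
proof -
  interpret H: module R "M\<lparr>carrier := H\<rparr>"
    by (rule submodule.submodule_is_module[OF H module_axioms])
  have "\<ominus>\<^bsub>M\<lparr>carrier := H\<rparr>\<^esub> y = \<ominus>\<^bsub>M\<^esub> y"
    by (rule H.minus_equality) (use x submoduleE[OF H] in \<open>auto simp: M.l_neg subset_iff\<close>)
  then show ?thesis by (simp add: a_minus_def)
qed

context filtered_complex
begin

lemma submodule_Zcyc: "submodule (Zcyc k A p n) R (cx_mod A n)"
proof -
  have "Zcyc k A p n = cx_F A p n \<inter> {x \<in> cx_carrier A n. cx_d A n x \<in> cx_F A (p - int k) (n + 1)}"
    by (auto simp: Zcyc_def F_carrier)
  then show ?thesis
    by (simp add: cx.submodule_Int submodule_F submodule_vimage[OF module_cx module_cx linear_d])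
qed

lemma Bbdry_Suc_iff: "x \<in> Bbdry (Suc k) A p n \<longleftrightarrow>
    (\<exists>y\<in>Zcyc k A (p + int k) (n - 1). \<exists>z\<in>Zcyc k A (p - 1) n. x = cx_d A (n - 1) y \<oplus>\<^bsub>cx_mod A n\<^esub> z)"
  by (auto simp: set_add_def')

lemma submodule_Bbdry_Suc: "submodule (Bbdry (Suc k) A p n) R (cx_mod A n)"
  by (simp add: cx.submodule_set_add submodule_image[OF module_cx module_cx linear_d_pred] submodule_Zcyc)

text \<open>For y in Z_k at level p + k, d y lies in F_p and is a cycle. For z in Z_k at level p -
  1, d z lies in F_(p-1-k), which is the level p - (k + 1) asked for by Z_(k+1).\<close>

lemma Bbdry_Suc_subset: "Bbdry (Suc k) A p n \<subseteq> Zcyc (Suc k) A p n"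
proof
  fix x assume "x \<in> Bbdry (Suc k) A p n"
  then obtain y z where y: "y \<in> Zcyc k A (p + int k) (n - 1)" and z: "z \<in> Zcyc k A (p - 1) n"
    and x: "x = cx_d A (n - 1) y \<oplus>\<^bsub>cx_mod A n\<^esub> z"
    unfolding Bbdry_Suc_iff by blast
  have "y \<in> cx_carrier A (n - 1)" "z \<in> cx_carrier A n" "z \<in> cx_F A p n"
    using y z F_le[of z "p - 1" n p] by (auto simp: Zcyc_def intro: F_carrier)
  then show "x \<in> Zcyc (Suc k) A p n"
    using y z unfolding x by (auto simp: Zcyc_def d_add algebra_simps)
qed

lemma ZcycD:
  assumes "x \<in> Zcyc k A p n"
  shows "x \<in> cx_F A p n" "cx_d A n x \<in> cx_F A (p - int k) (n + 1)" "x \<in> cx_carrier A n"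
  using assms by (auto simp: Zcyc_def intro: F_carrier)

lemma Zcyc_minus: "x \<in> Zcyc k A p n \<Longrightarrow> y \<in> Zcyc k A p n \<Longrightarrow> x \<ominus>\<^bsub>cx_mod A n\<^esub> y \<in> Zcyc k A p n"
  by (rule cx.submodule_minus[OF submodule_Zcyc])

lemma Zcyc_add: "x \<in> Zcyc k A p n \<Longrightarrow> y \<in> Zcyc k A p n \<Longrightarrow> x \<oplus>\<^bsub>cx_mod A n\<^esub> y \<in> Zcyc k A p n"
  by (rule cx.submoduleE(5)[OF submodule_Zcyc])

end

context filtered_map
begin

lemma Zcyc: "x \<in> Zcyc k A p n \<Longrightarrow> f n x \<in> Zcyc k B p n"
  using F[of x p n] F[of "cx_d A n x" "p - int k" "n + 1"] A.ZcycD[of x k p n] d[of x n]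
  unfolding Zcyc_def mem_Collect_eq by metis

lemma Bbdry_Suc: "x \<in> Bbdry (Suc k) A p n \<Longrightarrow> f n x \<in> Bbdry (Suc k) B p n"
  unfolding A.Bbdry_Suc_iff B.Bbdry_Suc_iff
proof (elim bexE)
  fix y z assume y: "y \<in> Zcyc k A (p + int k) (n - 1)" and z: "z \<in> Zcyc k A (p - 1) n"
    and x: "x = cx_d A (n - 1) y \<oplus>\<^bsub>cx_mod A n\<^esub> z"
  have "f n x = cx_d B (n - 1) (f (n - 1) y) \<oplus>\<^bsub>cx_mod B n\<^esub> f n z"
    using A.ZcycD(3)[OF y] A.ZcycD(3)[OF z] by (simp add: x add d_pred)
  then show "\<exists>y\<in>Zcyc k B (p + int k) (n - 1). \<exists>z\<in>Zcyc k B (p - 1) n.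
      f n x = cx_d B (n - 1) y \<oplus>\<^bsub>cx_mod B n\<^esub> z"
    using Zcyc[OF y] Zcyc[OF z] by blast
qed

lemma quasi_iso_iff:
  "quasi_iso R r A B f \<longleftrightarrow>
    (\<forall>p n. (\<forall>x\<in>Zcyc (Suc r) A p n. f n x \<in> Bbdry (Suc r) B p n \<longrightarrow> x \<in> Bbdry (Suc r) A p n) \<and>
      (\<forall>y\<in>Zcyc (Suc r) B p n. \<exists>x\<in>Zcyc (Suc r) A p n. y \<ominus>\<^bsub>cx_mod B n\<^esub> f n x \<in> Bbdry (Suc r) B p n))"
proof -
  have "module_iso R (page (Suc r) A p n) (page (Suc r) B p n) (page_map (Suc r) B f p n) \<longleftrightarrow>
      (\<forall>x\<in>Zcyc (Suc r) A p n. f n x \<in> Bbdry (Suc r) B p n \<longrightarrow> x \<in> Bbdry (Suc r) A p n) \<and>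
      (\<forall>y\<in>Zcyc (Suc r) B p n. \<exists>x\<in>Zcyc (Suc r) A p n. y \<ominus>\<^bsub>cx_mod B n\<^esub> f n x \<in> Bbdry (Suc r) B p n)" for p n
  proof -
    let ?M = "cx_mod A n\<lparr>carrier := Zcyc (Suc r) A p n\<rparr>" and ?M' = "cx_mod B n\<lparr>carrier := Zcyc (Suc r) B p n\<rparr>"
    have "module_iso R (page (Suc r) A p n) (page (Suc r) B p n) (page_map (Suc r) B f p n) \<longleftrightarrow>
      (\<forall>x\<in>carrier ?M. f n x \<in> Bbdry (Suc r) B p n \<longrightarrow> x \<in> Bbdry (Suc r) A p n) \<and>
      (\<forall>y\<in>carrier ?M'. \<exists>x\<in>carrier ?M. y \<ominus>\<^bsub>?M'\<^esub> f n x \<in> Bbdry (Suc r) B p n)"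
      unfolding page_def page_map_def
    proof (rule module_iso_quot_map_iff)
      show "module R ?M" "module R ?M'"
        using submodule.submodule_is_module[OF A.submodule_Zcyc A.module_cx]
          submodule.submodule_is_module[OF B.submodule_Zcyc B.module_cx] by blast+
      show "submodule (Bbdry (Suc r) A p n) R ?M" "submodule (Bbdry (Suc r) B p n) R ?M'"
        by (intro A.cx.submodule_of_submodule A.submodule_Bbdry_Suc A.submodule_Zcyc A.Bbdry_Suc_subset
          B.cx.submodule_of_submodule B.submodule_Bbdry_Suc B.submodule_Zcyc B.Bbdry_Suc_subset)+
      show "linear_map R ?M ?M' (f n)"
        by (rule linear_mapI) (auto simp: Zcyc add[OF A.ZcycD(3) A.ZcycD(3)] smult[OF _ A.ZcycD(3)])
      show "f n ` Bbdry (Suc r) A p n \<subseteq> Bbdry (Suc r) B p n"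
        using Bbdry_Suc by blast
    qed
    \<comment> \<open>Subtraction so far belongs to the record with carrier \<open>Zcyc\<close>;
      here it is replaced by subtraction in the ambient module.\<close>
    also have "(\<forall>y\<in>carrier ?M'. \<exists>x\<in>carrier ?M. y \<ominus>\<^bsub>?M'\<^esub> f n x \<in> Bbdry (Suc r) B p n) \<longleftrightarrow>
      (\<forall>y\<in>Zcyc (Suc r) B p n. \<exists>x\<in>Zcyc (Suc r) A p n. y \<ominus>\<^bsub>cx_mod B n\<^esub> f n x \<in> Bbdry (Suc r) B p n)"
      using Zcyc by (auto simp: B.cx.a_minus_submodule[OF B.submodule_Zcyc] simp del: Bbdry.simps intro!: ball_cong bex_cong)
    finally show ?thesis by simp
  qed
  then show ?thesis by (simp add: quasi_iso_def fmor del: Bbdry.simps)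
qed

end

text \<open>On pages, \<rho> is a left inverse of g, which gives injectivity. For surjectivity, y -
  g \<rho> y = d h y + h d y exhibits the difference as a boundary: h y has level p + r and h d y
  has level p - (r + 1) + r = p - 1.\<close>

lemma (in def_retract) quasi_iso: "quasi_iso R r A B g"
  unfolding g.quasi_iso_iff
proof (intro allI conjI ballI impI)
  fix p n x assume x: "x \<in> Zcyc (Suc r) A p n" "g n x \<in> Bbdry (Suc r) B p n"
  then show "x \<in> Bbdry (Suc r) A p n"
    using \<rho>.Bbdry_Suc[OF x(2)] \<rho>_g[OF g.A.ZcycD(3)[OF x(1)]] by simp
next
  fix p n y assume y: "y \<in> Zcyc (Suc r) B p n"
  note yD = g.B.ZcycD[OF y]
  let ?z = "h (n + 1) (cx_d B n y)"
  have c: "g n (\<rho> n y) \<in> cx_carrier B n" "cx_d B (n - 1) (h n y) \<in> cx_carrier B n" "?z \<in> cx_carrier B n"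
    using yD by auto
  have hy: "h n y \<in> cx_F B (p + int r) (n - 1)" by (rule h_F[OF yD(1)])
  have z: "?z \<in> cx_F B (p - 1) n"
    using h_succ_F[OF yD(2)] by (simp add: algebra_simps)
  have gy: "g n (\<rho> n y) \<in> Zcyc (Suc r) B p n"
    by (intro g.Zcyc \<rho>.Zcyc y)
  \<comment> \<open>Each of the two terms is y - g \<rho> y minus the other. For d h y this yields
    its filtration level, for h d y the level of its differential. \<open>subst (2)\<close> expands
    only the free-standing \<open>y\<close>, not the one under h.\<close>
  have e: "cx_d B (n - 1) (h n y) = y \<ominus>\<^bsub>cx_mod B n\<^esub> g n (\<rho> n y) \<ominus>\<^bsub>cx_mod B n\<^esub> ?z"
    by (subst (2) homotopy[OF yD(3), symmetric]) (use c in algebra)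
  have e': "?z = y \<ominus>\<^bsub>cx_mod B n\<^esub> g n (\<rho> n y) \<ominus>\<^bsub>cx_mod B n\<^esub> cx_d B (n - 1) (h n y)"
    by (subst (2) homotopy[OF yD(3), symmetric]) (use c in algebra)
  have "cx_d B (n - 1) (h n y) \<in> cx_F B p n"
    unfolding e using yD(1) g.B.ZcycD(1)[OF gy] g.B.F_le[OF z] by (intro g.B.F_minus) auto
  then have hZ: "h n y \<in> Zcyc r B (p + int r) (n - 1)"
    using hy by (simp add: Zcyc_def)
  have "cx_d B n ?z = cx_d B n y \<ominus>\<^bsub>cx_mod B (n + 1)\<^esub> cx_d B n (g n (\<rho> n y))"
    unfolding e' using c yD by (simp add: g.B.d_minus)
  then have "cx_d B n ?z \<in> cx_F B (p - int (Suc r)) (n + 1)"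
    using yD(2) g.B.ZcycD(2)[OF gy] by simp
  then have zZ: "?z \<in> Zcyc r B (p - 1) n"
    using z by (simp add: Zcyc_def algebra_simps)
  have "y \<ominus>\<^bsub>cx_mod B n\<^esub> g n (\<rho> n y) = cx_d B (n - 1) (h n y) \<oplus>\<^bsub>cx_mod B n\<^esub> ?z"
    by (subst (1) homotopy[OF yD(3), symmetric]) (use c in algebra)
  then show "\<exists>x\<in>Zcyc (Suc r) A p n. y \<ominus>\<^bsub>cx_mod B n\<^esub> g n x \<in> Bbdry (Suc r) B p n"
    using \<rho>.Zcyc[OF y] hZ zZ unfolding g.B.Bbdry_Suc_iff by blast
qed


section \<open>Acyclic fibrations\<close>

lemma rank_one_simps [simp]:
  "carrier (rank_one R c m) = (if c m then carrier R else {\<zero>\<^bsub>R\<^esub>})"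
  "\<zero>\<^bsub>rank_one R c m\<^esub> = \<zero>\<^bsub>R\<^esub>"
  "x \<oplus>\<^bsub>rank_one R c m\<^esub> y = x \<oplus>\<^bsub>R\<^esub> y"
  "a \<odot>\<^bsub>rank_one R c m\<^esub> x = a \<otimes>\<^bsub>R\<^esub> x"
  by (simp_all add: rank_one_def ring_as_module_def)

lemma ZZ_simps [simp]:
  "cx_mod (ZZ R k p n) = rank_one R (\<lambda>m. m = n \<or> m = n + 1)"
  "cx_d (ZZ R k p n) m x = (if m = n then x else \<zero>\<^bsub>R\<^esub>)"
  "cx_F (ZZ R k p n) q m = (if m = n \<and> p \<le> q \<or> m = n + 1 \<and> p - int k \<le> q then carrier R else {\<zero>\<^bsub>R\<^esub>})"
  by (simp_all add: ZZ_def)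

lemma module_ring_as_module: "cring R \<Longrightarrow> module R (ring_as_module R)"
proof -
  assume "cring R"
  then interpret cring R .
  have "abelian_group (ring_as_module R)"
    by (rule abelian_groupI) (auto simp: ring_as_module_def a_ac intro: bexI[of _ "\<ominus>\<^bsub>R\<^esub> x" for x] l_neg)
  then show ?thesis
    by (intro moduleI \<open>cring R\<close>) (auto simp: ring_as_module_def l_distr r_distr m_assoc)
qed

lemma filtered_complex_ZZ:
  assumes "cring R"
  shows "filtered_complex R (ZZ R k p n)"
proof (rule filtered_complex.intro)
  interpret R: cring R by fact
  interpret M: module R "ring_as_module R" by (rule module_ring_as_module) fact
  have car: "submodule (carrier R) R (ring_as_module R)"
    using M.carrier_is_submodule by (simp add: ring_as_module_def)
  have null: "submodule {\<zero>\<^bsub>R\<^esub>} R (ring_as_module R)"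
    using M.a_inv_zero by (intro M.submoduleI) (auto simp: ring_as_module_def)
  have H: "submodule (if P then carrier R else {\<zero>\<^bsub>R\<^esub>}) R (ring_as_module R)" for P
    using car null by simp
  show "module R (cx_mod (ZZ R k p n) m)" for m
    unfolding ZZ_simps rank_one_def by (rule submodule.submodule_is_module[OF H M.module_axioms])
  show "submodule (cx_F (ZZ R k p n) q m) R (cx_mod (ZZ R k p n) m)" for q m
    unfolding ZZ_simps rank_one_def by (rule M.submodule_of_submodule[OF H H]) auto
  show "linear_map R (cx_mod (ZZ R k p n) m) (cx_mod (ZZ R k p n) (m + 1)) (cx_d (ZZ R k p n) m)" for m
    by (rule linear_mapI) auto
qed (auto simp: cring.cring_simprules(2)[OF assms] split: if_splits)

text \<open>The morphism out of \<open>ZZ R k p n\<close> classified by x: the generator in degree n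
  goes to x, the one in degree n + 1 to d x. By \<open>fmor_cell_map\<close> and
  \<open>fmor_ZZ\<close>, such morphisms are the same as elements of \<open>Zcyc k X p n\<close>, in
  other words \<open>ZZ\<close> represents Z_k.\<close>

definition cell_map :: "('r, 'a) fcomplex \<Rightarrow> int \<Rightarrow> 'a \<Rightarrow> int \<Rightarrow> 'r \<Rightarrow> 'a" where
  "cell_map X n x m a =
     (if m = n then a \<odot>\<^bsub>cx_mod X n\<^esub> x
      else if m = n + 1 then a \<odot>\<^bsub>cx_mod X (n + 1)\<^esub> cx_d X n x else \<zero>\<^bsub>cx_mod X m\<^esub>)"

lemma (in filtered_complex) fmor_cell_map:
  assumes x: "x \<in> Zcyc k A p n"
  shows "fmor R (ZZ R k p n) A (cell_map A n x)"
proof (rule fmorI[OF filtered_complex_ZZ filtered_complex_axioms])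
  note xD = ZcycD[OF x]
  show "cring R" by (rule cx.R.is_cring)
  show "linear_map R (cx_mod (ZZ R k p n) m) (cx_mod A m) (cell_map A n x m)" for m
    by (rule linear_mapI)
      (use xD in \<open>auto simp: cell_map_def cx.smult_l_distr cx.smult_assoc1 split: if_splits\<close>)
  show "cell_map A n x (m + 1) (cx_d (ZZ R k p n) m a) = cx_d A m (cell_map A n x m a)"
    if "a \<in> cx_carrier (ZZ R k p n) m" for m a
    using xD that by (auto simp: cell_map_def d_smult d_d split: if_splits)
  show "cell_map A n x m a \<in> cx_F A q m" if "a \<in> cx_F (ZZ R k p n) q m" for q m a
    using xD that F_le[OF xD(1), of q] F_le[OF xD(2), of q]
    by (auto simp: cell_map_def split: if_splits)
qed

lemma fmor_ZZ:
  assumes g: "fmor R (ZZ R k p n) Y g"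
  shows "g n \<one>\<^bsub>R\<^esub> \<in> Zcyc k Y p n"
    and "a \<in> cx_carrier (ZZ R k p n) m \<Longrightarrow> g m a = cell_map Y n (g n \<one>\<^bsub>R\<^esub>) m a"
proof -
  interpret g: filtered_map R "ZZ R k p n" Y g by (rule filtered_mapI[OF g])
  interpret R: cring R by (rule g.A.cx.R.is_cring)
  have d1: "cx_d Y n (g n \<one>\<^bsub>R\<^esub>) = g (n + 1) \<one>\<^bsub>R\<^esub>"
    using g.d[of "\<one>\<^bsub>R\<^esub>" n] by simp
  show "g n \<one>\<^bsub>R\<^esub> \<in> Zcyc k Y p n"
    using g.F[of "\<one>\<^bsub>R\<^esub>" p n] g.F[of "\<one>\<^bsub>R\<^esub>" "p - int k" "n + 1"] by (simp add: Zcyc_def d1)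
  show "g m a = cell_map Y n (g n \<one>\<^bsub>R\<^esub>) m a" if a: "a \<in> cx_carrier (ZZ R k p n) m"
    using a g.smult[of a "\<one>\<^bsub>R\<^esub>" n] g.smult[of a "\<one>\<^bsub>R\<^esub>" "n + 1"] g.zero[of m]
    by (auto simp: cell_map_def d1 split: if_splits)
qed

lemma (in filtered_map) cell_map:
  assumes x: "x \<in> cx_carrier A n" and a: "a \<in> cx_carrier (ZZ R k p n) m"
  shows "f m (cell_map A n x m a) = cell_map B n (f n x) m a"
  using assms by (auto simp: cell_map_def smult d split: if_splits)

text \<open>Since \<open>ZZ\<close> represents Z_s, a square is an element y of Z_s(Y) and a lift is
  a preimage of y in Z_s(X).\<close>

lemma lifts_ZZ:
  assumes q: "fmor R X Y q"
    and surj: "\<And>y. y \<in> Zcyc s Y p n \<Longrightarrow> \<exists>x\<in>Zcyc s X p n. q n x = y"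
  shows "lifts R (zero_cx R) (ZZ R s p n) (\<lambda>_ _. \<zero>\<^bsub>R\<^esub>) X Y q"
  unfolding lifts_def
proof (intro allI impI, elim conjE)
  fix f g assume f: "fmor R (zero_cx R) X f" and g: "fmor R (ZZ R s p n) Y g"
  interpret q: filtered_map R X Y q by (rule filtered_mapI[OF q])
  interpret f: filtered_map R "zero_cx R" X f by (rule filtered_mapI[OF f])
  obtain x where x: "x \<in> Zcyc s X p n" "q n x = g n \<one>\<^bsub>R\<^esub>"
    using surj[OF fmor_ZZ(1)[OF g]] by blast
  have h: "fmor R (ZZ R s p n) X (cell_map X n x)"
    by (rule q.A.fmor_cell_map[OF x(1)])
  interpret h: filtered_map R "ZZ R s p n" X "cell_map X n x" by (rule filtered_mapI[OF h])
  have "mor_eq (zero_cx R) (cell_map X n x \<circ>\<^sub>m (\<lambda>_ _. \<zero>\<^bsub>R\<^esub>)) f"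
    using h.zero f.zero by (auto simp: mor_eq_def mor_comp_def zero_cx_def)
  moreover have "mor_eq (ZZ R s p n) (q \<circ>\<^sub>m cell_map X n x) g"
    unfolding mor_eq_def mor_comp_def
    by (intro allI ballI, subst q.cell_map[OF q.A.ZcycD(3)[OF x(1)]], assumption,
      subst fmor_ZZ(2)[OF g], assumption, simp only: x(2))
  ultimately show "\<exists>h. fmor R (ZZ R s p n) X h \<and> mor_eq (zero_cx R) (h \<circ>\<^sub>m (\<lambda>_ _. \<zero>\<^bsub>R\<^esub>)) f \<and>
      mor_eq (ZZ R s p n) (q \<circ>\<^sub>m h) g"
    using h by blast
qed

lemma direct_sum_simps [simp]:
  "cx_mod (direct_sum A B) n = prod_module (cx_mod A n) (cx_mod B n)"
  "cx_d (direct_sum A B) n x = (cx_d A n (fst x), cx_d B n (snd x))"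
  "cx_F (direct_sum A B) p n = cx_F A p n \<times> cx_F B p n"
  by (simp_all add: direct_sum_def)

lemma fmor_copair:
  assumes f: "fmor R A X f" and g: "fmor R B X g" and AB: "filtered_complex R (direct_sum A B)"
  shows "fmor R (direct_sum A B) X (\<lambda>m x. f m (fst x) \<oplus>\<^bsub>cx_mod X m\<^esub> g m (snd x))"
proof -
  interpret f: filtered_map R A X f by (rule filtered_mapI[OF f])
  interpret g: filtered_map R B X g by (rule filtered_mapI[OF g])
  show ?thesis
  proof (rule fmorI[OF AB f.B.filtered_complex_axioms])
    show "linear_map R (cx_mod (direct_sum A B) n) (cx_mod X n) (\<lambda>x. f n (fst x) \<oplus>\<^bsub>cx_mod X n\<^esub> g n (snd x))" for n
      unfolding direct_sum_simps
      by (intro linear_map_fun_add module_prod_module f.A.module_cx f.B.module_cx g.A.module_cx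
        linear_map_comp[OF linear_map_fst f.linear] linear_map_comp[OF linear_map_snd g.linear])
  qed (auto simp: f.d g.d f.B.d_add f.F g.F)
qed

lemma fmor_direct_sum_split:
  assumes g: "fmor R (direct_sum A B) X g" and A: "filtered_complex R A" and B: "filtered_complex R B"
  shows "fmor R A X (\<lambda>m a. g m (a, \<zero>\<^bsub>cx_mod B m\<^esub>))" and "fmor R B X (\<lambda>m b. g m (\<zero>\<^bsub>cx_mod A m\<^esub>, b))"
    and "a \<in> cx_carrier A m \<Longrightarrow> b \<in> cx_carrier B m \<Longrightarrow>
      g m (a, b) = g m (a, \<zero>\<^bsub>cx_mod B m\<^esub>) \<oplus>\<^bsub>cx_mod X m\<^esub> g m (\<zero>\<^bsub>cx_mod A m\<^esub>, b)"
proof -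
  interpret g: filtered_map R "direct_sum A B" X g by (rule filtered_mapI[OF g])
  interpret A: filtered_complex R A by fact
  interpret B: filtered_complex R B by fact
  have "fmor R A (direct_sum A B) (\<lambda>m a. (a, \<zero>\<^bsub>cx_mod B m\<^esub>))"
    by (rule fmorI[OF A g.A.filtered_complex_axioms]) (auto intro!: linear_mapI)
  from fmor_comp[OF this g] show "fmor R A X (\<lambda>m a. g m (a, \<zero>\<^bsub>cx_mod B m\<^esub>))"
    by (simp add: mor_comp_def[abs_def])
  have "fmor R B (direct_sum A B) (\<lambda>m b. (\<zero>\<^bsub>cx_mod A m\<^esub>, b))"
    by (rule fmorI[OF B g.A.filtered_complex_axioms]) (auto intro!: linear_mapI)
  from fmor_comp[OF this g] show "fmor R B X (\<lambda>m b. g m (\<zero>\<^bsub>cx_mod A m\<^esub>, b))"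
    by (simp add: mor_comp_def[abs_def])
  show "g m (a, b) = g m (a, \<zero>\<^bsub>cx_mod B m\<^esub>) \<oplus>\<^bsub>cx_mod X m\<^esub> g m (\<zero>\<^bsub>cx_mod A m\<^esub>, b)"
    if "a \<in> cx_carrier A m" "b \<in> cx_carrier B m"
    using g.add[of "(a, \<zero>\<^bsub>cx_mod B m\<^esub>)" m "(\<zero>\<^bsub>cx_mod A m\<^esub>, b)"] that by simp
qed

text \<open>Read in elements, a square consists of w in Z_(r+1)(X) and a presentation q w = d b1 +
  b2 of its image as a boundary; a lift is a presentation of w lying over it. The summand d b1
  arises because the first summand of \<open>BB\<close> starts in degree n - 1, so its unit in
  degree n is the differential of its generator.\<close>

lemma lifts_phi:
  assumes q: "fmor R X Y q"
    and lift: "\<And>w b1 b2. w \<in> Zcyc (Suc r) X p n \<Longrightarrow> b1 \<in> Zcyc r Y (p + int r) (n - 1) \<Longrightarrow> b2 \<in> Zcyc r Y (p - 1) n \<Longrightarrow>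
      q n w = cx_d Y (n - 1) b1 \<oplus>\<^bsub>cx_mod Y n\<^esub> b2 \<Longrightarrow>
      \<exists>w1\<in>Zcyc r X (p + int r) (n - 1). \<exists>w2\<in>Zcyc r X (p - 1) n.
        w = cx_d X (n - 1) w1 \<oplus>\<^bsub>cx_mod X n\<^esub> w2 \<and> q (n - 1) w1 = b1 \<and> q n w2 = b2"
  shows "lifts R (ZZ R (r + 1) p n) (BB R (r + 1) p n) (phi R n) X Y q"
  unfolding lifts_def
proof (intro allI impI, elim conjE)
  let ?Z1 = "ZZ R r (p + int r) (n - 1)" and ?Z2 = "ZZ R r (p - 1) n"
  have BB: "BB R (r + 1) p n = direct_sum ?Z1 ?Z2" by (simp add: BB_def)
  fix f g assume f: "fmor R (ZZ R (r + 1) p n) X f" and g: "fmor R (BB R (r + 1) p n) Y g"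
    and eq: "mor_eq (ZZ R (r + 1) p n) (g \<circ>\<^sub>m phi R n) (q \<circ>\<^sub>m f)"
  interpret q: filtered_map R X Y q by (rule filtered_mapI[OF q])
  have Z: "filtered_complex R ?Z1" "filtered_complex R ?Z2"
    by (rule filtered_complex_ZZ[OF q.A.cx.R.is_cring])+
  note g' = g[unfolded BB]
  note gs = fmor_direct_sum_split[OF g' Z]
  \<comment> \<open>Images of the three generators that determine f and g; b1 lives one degree lower
    than w and b2.\<close>
  define w b1 b2 where "w = f n \<one>\<^bsub>R\<^esub>" and "b1 = g (n - 1) (\<one>\<^bsub>R\<^esub>, \<zero>\<^bsub>R\<^esub>)" and "b2 = g n (\<zero>\<^bsub>R\<^esub>, \<one>\<^bsub>R\<^esub>)"
  have w: "w \<in> Zcyc (Suc r) X p n" unfolding w_def using fmor_ZZ(1)[OF f] by simp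
  have b1: "b1 \<in> Zcyc r Y (p + int r) (n - 1)" using fmor_ZZ(1)[OF gs(1)] by (simp add: b1_def)
  have b2: "b2 \<in> Zcyc r Y (p - 1) n" using fmor_ZZ(1)[OF gs(2)] by (simp add: b2_def)
  have g1: "g m (a, \<zero>\<^bsub>R\<^esub>) = cell_map Y (n - 1) b1 m a" if "a \<in> cx_carrier ?Z1 m" for a m
    unfolding b1_def by (rule fmor_ZZ(2)[OF gs(1) that, simplified rank_one_simps ZZ_simps])
  have g2: "g m (\<zero>\<^bsub>R\<^esub>, b) = cell_map Y n b2 m b" if "b \<in> cx_carrier ?Z2 m" for b m
    unfolding b2_def by (rule fmor_ZZ(2)[OF gs(2) that, simplified rank_one_simps ZZ_simps])
  have g12: "g m (a, b) = cell_map Y (n - 1) b1 m a \<oplus>\<^bsub>cx_mod Y m\<^esub> cell_map Y n b2 m b"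
    if ab: "a \<in> cx_carrier ?Z1 m" "b \<in> cx_carrier ?Z2 m" for m a b
    using gs(3)[OF ab] g1[OF ab(1)] g2[OF ab(2)] by simp
  have "q n w = g n (\<one>\<^bsub>R\<^esub>, \<one>\<^bsub>R\<^esub>)"
    using eq[unfolded mor_eq_def mor_comp_def, rule_format, of "\<one>\<^bsub>R\<^esub>" n] by (simp add: phi_def w_def)
  also have "\<dots> = cx_d Y (n - 1) b1 \<oplus>\<^bsub>cx_mod Y n\<^esub> b2"
    using q.B.ZcycD(3)[OF b1] q.B.ZcycD(3)[OF b2] by (subst g12) (auto simp: cell_map_def)
  finally obtain w1 w2 where w1: "w1 \<in> Zcyc r X (p + int r) (n - 1)" "q (n - 1) w1 = b1"
    and w2: "w2 \<in> Zcyc r X (p - 1) n" "q n w2 = b2" and ww: "w = cx_d X (n - 1) w1 \<oplus>\<^bsub>cx_mod X n\<^esub> w2"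
    using lift[OF w b1 b2] by blast
  note wc = q.A.ZcycD(3)[OF w1(1)] q.A.ZcycD(3)[OF w2(1)]
  define h where "h m x = cell_map X (n - 1) w1 m (fst x) \<oplus>\<^bsub>cx_mod X m\<^esub> cell_map X n w2 m (snd x)" for m x
  note h1 = q.A.fmor_cell_map[OF w1(1)] and h2 = q.A.fmor_cell_map[OF w2(1)]
  interpret h1: filtered_map R ?Z1 X "cell_map X (n - 1) w1" by (rule filtered_mapI[OF h1])
  interpret h2: filtered_map R ?Z2 X "cell_map X n w2" by (rule filtered_mapI[OF h2])
  have "fmor R (BB R (r + 1) p n) X h"
    unfolding BB h_def[abs_def] by (rule fmor_copair[OF h1 h2 fmor_dom[OF g']])
  moreover have "mor_eq (ZZ R (r + 1) p n) (h \<circ>\<^sub>m phi R n) f"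
    unfolding mor_eq_def mor_comp_def
  proof (intro allI ballI)
    fix m x assume x: "x \<in> cx_carrier (ZZ R (r + 1) p n) m"
    have fx: "f m x = cell_map X n w m x" unfolding w_def by (rule fmor_ZZ(2)[OF f x])
    consider "m = n" "x \<in> carrier R" | "m = n + 1" "x \<in> carrier R" | "m \<noteq> n" "m \<noteq> n + 1" "x = \<zero>\<^bsub>R\<^esub>"
      using x by (auto split: if_splits)
    then show "h m (phi R n m x) = f m x"
    proof cases
      case 1
      then show ?thesis using wc unfolding fx
        by (simp add: h_def phi_def cell_map_def ww q.A.cx.smult_r_distr)
    next
      case 2
      then show ?thesis using wc unfolding fx
        by (simp add: h_def phi_def cell_map_def ww q.A.d_add)
    next
      case 3
      then show ?thesis using h1.zero[of m] h2.zero[of m] unfolding fx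
        by (simp add: h_def phi_def) (simp add: cell_map_def)
    qed
  qed
  moreover have "mor_eq (BB R (r + 1) p n) (q \<circ>\<^sub>m h) g"
    unfolding mor_eq_def mor_comp_def BB
  proof (intro allI ballI)
    fix m x assume "x \<in> cx_carrier (direct_sum ?Z1 ?Z2) m"
    then obtain a b where x: "x = (a, b)" and a: "a \<in> cx_carrier ?Z1 m" and b: "b \<in> cx_carrier ?Z2 m"
      by auto
    show "q m (h m x) = g m x"
      using q.cell_map[OF wc(1) a] q.cell_map[OF wc(2) b] q.add[OF h1.closed[OF a] h2.closed[OF b]] g12[OF a b]
      by (simp add: h_def x w1 w2)
  qed
  ultimately show "\<exists>h. fmor R (BB R (r + 1) p n) X h \<and> mor_eq (ZZ R (r + 1) p n) (h \<circ>\<^sub>m phi R n) f \<and>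
      mor_eq (BB R (r + 1) p n) (q \<circ>\<^sub>m h) g"
    by blast
qed

section \<open>Acyclic fibrations from conditions on pages and cycles\<close>

context filtered_map
begin

text \<open>Injectivity on E_(r+1) yields some presentation w = d v1 + v2, but its image need not be
  the prescribed (b1, b2). The discrepancy c = b1 - f v1 lies in Z_(r+1) and has a preimage y of the
  same kind, by surjectivity on E_(r+1) and on Z_r. Moving d y from one summand to the other
  corrects the presentation.\<close>

lemma lift_boundary:
  assumes qi: "quasi_iso R r A B f"
    and surj: "\<And>p n y. y \<in> Zcyc r B p n \<Longrightarrow> \<exists>x\<in>Zcyc r A p n. f n x = y"
    and w: "w \<in> Zcyc (Suc r) A p n" and b1: "b1 \<in> Zcyc r B (p + int r) (n - 1)" and b2: "b2 \<in> Zcyc r B (p - 1) n"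
    and fw: "f n w = cx_d B (n - 1) b1 \<oplus>\<^bsub>cx_mod B n\<^esub> b2"
  shows "\<exists>w1\<in>Zcyc r A (p + int r) (n - 1). \<exists>w2\<in>Zcyc r A (p - 1) n.
    w = cx_d A (n - 1) w1 \<oplus>\<^bsub>cx_mod A n\<^esub> w2 \<and> f (n - 1) w1 = b1 \<and> f n w2 = b2"
proof -
  note qi' = qi[unfolded quasi_iso_iff, rule_format]
  have "f n w \<in> Bbdry (Suc r) B p n" unfolding B.Bbdry_Suc_iff using fw b1 b2 by blast
  then have "w \<in> Bbdry (Suc r) A p n" using qi' w by blast
  then obtain v1 v2 where v1: "v1 \<in> Zcyc r A (p + int r) (n - 1)" and v2: "v2 \<in> Zcyc r A (p - 1) n"
    and wv: "w = cx_d A (n - 1) v1 \<oplus>\<^bsub>cx_mod A n\<^esub> v2" unfolding A.Bbdry_Suc_iff by blast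
  note wD = A.ZcycD[OF w] and v1D = A.ZcycD[OF v1] and v2D = A.ZcycD[OF v2]
    and b1D = B.ZcycD[OF b1] and b2D = B.ZcycD[OF b2]
  define c where "c = b1 \<ominus>\<^bsub>cx_mod B (n - 1)\<^esub> f (n - 1) v1"
  have cc: "c \<in> cx_carrier B (n - 1)" using b1D v1D by (simp add: c_def)
  have dc: "cx_d B (n - 1) c = f n v2 \<ominus>\<^bsub>cx_mod B n\<^esub> b2"
  proof -
    have cl: "cx_d B (n - 1) b1 \<in> cx_carrier B n" "b2 \<in> cx_carrier B n" "f n v2 \<in> cx_carrier B n"
      "cx_d B (n - 1) (f (n - 1) v1) \<in> cx_carrier B n"
      using b1D b2D v1D v2D by auto
    have e: "cx_d B (n - 1) b1 \<oplus>\<^bsub>cx_mod B n\<^esub> b2 = cx_d B (n - 1) (f (n - 1) v1) \<oplus>\<^bsub>cx_mod B n\<^esub> f n v2"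
      using v1D v2D by (simp add: fw[symmetric] wv add d_pred)
    have "cx_d B (n - 1) c = cx_d B (n - 1) b1 \<ominus>\<^bsub>cx_mod B n\<^esub> cx_d B (n - 1) (f (n - 1) v1)"
      using b1D v1D by (simp add: c_def B.d_pred_minus)
    also have "\<dots> = (cx_d B (n - 1) b1 \<oplus>\<^bsub>cx_mod B n\<^esub> b2) \<ominus>\<^bsub>cx_mod B n\<^esub> b2 \<ominus>\<^bsub>cx_mod B n\<^esub> cx_d B (n - 1) (f (n - 1) v1)"
      using cl by algebra
    also have "\<dots> = f n v2 \<ominus>\<^bsub>cx_mod B n\<^esub> b2"
      unfolding e using cl by algebra
    finally show ?thesis .
  qed
  \<comment> \<open>One page better than b1 and v1 themselves: p - 1 = (p + r) - (r + 1), and d b1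
    differs from d f v1 by terms of level p - 1.\<close>
  have cZ: "c \<in> Zcyc (Suc r) B (p + int r) (n - 1)"
  proof -
    have "c \<in> cx_F B (p + int r) (n - 1)"
      unfolding c_def using b1D(1) F[OF v1D(1)] by simp
    moreover have "cx_d B (n - 1) c \<in> cx_F B (p - 1) n"
      unfolding dc using b2D(1) F[OF v2D(1)] by simp
    ultimately show ?thesis by (simp add: Zcyc_def)
  qed
  obtain x where x: "x \<in> Zcyc (Suc r) A (p + int r) (n - 1)"
    and cx: "c \<ominus>\<^bsub>cx_mod B (n - 1)\<^esub> f (n - 1) x \<in> Bbdry (Suc r) B (p + int r) (n - 1)"
    using qi' cZ by blast
  from cx obtain e1 e2 where e1: "e1 \<in> Zcyc r B (p + int r + int r) (n - 1 - 1)" and e2: "e2 \<in> Zcyc r B (p + int r - 1) (n - 1)"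
    and ce: "c \<ominus>\<^bsub>cx_mod B (n - 1)\<^esub> f (n - 1) x = cx_d B (n - 1 - 1) e1 \<oplus>\<^bsub>cx_mod B (n - 1)\<^esub> e2"
    unfolding B.Bbdry_Suc_iff by blast
  obtain u1 where u1: "u1 \<in> Zcyc r A (p + int r + int r) (n - 1 - 1)" "f (n - 1 - 1) u1 = e1"
    using surj[OF e1] by blast
  obtain u2 where u2: "u2 \<in> Zcyc r A (p + int r - 1) (n - 1)" "f (n - 1) u2 = e2"
    using surj[OF e2] by blast
  note xD = A.ZcycD[OF x] and u1D = A.ZcycD[OF u1(1)] and u2D = A.ZcycD[OF u2(1)]
  \<comment> \<open>Lifting e1 and e2 through Z_r removes the boundary error, so that y maps to c
    itself and not only to its class. The term d u1 does not affect d y.\<close>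
  define y where "y = x \<oplus>\<^bsub>cx_mod A (n - 1)\<^esub> (cx_d A (n - 1 - 1) u1 \<oplus>\<^bsub>cx_mod A (n - 1)\<^esub> u2)"
  have u1c: "cx_d A (n - 1 - 1) u1 \<in> cx_carrier A (n - 1)" using u1D(3) by (rule A.d_pred_closed)
  have yc: "y \<in> cx_carrier A (n - 1)" unfolding y_def using xD u1c u2D by simp
  have fy: "f (n - 1) y = c"
  proof -
    have "f (n - 1) y = f (n - 1) x \<oplus>\<^bsub>cx_mod B (n - 1)\<^esub> (c \<ominus>\<^bsub>cx_mod B (n - 1)\<^esub> f (n - 1) x)"
      unfolding y_def ce using xD u1c u2D u2(2) u1(2) d_pred[OF u1D(3)] by (simp add: add)
    also have "\<dots> = c" using cc closed[OF xD(3)] by algebra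
    finally show ?thesis .
  qed
  have "cx_d A (n - 1) (cx_d A (n - 1 - 1) u1) = \<zero>\<^bsub>cx_mod A n\<^esub>"
    using A.d_d_pred[OF u1D(3)] by simp
  then have dy: "cx_d A (n - 1) y = cx_d A (n - 1) x \<oplus>\<^bsub>cx_mod A n\<^esub> cx_d A (n - 1) u2"
    unfolding y_def using xD u1c u2D by (simp add: A.d_pred_add)
  have "cx_d A (n - 1) x \<in> cx_F A (p - 1) n" "cx_d A (n - 1) u2 \<in> cx_F A (p - 1) n"
    using xD(2) u2D(2) by (simp_all add: algebra_simps)
  then have dyF: "cx_d A (n - 1) y \<in> cx_F A (p - 1) n" unfolding dy by simp
  have yZ: "y \<in> Zcyc r A (p + int r) (n - 1)"
  proof -
    have "cx_d A (n - 1 - 1) u1 \<in> cx_F A (p + int r) (n - 1)"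
      using u1D(2) by (simp add: algebra_simps)
    then have "y \<in> cx_F A (p + int r) (n - 1)"
      unfolding y_def using xD(1) A.F_le[OF u2D(1), of "p + int r"] by simp
    then show ?thesis using A.F_le[OF dyF, of p] by (simp add: Zcyc_def)
  qed
  \<comment> \<open>The sum d w1 + w2 is unchanged, since d y enters with opposite signs.\<close>
  define w1 where "w1 = v1 \<oplus>\<^bsub>cx_mod A (n - 1)\<^esub> y"
  define w2 where "w2 = v2 \<ominus>\<^bsub>cx_mod A n\<^esub> cx_d A (n - 1) y"
  have w1: "w1 \<in> Zcyc r A (p + int r) (n - 1)" unfolding w1_def by (rule A.Zcyc_add[OF v1 yZ])
  have w2F: "w2 \<in> cx_F A (p - 1) n" unfolding w2_def using v2D(1) dyF by simp
  have "cx_d A n w2 = cx_d A n v2" unfolding w2_def using v2D yc by (simp add: A.d_minus)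
  then have w2: "w2 \<in> Zcyc r A (p - 1) n" using w2F v2D(2) by (simp add: Zcyc_def)
  have "w = cx_d A (n - 1) w1 \<oplus>\<^bsub>cx_mod A n\<^esub> w2"
  proof -
    have cl: "cx_d A (n - 1) v1 \<in> cx_carrier A n" "cx_d A (n - 1) y \<in> cx_carrier A n" "v2 \<in> cx_carrier A n"
      using v1D yc v2D by auto
    have "cx_d A (n - 1) w1 = cx_d A (n - 1) v1 \<oplus>\<^bsub>cx_mod A n\<^esub> cx_d A (n - 1) y"
      unfolding w1_def using v1D yc by (simp add: A.d_pred_add)
    then show ?thesis unfolding wv w2_def using cl by algebra
  qed
  moreover have "f (n - 1) w1 = b1"
  proof -
    have "f (n - 1) w1 = f (n - 1) v1 \<oplus>\<^bsub>cx_mod B (n - 1)\<^esub> (b1 \<ominus>\<^bsub>cx_mod B (n - 1)\<^esub> f (n - 1) v1)"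
      unfolding w1_def using v1D yc fy by (simp add: add c_def)
    also have "\<dots> = b1" using b1D closed[OF v1D(3)] by algebra
    finally show ?thesis .
  qed
  moreover have "f n w2 = b2"
  proof -
    have "f n w2 = f n v2 \<ominus>\<^bsub>cx_mod B n\<^esub> (f n v2 \<ominus>\<^bsub>cx_mod B n\<^esub> b2)"
      unfolding w2_def using v2D yc fy dc by (simp add: minus d_pred)
    also have "\<dots> = b2" using b2D closed[OF v2D(3)] by algebra
    finally show ?thesis .
  qed
  ultimately show ?thesis using w1 w2 by blast
qed

text \<open>Surjectivity on Z_s settles the maps in J_s. The case s = r also feeds
  \<open>lift_boundary\<close>, which is where r in S is needed.\<close>

lemma acyclic_fibrationI:
  assumes qi: "quasi_iso R r A B f" and "r \<in> S"
    and surj: "\<And>s p n y. s \<in> S \<Longrightarrow> y \<in> Zcyc s B p n \<Longrightarrow> \<exists>x\<in>Zcyc s A p n. f n x = y"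
  shows "acyclic_fibration R r S A B f"
  unfolding acyclic_fibration_def
  using lifts_phi[OF fmor lift_boundary[OF qi surj[OF \<open>r \<in> S\<close>]]] lifts_ZZ[OF fmor surj] fmor
  by blast

section \<open>The mapping path projection of a quasi-isomorphism\<close>

lemma Zcyc_mapping_path_iff:
  "(a, b, z) \<in> Zcyc k (mapping_path r A B f) p n \<longleftrightarrow>
    a \<in> Zcyc k A p n \<and> b \<in> Zcyc k B p n \<and> z \<in> cx_F B (p + int r) (n - 1) \<and>
    b \<ominus>\<^bsub>cx_mod B n\<^esub> (f n a \<oplus>\<^bsub>cx_mod B n\<^esub> cx_d B (n - 1) z) \<in> cx_F B (p - int k + int r) n"
  by (auto simp: Zcyc_def)

text \<open>Surjectivity is inherited from f, which is the inclusion of A followed by the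
  projection. For injectivity, a presentation of b as a boundary must be extended to the triple (a,
  b, z): a is a boundary because f is injective on pages, and the mismatch in the third component
  can be removed because f is surjective on pages.\<close>

lemma quasi_iso_mapping_path_proj:
  assumes qi: "quasi_iso R r A B f"
  shows "quasi_iso R r (mapping_path r A B f) B mapping_path_proj"
proof -
  let ?W = "mapping_path r A B f"
  interpret W: filtered_map R ?W B mapping_path_proj
    by (rule filtered_mapI[OF fmor_mapping_path_proj])
  interpret i: filtered_map R A ?W "mapping_path_incl B f"
    by (rule filtered_mapI[OF fmor_mapping_path_incl])
  note qi' = qi[unfolded quasi_iso_iff, rule_format]
  show ?thesis unfolding W.quasi_iso_iff
  proof (intro allI conjI ballI impI)
    fix p n y assume "y \<in> Zcyc (Suc r) B p n"
    then obtain x where x: "x \<in> Zcyc (Suc r) A p n" "y \<ominus>\<^bsub>cx_mod B n\<^esub> f n x \<in> Bbdry (Suc r) B p n"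
      using qi' by blast
    then show "\<exists>x\<in>Zcyc (Suc r) ?W p n. y \<ominus>\<^bsub>cx_mod B n\<^esub> mapping_path_proj n x \<in> Bbdry (Suc r) B p n"
      using i.Zcyc[OF x(1)] by (intro bexI[of _ "mapping_path_incl B f n x"])
        (simp_all add: mapping_path_proj_def mapping_path_incl_def)
  next
    fix p n w assume w: "w \<in> Zcyc (Suc r) ?W p n" and pw: "mapping_path_proj n w \<in> Bbdry (Suc r) B p n"
    obtain a b z where wabz: "w = (a, b, z)" by (cases w)
    have a: "a \<in> Zcyc (Suc r) A p n" and b: "b \<in> Zcyc (Suc r) B p n" and z: "z \<in> cx_F B (p + int r) (n - 1)"
      and e0: "b \<ominus>\<^bsub>cx_mod B n\<^esub> (f n a \<oplus>\<^bsub>cx_mod B n\<^esub> cx_d B (n - 1) z) \<in> cx_F B (p - 1) n"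
      using w unfolding wabz Zcyc_mapping_path_iff by simp_all
    \<comment> \<open>The third component of d w. Since w is in Z_(r+1), it has level (p - (r + 1))
      + r = p - 1.\<close>
    define e where "e = b \<ominus>\<^bsub>cx_mod B n\<^esub> (f n a \<oplus>\<^bsub>cx_mod B n\<^esub> cx_d B (n - 1) z)"
    have eF: "e \<in> cx_F B (p - 1) n" using e0 by (simp add: e_def)
    note aD = A.ZcycD[OF a] and bD = B.ZcycD[OF b] and fa = Zcyc[OF a] and zc = B.F_carrier[OF z]
    note faD = B.ZcycD[OF fa]
    have dzc: "cx_d B (n - 1) z \<in> cx_carrier B n" using zc by simp
    have ec: "e \<in> cx_carrier B n" using B.F_carrier[OF eF] .
    obtain b1 b2 where b1: "b1 \<in> Zcyc r B (p + int r) (n - 1)" and b2: "b2 \<in> Zcyc r B (p - 1) n"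
      and bb: "b = cx_d B (n - 1) b1 \<oplus>\<^bsub>cx_mod B n\<^esub> b2"
      using pw unfolding wabz mapping_path_proj_def B.Bbdry_Suc_iff by auto
    note b1D = B.ZcycD[OF b1] and b2D = B.ZcycD[OF b2]
    have dz: "cx_d B (n - 1) z = b \<ominus>\<^bsub>cx_mod B n\<^esub> f n a \<ominus>\<^bsub>cx_mod B n\<^esub> e"
      unfolding e_def using bD(3) faD(3) dzc by algebra
    have zZ: "z \<in> Zcyc r B (p + int r) (n - 1)"
      using z B.F_le[OF eF, of p] bD(1) faD(1) by (simp add: Zcyc_def dz)
    have eZ: "e \<in> Zcyc r B (p - 1) n"
    proof -
      have "cx_d B n e = cx_d B n b \<ominus>\<^bsub>cx_mod B (n + 1)\<^esub> cx_d B n (f n a)"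
        unfolding e_def using bD(3) faD(3) zc by (simp add: B.d_minus B.d_add)
      then show ?thesis using eF bD(2) faD(2) by (simp add: Zcyc_def algebra_simps)
    qed
    \<comment> \<open>Eliminating b between its boundary presentation and the definition of e shows
      that f a is a boundary.\<close>
    have "f n a = cx_d B (n - 1) (b1 \<ominus>\<^bsub>cx_mod B (n - 1)\<^esub> z) \<oplus>\<^bsub>cx_mod B n\<^esub> (b2 \<ominus>\<^bsub>cx_mod B n\<^esub> e)"
    proof -
      have "cx_d B (n - 1) (b1 \<ominus>\<^bsub>cx_mod B (n - 1)\<^esub> z) = cx_d B (n - 1) b1 \<ominus>\<^bsub>cx_mod B n\<^esub> (b \<ominus>\<^bsub>cx_mod B n\<^esub> f n a \<ominus>\<^bsub>cx_mod B n\<^esub> e)"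
        using b1D zc by (simp add: B.d_pred_minus dz)
      moreover have "cx_d B (n - 1) b1 \<in> cx_carrier B n" using b1D by simp
      ultimately show ?thesis unfolding bb using b2D(3) faD(3) ec by algebra
    qed
    then have "f n a \<in> Bbdry (Suc r) B p n"
      unfolding B.Bbdry_Suc_iff using B.Zcyc_minus[OF b1 zZ] B.Zcyc_minus[OF b2 eZ] by blast
    then obtain a1' a2' where a1': "a1' \<in> Zcyc r A (p + int r) (n - 1)" and a2': "a2' \<in> Zcyc r A (p - 1) n"
      and aa': "a = cx_d A (n - 1) a1' \<oplus>\<^bsub>cx_mod A n\<^esub> a2'"
      using qi' a unfolding A.Bbdry_Suc_iff by blast
    note a1'D = A.ZcycD[OF a1'] and a2'D = A.ZcycD[OF a2']
    \<comment> \<open>The third component of the presentation sought for w requires z - b1 + f a1 =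
      e2 - d z1. For the provisional a1' the left side is y, which need not have that form; but y
      lies in Z_(r+1), so it acquires the form after subtracting f x for a suitable x.\<close>
    define y where "y = z \<ominus>\<^bsub>cx_mod B (n - 1)\<^esub> b1 \<oplus>\<^bsub>cx_mod B (n - 1)\<^esub> f (n - 1) a1'"
    have yZr: "y \<in> Zcyc r B (p + int r) (n - 1)"
      unfolding y_def by (intro B.Zcyc_add B.Zcyc_minus zZ b1 Zcyc a1')
    note yD = B.ZcycD[OF yZr]
    have dy: "cx_d B (n - 1) y = b2 \<ominus>\<^bsub>cx_mod B n\<^esub> e \<ominus>\<^bsub>cx_mod B n\<^esub> f n a2'"
    proof -
      have c: "cx_d B (n - 1) b1 \<in> cx_carrier B n" "cx_d B (n - 1) (f (n - 1) a1') \<in> cx_carrier B n" "f n a2' \<in> cx_carrier B n"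
        using b1D a1'D a2'D by auto
      have fa': "f n a = cx_d B (n - 1) (f (n - 1) a1') \<oplus>\<^bsub>cx_mod B n\<^esub> f n a2'"
        using a1'D a2'D by (simp add: aa' add d_pred)
      have "cx_d B (n - 1) y = (b \<ominus>\<^bsub>cx_mod B n\<^esub> f n a \<ominus>\<^bsub>cx_mod B n\<^esub> e) \<ominus>\<^bsub>cx_mod B n\<^esub> cx_d B (n - 1) b1
          \<oplus>\<^bsub>cx_mod B n\<^esub> cx_d B (n - 1) (f (n - 1) a1')"
        unfolding y_def using b1D zc a1'D by (simp add: B.d_pred_minus B.d_pred_add dz)
      then show ?thesis unfolding bb fa' using c b2D(3) ec by algebra
    qed
    have "y \<in> Zcyc (Suc r) B (p + int r) (n - 1)"
    proof -
      have "cx_d B (n - 1) y \<in> cx_F B (p - 1) n"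
        unfolding dy using b2D(1) eF F[OF a2'D(1)] by simp
      then show ?thesis using yD(1) by (simp add: Zcyc_def)
    qed
    then obtain x where x: "x \<in> Zcyc (Suc r) A (p + int r) (n - 1)"
      and yx: "y \<ominus>\<^bsub>cx_mod B (n - 1)\<^esub> f (n - 1) x \<in> Bbdry (Suc r) B (p + int r) (n - 1)"
      using qi' by blast
    from yx obtain e1 e2 where e1: "e1 \<in> Zcyc r B (p + int r + int r) (n - 1 - 1)" and e2: "e2 \<in> Zcyc r B (p + int r - 1) (n - 1)"
      and ye: "y \<ominus>\<^bsub>cx_mod B (n - 1)\<^esub> f (n - 1) x = cx_d B (n - 1 - 1) e1 \<oplus>\<^bsub>cx_mod B (n - 1)\<^esub> e2"
      unfolding B.Bbdry_Suc_iff by blast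
    note xD = A.ZcycD[OF x] and e1D = B.ZcycD[OF e1] and e2D = B.ZcycD[OF e2]
    have dxF: "cx_d A (n - 1) x \<in> cx_F A (p - 1) n" using xD(2) by simp
    have de1: "cx_d B (n - 1 - 1) e1 \<in> cx_carrier B (n - 1)" using e1D(3) by (rule B.d_pred_closed)
    have de1F: "cx_d B (n - 1 - 1) e1 \<in> cx_F B (p + int r) (n - 1)" using e1D(2) by (simp add: algebra_simps)
    \<comment> \<open>Absorbs x into a1 and compensates by d x in a2, so that a = d a1 + a2 still
      holds.\<close>
    define a1 where "a1 = a1' \<ominus>\<^bsub>cx_mod A (n - 1)\<^esub> x"
    define a2 where "a2 = a2' \<oplus>\<^bsub>cx_mod A n\<^esub> cx_d A (n - 1) x"
    have a1: "a1 \<in> Zcyc r A (p + int r) (n - 1)"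
    proof -
      have "x \<in> Zcyc r A (p + int r) (n - 1)"
        using xD(1) A.F_le[OF dxF, of p] by (simp add: Zcyc_def)
      then show ?thesis unfolding a1_def by (rule A.Zcyc_minus[OF a1'])
    qed
    have "cx_d A n a2 = cx_d A n a2'" unfolding a2_def using a2'D xD by (simp add: A.d_add)
    then have a2: "a2 \<in> Zcyc r A (p - 1) n"
      using a2'D(1,2) dxF by (simp add: Zcyc_def a2_def)
    note a1D = A.ZcycD[OF a1] and a2D = A.ZcycD[OF a2]
    have aa: "a = cx_d A (n - 1) a1 \<oplus>\<^bsub>cx_mod A n\<^esub> a2"
    proof -
      have "cx_d A (n - 1) a1 = cx_d A (n - 1) a1' \<ominus>\<^bsub>cx_mod A n\<^esub> cx_d A (n - 1) x"
        unfolding a1_def using a1'D xD by (simp add: A.d_pred_minus)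
      moreover have "cx_d A (n - 1) a1' \<in> cx_carrier A n" "cx_d A (n - 1) x \<in> cx_carrier A n"
        using a1'D xD by auto
      ultimately show ?thesis unfolding aa' a2_def using a2'D(3) by algebra
    qed
    have zy: "z \<ominus>\<^bsub>cx_mod B (n - 1)\<^esub> b1 \<oplus>\<^bsub>cx_mod B (n - 1)\<^esub> f (n - 1) a1 = cx_d B (n - 1 - 1) e1 \<oplus>\<^bsub>cx_mod B (n - 1)\<^esub> e2"
    proof -
      have "f (n - 1) a1 = f (n - 1) a1' \<ominus>\<^bsub>cx_mod B (n - 1)\<^esub> f (n - 1) x"
        unfolding a1_def using a1'D xD by (simp add: minus)
      then show ?thesis unfolding ye[symmetric] y_def
        using zc b1D(3) closed[OF a1'D(3)] closed[OF xD(3)] by algebra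
    qed
    have fa1: "f (n - 1) a1 \<in> cx_F B (p + int r) (n - 1)" by (rule F[OF a1D(1)])
    \<comment> \<open>The sign is due to -d z1 in the third component of d (a1, b1, z1). The level p
      + r + r comes from e1, and is what the shift by r demands of a third component at level p +
      r.\<close>
    define z1 where "z1 = \<ominus>\<^bsub>cx_mod B (n - 1 - 1)\<^esub> e1"
    have z1: "z1 \<in> cx_F B (p + int r + int r) (n - 1 - 1)" unfolding z1_def using e1D(1) by simp
    have dz1: "cx_d B (n - 1 - 1) z1 = \<ominus>\<^bsub>cx_mod B (n - 1)\<^esub> cx_d B (n - 1 - 1) e1"
      unfolding z1_def by (rule B.d_pred_a_inv[OF e1D(3)])
    have ww: "w = cx_d ?W (n - 1) (a1, b1, z1) \<oplus>\<^bsub>cx_mod ?W n\<^esub> (a2, b2, e2)"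
    proof -
      have "z = b1 \<ominus>\<^bsub>cx_mod B (n - 1)\<^esub> (f (n - 1) a1 \<oplus>\<^bsub>cx_mod B (n - 1)\<^esub> cx_d B (n - 1 - 1) z1) \<oplus>\<^bsub>cx_mod B (n - 1)\<^esub> e2"
      proof -
        have "z = (z \<ominus>\<^bsub>cx_mod B (n - 1)\<^esub> b1 \<oplus>\<^bsub>cx_mod B (n - 1)\<^esub> f (n - 1) a1) \<oplus>\<^bsub>cx_mod B (n - 1)\<^esub> (b1 \<ominus>\<^bsub>cx_mod B (n - 1)\<^esub> f (n - 1) a1)"
          using zc b1D(3) closed[OF a1D(3)] by algebra
        then show ?thesis unfolding zy dz1
          using zc b1D(3) closed[OF a1D(3)] de1 e2D(3) by algebra
      qed
      then show ?thesis using aa bb by (simp add: wabz)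
    qed
    have W1: "(a1, b1, z1) \<in> Zcyc r ?W (p + int r) (n - 1)"
    proof -
      have "b1 \<ominus>\<^bsub>cx_mod B (n - 1)\<^esub> (f (n - 1) a1 \<oplus>\<^bsub>cx_mod B (n - 1)\<^esub> cx_d B (n - 1 - 1) z1)
          \<in> cx_F B (p + int r) (n - 1)"
        unfolding dz1 by (intro B.F_minus B.F_add B.F_a_inv b1D(1) fa1 de1F)
      then show ?thesis
        unfolding Zcyc_mapping_path_iff using a1 b1 z1 by simp
    qed
    \<comment> \<open>The differential of e2 is found from y - f x = d e1 + e2; with it, the third
      component of d (a2, b2, e2) is e again, of level p - 1.\<close>
    have W2: "(a2, b2, e2) \<in> Zcyc r ?W (p - 1) n"
    proof -
      have c: "cx_d B (n - 1) y \<in> cx_carrier B n" "cx_d B (n - 1) (f (n - 1) x) \<in> cx_carrier B n"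
        using yD xD by auto
      have "cx_d B (n - 1) (cx_d B (n - 1 - 1) e1) = \<zero>\<^bsub>cx_mod B n\<^esub>"
        using B.d_d_pred[OF e1D(3)] by simp
      then have "cx_d B (n - 1) e2 = cx_d B (n - 1) (cx_d B (n - 1 - 1) e1 \<oplus>\<^bsub>cx_mod B (n - 1)\<^esub> e2)"
        using de1 e2D by (simp add: B.d_pred_add)
      also have "\<dots> = cx_d B (n - 1) y \<ominus>\<^bsub>cx_mod B n\<^esub> f n (cx_d A (n - 1) x)"
        unfolding ye[symmetric] using yD xD by (simp add: B.d_pred_minus d_pred)
      also have "\<dots> = b2 \<ominus>\<^bsub>cx_mod B n\<^esub> e \<ominus>\<^bsub>cx_mod B n\<^esub> f n a2"
      proof -
        have "f n a2 = f n a2' \<oplus>\<^bsub>cx_mod B n\<^esub> f n (cx_d A (n - 1) x)"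
          unfolding a2_def using a2'D xD by (simp add: add)
        moreover have "f n (cx_d A (n - 1) x) \<in> cx_carrier B n" "f n a2' \<in> cx_carrier B n" using xD a2'D by auto
        ultimately show ?thesis unfolding dy using b2D(3) ec by algebra
      qed
      finally have de2: "cx_d B (n - 1) e2 = b2 \<ominus>\<^bsub>cx_mod B n\<^esub> e \<ominus>\<^bsub>cx_mod B n\<^esub> f n a2" .
      have "b2 \<ominus>\<^bsub>cx_mod B n\<^esub> (f n a2 \<oplus>\<^bsub>cx_mod B n\<^esub> cx_d B (n - 1) e2) = e"
        unfolding de2 using b2D(3) ec closed[OF a2D(3)] by algebra
      moreover have "e2 \<in> cx_F B (p - 1 + int r) (n - 1)" using e2D(1) by (simp add: algebra_simps)
      ultimately show ?thesis unfolding Zcyc_mapping_path_iff using a2 b2 eF by simp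
    qed
    show "w \<in> Bbdry (Suc r) ?W p n"
      unfolding W.A.Bbdry_Suc_iff using W1 W2 ww by blast
  qed
qed

lemma acyclic_fibration_mapping_path_proj:
  assumes qi: "quasi_iso R r A B f" and S: "S \<subseteq> {0..r}" "r \<in> S"
  shows "acyclic_fibration R r S (mapping_path r A B f) B mapping_path_proj"
proof -
  interpret W: filtered_map R "mapping_path r A B f" B mapping_path_proj
    by (rule filtered_mapI[OF fmor_mapping_path_proj])
  show ?thesis
  proof (rule W.acyclic_fibrationI[OF quasi_iso_mapping_path_proj[OF qi] S(2)])
    fix s p n y assume s: "s \<in> S" and y: "y \<in> Zcyc s B p n"
    \<comment> \<open>The lift of y is (0, y, 0). The third component of its differential is y,
      which has to lie in F_(p-s+r); this is where S \<subseteq> {0..r} enters.\<close>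
    have "s \<le> r" using s S by auto
    then have "(\<zero>\<^bsub>cx_mod A n\<^esub>, y, \<zero>\<^bsub>cx_mod B (n - 1)\<^esub>) \<in> Zcyc s (mapping_path r A B f) p n"
      unfolding Zcyc_mapping_path_iff
      using y B.ZcycD[OF y] B.F_le[of y p n "p - int s + int r"] by (auto simp: Zcyc_def)
    then show "\<exists>x\<in>Zcyc s (mapping_path r A B f) p n. mapping_path_proj n x = y"
      by (rule bexI[rotated]) (simp add: mapping_path_proj_def)
  qed
qed

end


section \<open>Lifting properties and universal properties\<close>

text \<open>The complexes in the lifting problems and universal properties have elements in the
  universe \<open>'u\<close>. Mapping path complexes live on \<open>'u \<times> 'u \<times> 'u\<close> and are moved
  into \<open>'u\<close> along an injection.\<close>

definition transport_module :: "('t \<Rightarrow> 'u) \<Rightarrow> ('r, 't) module \<Rightarrow> ('r, 'u) module" where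
  "transport_module e M =
     \<lparr>carrier = e ` carrier M, mult = undefined, one = undefined, zero = e \<zero>\<^bsub>M\<^esub>,
      add = (\<lambda>x y. e (inv_into UNIV e x \<oplus>\<^bsub>M\<^esub> inv_into UNIV e y)), smult = (\<lambda>a x. e (a \<odot>\<^bsub>M\<^esub> inv_into UNIV e x))\<rparr>"

definition transport :: "('t \<Rightarrow> 'u) \<Rightarrow> ('r, 't) fcomplex \<Rightarrow> ('r, 'u) fcomplex" where
  "transport e W =
     \<lparr>cx_mod = (\<lambda>n. transport_module e (cx_mod W n)), cx_d = (\<lambda>n x. e (cx_d W n (inv_into UNIV e x))),
      cx_F = (\<lambda>p n. e ` cx_F W p n)\<rparr>"

context
  fixes e :: "'t \<Rightarrow> 'u"
  assumes e: "inj e"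
begin

lemma transport_module_simps:
  "carrier (transport_module e M) = e ` carrier M"
  "\<zero>\<^bsub>transport_module e M\<^esub> = e \<zero>\<^bsub>M\<^esub>"
  "e x \<oplus>\<^bsub>transport_module e M\<^esub> e y = e (x \<oplus>\<^bsub>M\<^esub> y)"
  "a \<odot>\<^bsub>transport_module e M\<^esub> e x = e (a \<odot>\<^bsub>M\<^esub> x)"
  using e by (simp_all add: transport_module_def inv_f_f)

lemma module_transport_module:
  assumes "module R M"
  shows "module R (transport_module e M)"
proof -
  interpret M: module R M by fact
  have "abelian_group (transport_module e M)"
  proof (rule abelian_groupI)
    fix x assume "x \<in> carrier (transport_module e M)"
    then obtain y where y: "y \<in> carrier M" "x = e y" by (auto simp: transport_module_simps)
    then show "\<exists>y\<in>carrier (transport_module e M). y \<oplus>\<^bsub>transport_module e M\<^esub> x = \<zero>\<^bsub>transport_module e M\<^esub>"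
      by (intro bexI[of _ "e (\<ominus>\<^bsub>M\<^esub> y)"]) (auto simp: transport_module_simps M.l_neg)
  qed (auto simp: transport_module_simps M.a_ac)
  then show ?thesis
    by (intro moduleI M.R.is_cring)
      (auto simp: transport_module_simps M.smult_l_distr M.smult_r_distr M.smult_assoc1)
qed

lemma linear_map_transport_module:
  "linear_map R M (transport_module e M) e" "linear_map R (transport_module e M) M (inv_into UNIV e)"
  using e by (auto intro!: linear_mapI simp: transport_module_simps inv_f_f)

lemma
  assumes W: "filtered_complex R W"
  shows fmor_transport: "fmor R W (transport e W) (\<lambda>_. e)"
    and fmor_transport_inv: "fmor R (transport e W) W (\<lambda>_. inv_into UNIV e)"
proof -
  interpret W: filtered_complex R W by fact
  let ?T = "transport e W"
  have T: "filtered_complex R ?T"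
  proof (rule filtered_complex.intro)
    show "module R (cx_mod ?T n)" for n
      by (simp add: transport_def module_transport_module W.module_cx)
    show "linear_map R (cx_mod ?T n) (cx_mod ?T (n + 1)) (cx_d ?T n)" for n
      unfolding transport_def fcomplex.simps
      by (intro linear_map_comp[OF linear_map_comp[OF linear_map_transport_module(2) W.linear_d] linear_map_transport_module(1)])
    show "cx_d ?T (n + 1) (cx_d ?T n x) = \<zero>\<^bsub>cx_mod ?T (n + 1 + 1)\<^esub>" if "x \<in> cx_carrier ?T n" for n x
      using that e by (auto simp: transport_def transport_module_simps inv_f_f W.d_d)
    show "submodule (cx_F ?T p n) R (cx_mod ?T n)" for p n
      unfolding transport_def fcomplex.simps
      by (rule submodule_image[OF W.module_cx module_transport_module[OF W.module_cx]
        linear_map_transport_module(1) W.submodule_F])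
    show "cx_F ?T p n \<subseteq> cx_F ?T (p + 1) n" for p n
      using W.F_mono[of p n] by (auto simp: transport_def)
    show "cx_d ?T n x \<in> cx_F ?T p (n + 1)" if "x \<in> cx_F ?T p n" for n p x
      using that e W.d_F by (auto simp: transport_def inv_f_f)
  qed
  show "fmor R W ?T (\<lambda>_. e)"
    using e by (intro fmorI W T) (auto simp: transport_def linear_map_transport_module inv_f_f)
  show "fmor R ?T W (\<lambda>_. inv_into UNIV e)"
    using e by (intro fmorI W T) (auto simp: transport_def linear_map_transport_module transport_module_simps inv_f_f)
qed

end

lemma mor_eqD: "mor_eq A f g \<Longrightarrow> x \<in> cx_carrier A n \<Longrightarrow> f n x = g n x"
  by (simp add: mor_eq_def)

lemma mor_eqI: "(\<And>n x. x \<in> cx_carrier A n \<Longrightarrow> f n x = g n x) \<Longrightarrow> mor_eq A f g"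
  by (simp add: mor_eq_def)

lemma fmor_closed: "fmor R A B f \<Longrightarrow> x \<in> cx_carrier A n \<Longrightarrow> f n x \<in> cx_carrier B n"
  by (rule filtered_map.closed[OF filtered_mapI])

text \<open>\<open>e\<close> and its inverse are mutually inverse isomorphisms of filtered
  complexes. Thus a cofibration, tested only against objects over the universe, also lifts against
  maps out of mapping path complexes.\<close>

lemma lifts_transport:
  assumes W: "filtered_complex R W" and e: "inj e"
  shows "lifts R A B i (transport e W) Y (q \<circ>\<^sub>m (\<lambda>_. inv_into UNIV e)) \<longleftrightarrow> lifts R A B i W Y q"
proof
  note E = fmor_transport[OF e W] and E' = fmor_transport_inv[OF e W]
  have EE': "e (inv_into UNIV e x) = x" if "x \<in> cx_carrier (transport e W) n" for x n
    using that e by (auto simp: transport_def transport_module_simps inv_f_f)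
  have E'E: "inv_into UNIV e (e x) = x" for x using e by (simp add: inv_f_f)
  show "lifts R A B i W Y q" if L: "lifts R A B i (transport e W) Y (q \<circ>\<^sub>m (\<lambda>_. inv_into UNIV e))"
    unfolding lifts_def
  proof (intro allI impI, elim conjE)
    fix f g assume f: "fmor R A W f" and g: "fmor R B Y g" and eq: "mor_eq A (g \<circ>\<^sub>m i) (q \<circ>\<^sub>m f)"
    have "mor_eq A (g \<circ>\<^sub>m i) (q \<circ>\<^sub>m (\<lambda>_. inv_into UNIV e) \<circ>\<^sub>m ((\<lambda>_. e) \<circ>\<^sub>m f))"
      using eq by (simp add: mor_eq_def mor_comp_def E'E)
    then obtain h where h: "fmor R B (transport e W) h" "mor_eq A (h \<circ>\<^sub>m i) ((\<lambda>_. e) \<circ>\<^sub>m f)"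
      "mor_eq B (q \<circ>\<^sub>m (\<lambda>_. inv_into UNIV e) \<circ>\<^sub>m h) g"
      using L fmor_comp[OF f E] g unfolding lifts_def by blast
    have "mor_eq A ((\<lambda>_. inv_into UNIV e) \<circ>\<^sub>m h \<circ>\<^sub>m i) f"
      using h(2) by (simp add: mor_eq_def mor_comp_def E'E)
    moreover have "mor_eq B (q \<circ>\<^sub>m ((\<lambda>_. inv_into UNIV e) \<circ>\<^sub>m h)) g"
      using h(3) by (simp add: mor_eq_def mor_comp_def)
    ultimately show "\<exists>h. fmor R B W h \<and> mor_eq A (h \<circ>\<^sub>m i) f \<and> mor_eq B (q \<circ>\<^sub>m h) g"
      using fmor_comp[OF h(1) E'] by blast
  qed
  show "lifts R A B i (transport e W) Y (q \<circ>\<^sub>m (\<lambda>_. inv_into UNIV e))" if L: "lifts R A B i W Y q"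
    unfolding lifts_def
  proof (intro allI impI, elim conjE)
    fix f g assume f: "fmor R A (transport e W) f" and g: "fmor R B Y g"
      and eq: "mor_eq A (g \<circ>\<^sub>m i) (q \<circ>\<^sub>m (\<lambda>_. inv_into UNIV e) \<circ>\<^sub>m f)"
    have "mor_eq A (g \<circ>\<^sub>m i) (q \<circ>\<^sub>m ((\<lambda>_. inv_into UNIV e) \<circ>\<^sub>m f))"
      using eq by (simp add: mor_eq_def mor_comp_def)
    then obtain h where h: "fmor R B W h" "mor_eq A (h \<circ>\<^sub>m i) ((\<lambda>_. inv_into UNIV e) \<circ>\<^sub>m f)" "mor_eq B (q \<circ>\<^sub>m h) g"
      using L fmor_comp[OF f E'] g unfolding lifts_def by blast
    have "mor_eq A ((\<lambda>_. e) \<circ>\<^sub>m h \<circ>\<^sub>m i) f"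
      using h(2) EE'[OF fmor_closed[OF f]] by (simp add: mor_eq_def mor_comp_def)
    moreover have "mor_eq B (q \<circ>\<^sub>m (\<lambda>_. inv_into UNIV e) \<circ>\<^sub>m ((\<lambda>_. e) \<circ>\<^sub>m h)) g"
      using h(3) by (simp add: mor_eq_def mor_comp_def E'E)
    ultimately show "\<exists>h. fmor R B (transport e W) h \<and> mor_eq A (h \<circ>\<^sub>m i) f \<and>
        mor_eq B (q \<circ>\<^sub>m (\<lambda>_. inv_into UNIV e) \<circ>\<^sub>m h) g"
      using fmor_comp[OF h(1) E] by blast
  qed
qed

lemma acyclic_fibration_transport:
  assumes "acyclic_fibration R r S W Y q" and e: "inj e"
  shows "acyclic_fibration R r S (transport e W) Y (q \<circ>\<^sub>m (\<lambda>_. inv_into UNIV e))"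
proof -
  have q: "fmor R W Y q" using assms by (simp add: acyclic_fibration_def)
  show ?thesis
    using assms(1) fmor_comp[OF fmor_transport_inv[OF e fmor_dom[OF q]] q]
    by (simp add: acyclic_fibration_def lifts_transport[OF fmor_dom[OF q] e])
qed

text \<open>An infinite type is equipotent to its square; two applications give the triple.\<close>

lemma infinite_UNIV_inj_triple:
  assumes "infinite (UNIV :: 'u set)"
  shows "\<exists>e :: 'u \<times> 'u \<times> 'u \<Rightarrow> 'u. inj e"
proof -
  obtain f :: "'u \<times> 'u \<Rightarrow> 'u" where "bij_betw f (UNIV \<times> UNIV) UNIV"
    using card_of_Times_same_infinite[OF assms] unfolding card_of_ordIso[symmetric] by blast
  then have f: "inj f" by (simp add: bij_betw_def)
  have "inj (\<lambda>(a, b, c). f (a, f (b, c)))"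
    by (rule injI) (auto simp: inj_eq[OF f] split: prod.splits)
  then show ?thesis by blast
qed

section \<open>Acyclic cofibrations as strong deformation retracts\<close>

lemma acyclic_cofibration_strong_def_retract:
  fixes A B :: "('r, 'u) fcomplex"
  assumes inf: "infinite (UNIV :: 'u set)" and S: "S \<subseteq> {0..r}" "r \<in> S"
    and g: "acyclic_cofibration R r S A B g"
  shows "\<exists>\<rho> h. strong_def_retract R r A B g \<rho> h"
proof -
  have cof: "cofibration R r S A B g" and qi: "quasi_iso R r A B g"
    using g by (simp_all add: acyclic_cofibration_def)
  have gm: "fmor R A B g" using cof by (simp add: cofibration_def)
  interpret g: filtered_map R A B g by (rule filtered_mapI[OF gm])
  let ?W = "mapping_path r A B g"
  obtain e :: "'u \<times> 'u \<times> 'u \<Rightarrow> 'u" where e: "inj e" using infinite_UNIV_inj_triple[OF inf] by blast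
  have "acyclic_fibration R r S (transport e ?W) B (mapping_path_proj \<circ>\<^sub>m (\<lambda>_. inv_into UNIV e))"
    by (rule acyclic_fibration_transport[OF g.acyclic_fibration_mapping_path_proj[OF qi S] e])
  then have "lifts R A B g (transport e ?W) B (mapping_path_proj \<circ>\<^sub>m (\<lambda>_. inv_into UNIV e))"
    using cof by (simp add: cofibration_def)
  then have "lifts R A B g ?W B mapping_path_proj"
    using lifts_transport[OF g.filtered_complex_mapping_path e] by blast
  \<comment> \<open>The square with the inclusion of A on top and the identity of B at the bottom; a
    lift in it is a section of the projection that extends the inclusion.\<close>
  moreover have "mor_eq A (mor_id \<circ>\<^sub>m g) (mapping_path_proj \<circ>\<^sub>m mapping_path_incl B g)"
    by (simp add: mor_eq_def mor_comp_def mor_id_def mapping_path_proj_def mapping_path_incl_def)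
  ultimately obtain k where "fmor R B ?W k" "mor_eq A (k \<circ>\<^sub>m g) (mapping_path_incl B g)"
    "mor_eq B (mapping_path_proj \<circ>\<^sub>m k) mor_id"
    using g.fmor_mapping_path_incl[of r] fmor_id[OF g.B.filtered_complex_axioms] unfolding lifts_def by blast
  then show ?thesis by (rule strong_def_retract_of_lift[OF gm])
qed

section \<open>Lifting properties under pushouts and transfinite compositions\<close>

lemma lifts_pushout:
  fixes X Y V :: "('r, 'u) fcomplex" and W :: "('r, 't) fcomplex" and e :: "'t \<Rightarrow> 'u"
  assumes po: "is_pushout R A B X Y i f j g" and e: "inj e" and q: "fmor R W V q"
    and L: "lifts R A B i W V q"
  shows "lifts R X Y j W V q"
  unfolding lifts_def
proof (intro allI impI, elim conjE)
  fix u v assume u: "fmor R X W u" and v: "fmor R Y V v" and eq: "mor_eq X (v \<circ>\<^sub>m j) (q \<circ>\<^sub>m u)"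
  have i: "fmor R A B i" and f: "fmor R A X f" and j: "fmor R X Y j" and g: "fmor R B Y g"
    and sq: "mor_eq A (j \<circ>\<^sub>m f) (g \<circ>\<^sub>m i)"
    and univ: "\<And>(T :: ('r, 'u) fcomplex) x b. fmor R X T x \<Longrightarrow> fmor R B T b \<Longrightarrow> mor_eq A (x \<circ>\<^sub>m f) (b \<circ>\<^sub>m i) \<Longrightarrow>
        (\<exists>t. fmor R Y T t \<and> mor_eq X (t \<circ>\<^sub>m j) x \<and> mor_eq B (t \<circ>\<^sub>m g) b \<and>
          (\<forall>t'. fmor R Y T t' \<and> mor_eq X (t' \<circ>\<^sub>m j) x \<and> mor_eq B (t' \<circ>\<^sub>m g) b \<longrightarrow> mor_eq Y t' t))"
    using po unfolding is_pushout_def by blast+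
  note E = fmor_transport[OF e fmor_dom[OF q]] and E' = fmor_transport_inv[OF e fmor_dom[OF q]]
  have "mor_eq A (v \<circ>\<^sub>m g \<circ>\<^sub>m i) (q \<circ>\<^sub>m (u \<circ>\<^sub>m f))"
  proof (rule mor_eqI)
    fix n x assume x: "x \<in> cx_carrier A n"
    show "(v \<circ>\<^sub>m g \<circ>\<^sub>m i) n x = (q \<circ>\<^sub>m (u \<circ>\<^sub>m f)) n x"
      using mor_eqD[OF sq x] mor_eqD[OF eq fmor_closed[OF f x]] by (simp add: mor_comp_def)
  qed
  then obtain h where h: "fmor R B W h" "mor_eq A (h \<circ>\<^sub>m i) (u \<circ>\<^sub>m f)" "mor_eq B (q \<circ>\<^sub>m h) (v \<circ>\<^sub>m g)"
    using L fmor_comp[OF f u] fmor_comp[OF g v] unfolding lifts_def by blast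
  have "mor_eq A ((\<lambda>_. e) \<circ>\<^sub>m u \<circ>\<^sub>m f) ((\<lambda>_. e) \<circ>\<^sub>m h \<circ>\<^sub>m i)"
    using h(2) by (simp add: mor_eq_def mor_comp_def)
  \<comment> \<open>Existence in the universal property is applied to the copy of W in the universe.
    Uniqueness, applied further down to maps into V, identifies q w with v.\<close>
  then obtain t where t: "fmor R Y (transport e W) t" "mor_eq X (t \<circ>\<^sub>m j) ((\<lambda>_. e) \<circ>\<^sub>m u)"
    "mor_eq B (t \<circ>\<^sub>m g) ((\<lambda>_. e) \<circ>\<^sub>m h)"
    using univ[OF fmor_comp[OF u E] fmor_comp[OF h(1) E]] by blast
  define w where "w = (\<lambda>_. inv_into UNIV e) \<circ>\<^sub>m t"
  have w: "fmor R Y W w" unfolding w_def by (rule fmor_comp[OF t(1) E'])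
  have wj: "mor_eq X (w \<circ>\<^sub>m j) u" and wg: "mor_eq B (w \<circ>\<^sub>m g) h"
    using t(2,3) e by (simp_all add: mor_eq_def mor_comp_def w_def inv_f_f)
  have "mor_eq A (q \<circ>\<^sub>m u \<circ>\<^sub>m f) (v \<circ>\<^sub>m g \<circ>\<^sub>m i)"
    using \<open>mor_eq A (v \<circ>\<^sub>m g \<circ>\<^sub>m i) (q \<circ>\<^sub>m (u \<circ>\<^sub>m f))\<close> by (simp add: mor_eq_def mor_comp_def)
  then obtain t0 where t0: "\<And>t'. fmor R Y V t' \<Longrightarrow> mor_eq X (t' \<circ>\<^sub>m j) (q \<circ>\<^sub>m u) \<Longrightarrow> mor_eq B (t' \<circ>\<^sub>m g) (v \<circ>\<^sub>m g) \<Longrightarrow> mor_eq Y t' t0"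
    using univ[OF fmor_comp[OF u q] fmor_comp[OF g v]] by blast
  have "mor_eq Y v t0" by (rule t0[OF v eq]) (simp add: mor_eq_def)
  moreover have "mor_eq Y (q \<circ>\<^sub>m w) t0"
    using wj wg h(3) by (intro t0 fmor_comp[OF w q]) (simp_all add: mor_eq_def mor_comp_def)
  ultimately have "mor_eq Y (q \<circ>\<^sub>m w) v" by (simp add: mor_eq_def)
  then show "\<exists>h. fmor R Y W h \<and> mor_eq X (h \<circ>\<^sub>m j) u \<and> mor_eq Y (q \<circ>\<^sub>m h) v"
    using w wj by blast
qed

text \<open>Glues compatible lifts over V: existence for the cocone into W gives t, and uniqueness
  for the cocone into V gives q t = v. It serves the limit stages of a sequence as well as its
  colimit.\<close>

lemma colimit_lift:
  fixes X :: "'i \<Rightarrow> ('r, 'u) fcomplex" and V :: "('r, 'u) fcomplex" and W :: "('r, 't) fcomplex" and e :: "'t \<Rightarrow> 'u"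
  assumes co: "is_colimit R \<Lambda> D X \<xi> Y c" and e: "inj e" and q: "fmor R W V q" and v: "fmor R Y V v"
    and b: "\<And>i. i \<in> D \<Longrightarrow> fmor R (X i) W (b i)"
    and compat: "\<And>i j. i \<in> D \<Longrightarrow> j \<in> D \<Longrightarrow> (i, j) \<in> \<Lambda> \<Longrightarrow> mor_eq (X i) (b j \<circ>\<^sub>m \<xi> i j) (b i)"
    and qb: "\<And>i. i \<in> D \<Longrightarrow> mor_eq (X i) (q \<circ>\<^sub>m b i) (v \<circ>\<^sub>m c i)"
  shows "\<exists>t. fmor R Y W t \<and> (\<forall>i\<in>D. mor_eq (X i) (t \<circ>\<^sub>m c i) (b i)) \<and> mor_eq Y (q \<circ>\<^sub>m t) v"
proof -
  have cc: "is_cocone R \<Lambda> D X \<xi> Y c"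
    and univ: "\<And>T b. is_cocone R \<Lambda> D X \<xi> T b \<Longrightarrow>
        (\<exists>t. fmor R Y T t \<and> (\<forall>i\<in>D. mor_eq (X i) (t \<circ>\<^sub>m c i) (b i)) \<and>
          (\<forall>t'. fmor R Y T t' \<and> (\<forall>i\<in>D. mor_eq (X i) (t' \<circ>\<^sub>m c i) (b i)) \<longrightarrow> mor_eq Y t' t))"
    using co unfolding is_colimit_def by blast+
  note E = fmor_transport[OF e fmor_dom[OF q]] and E' = fmor_transport_inv[OF e fmor_dom[OF q]]
  have "is_cocone R \<Lambda> D X \<xi> (transport e W) (\<lambda>i. (\<lambda>_. e) \<circ>\<^sub>m b i)"
    using fmor_cod[OF E] fmor_comp[OF b E] compat by (auto simp: is_cocone_def mor_eq_def mor_comp_def)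
  then obtain t where t: "fmor R Y (transport e W) t" "\<And>i. i \<in> D \<Longrightarrow> mor_eq (X i) (t \<circ>\<^sub>m c i) ((\<lambda>_. e) \<circ>\<^sub>m b i)"
    using univ by blast
  define w where "w = (\<lambda>_. inv_into UNIV e) \<circ>\<^sub>m t"
  have w: "fmor R Y W w" unfolding w_def by (rule fmor_comp[OF t(1) E'])
  have wc: "mor_eq (X i) (w \<circ>\<^sub>m c i) (b i)" if "i \<in> D" for i
    using t(2)[OF that] e by (simp add: mor_eq_def mor_comp_def w_def inv_f_f)
  have "is_cocone R \<Lambda> D X \<xi> V (\<lambda>i. v \<circ>\<^sub>m c i)"
    using cc fmor_cod[OF v] fmor_comp[OF _ v] by (auto simp: is_cocone_def mor_eq_def mor_comp_def)
  then obtain t0 where t0: "\<And>t'. fmor R Y V t' \<Longrightarrow> (\<And>i. i \<in> D \<Longrightarrow> mor_eq (X i) (t' \<circ>\<^sub>m c i) (v \<circ>\<^sub>m c i)) \<Longrightarrow> mor_eq Y t' t0"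
    using univ by blast
  have "mor_eq Y v t0" by (rule t0[OF v]) (simp add: mor_eq_def)
  moreover have "mor_eq Y (q \<circ>\<^sub>m w) t0"
    using wc qb by (intro t0 fmor_comp[OF w q]) (simp add: mor_eq_def mor_comp_def)
  ultimately have "mor_eq Y (q \<circ>\<^sub>m w) v" by (simp add: mor_eq_def)
  then show ?thesis using w wc by blast
qed

text \<open>Lifts X i \<rightarrow> W over V are chosen by well-founded recursion along
  \<open>\<Lambda>\<close>. Each must extend all earlier ones, since limit stages and the final
  colimit require a cocone.\<close>

lemma lifts_transfinite_composition:
  fixes X :: "'i \<Rightarrow> ('r, 'u) fcomplex" and V :: "('r, 'u) fcomplex" and W :: "('r, 't) fcomplex" and e :: "'t \<Rightarrow> 'u"
  assumes wo: "Well_order \<Lambda>" and i0: "i0 \<in> Field \<Lambda>" "\<And>i. i \<in> Field \<Lambda> \<Longrightarrow> (i0, i) \<in> \<Lambda>"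
    and seq: "transfinite_sequence R P \<Lambda> X \<xi>" and co: "is_colimit R \<Lambda> (Field \<Lambda>) X \<xi> Y c"
    and e: "inj e" and q: "fmor R W V q"
    and L: "\<And>i j. is_succ \<Lambda> i j \<Longrightarrow> lifts R (X i) (X j) (\<xi> i j) W V q"
  shows "lifts R (X i0) Y (c i0) W V q"
  unfolding lifts_def
proof (intro allI impI, elim conjE)
  fix u v assume u: "fmor R (X i0) W u" and v: "fmor R Y V v" and eq: "mor_eq (X i0) (v \<circ>\<^sub>m c i0) (q \<circ>\<^sub>m u)"
  have refl: "\<And>i. i \<in> Field \<Lambda> \<Longrightarrow> (i, i) \<in> \<Lambda>" and antisym: "\<And>i j. (i, j) \<in> \<Lambda> \<Longrightarrow> (j, i) \<in> \<Lambda> \<Longrightarrow> i = j"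
    and total: "\<And>i j. i \<in> Field \<Lambda> \<Longrightarrow> j \<in> Field \<Lambda> \<Longrightarrow> i \<noteq> j \<Longrightarrow> (i, j) \<in> \<Lambda> \<or> (j, i) \<in> \<Lambda>"
    and wf: "wf (\<Lambda> - Id)"
    using wo unfolding well_order_on_def linear_order_on_def partial_order_on_def preorder_on_def
      refl_on_def antisym_def total_on_def by blast+
  have fld: "\<And>i j. (i, j) \<in> \<Lambda> \<Longrightarrow> i \<in> Field \<Lambda> \<and> j \<in> Field \<Lambda>" by (auto simp: Field_def)
  have \<xi>_id: "\<And>i n x. i \<in> Field \<Lambda> \<Longrightarrow> x \<in> cx_carrier (X i) n \<Longrightarrow> \<xi> i i n x = x"
    and \<xi>: "\<And>i j. (i, j) \<in> \<Lambda> \<Longrightarrow> fmor R (X i) (X j) (\<xi> i j)"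
    and \<xi>\<xi>: "\<And>i j k n x. (i, j) \<in> \<Lambda> \<Longrightarrow> (j, k) \<in> \<Lambda> \<Longrightarrow> x \<in> cx_carrier (X i) n \<Longrightarrow> \<xi> j k n (\<xi> i j n x) = \<xi> i k n x"
    and lim: "\<And>j. j \<in> Field \<Lambda> \<Longrightarrow> is_limit \<Lambda> j \<Longrightarrow> is_colimit R \<Lambda> (underS \<Lambda> j) X \<xi> (X j) (\<lambda>i. \<xi> i j)"
    using seq by (simp_all add: transfinite_sequence_def mor_eq_def mor_comp_def mor_id_def)
  have c: "\<And>i. i \<in> Field \<Lambda> \<Longrightarrow> fmor R (X i) Y (c i)"
    and c\<xi>: "\<And>i j n x. (i, j) \<in> \<Lambda> \<Longrightarrow> x \<in> cx_carrier (X i) n \<Longrightarrow> c j n (\<xi> i j n x) = c i n x"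
    using co fld by (auto simp: is_colimit_def is_cocone_def mor_eq_def mor_comp_def)
  \<comment> \<open>Compatibility refers to strictly smaller k only:
    \<open>dependent_wf_choice\<close> needs \<open>Q\<close> to depend on w below i alone. The
    condition involving u starts the recursion at i0, where there is no smaller index.\<close>
  define Q where "Q w i wi \<longleftrightarrow> (i \<in> Field \<Lambda> \<longrightarrow>
      fmor R (X i) W wi \<and> mor_eq (X i) (q \<circ>\<^sub>m wi) (v \<circ>\<^sub>m c i) \<and>
      (\<forall>k. (k, i) \<in> \<Lambda> - Id \<longrightarrow> mor_eq (X k) (wi \<circ>\<^sub>m \<xi> k i) (w k)) \<and> mor_eq (X i0) (wi \<circ>\<^sub>m \<xi> i0 i) u)"
    for w :: "'i \<Rightarrow> int \<Rightarrow> 'u \<Rightarrow> 't" and i wi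
  have "\<exists>w. \<forall>i. Q w i (w i)"
  proof (rule dependent_wf_choice[OF wf])
    show "Q f x r = Q g x r" if "\<And>z. (z, x) \<in> \<Lambda> - Id \<Longrightarrow> f z = g z" for f g x r
      using that by (auto simp: Q_def)
  next
    fix i and w :: "'i \<Rightarrow> int \<Rightarrow> 'u \<Rightarrow> 't"
    assume IH: "\<And>k. (k, i) \<in> \<Lambda> - Id \<Longrightarrow> Q w k (w k)"
    show "\<exists>wi. Q w i wi"
    proof (cases "i \<in> Field \<Lambda>")
      case False
      then show ?thesis by (simp add: Q_def)
    next
      case i: True
      have w: "fmor R (X k) W (w k)" and qw: "mor_eq (X k) (q \<circ>\<^sub>m w k) (v \<circ>\<^sub>m c k)"
        if "(k, i) \<in> \<Lambda> - Id" for k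
        using IH[OF that] that fld by (auto simp: Q_def)
      have ww: "mor_eq (X k) (w j \<circ>\<^sub>m \<xi> k j) (w k)"
        if kj: "(k, j) \<in> \<Lambda>" and j: "(j, i) \<in> \<Lambda> - Id" for k j
        using IH[OF j] kj j fld[of k j] \<xi>_id[of k] by (cases "k = j") (auto simp: Q_def mor_eq_def mor_comp_def)
      \<comment> \<open>If some k lies strictly below i, then so does i0, and the condition on u is
        inherited from w i0.\<close>
      have bots: "mor_eq (X i0) (wi \<circ>\<^sub>m \<xi> i0 i) u"
        if wi: "\<And>k. (k, i) \<in> \<Lambda> - Id \<Longrightarrow> mor_eq (X k) (wi \<circ>\<^sub>m \<xi> k i) (w k)" and k: "(k, i) \<in> \<Lambda> - Id" for wi k
      proof -
        have b: "(i0, i) \<in> \<Lambda> - Id"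
          using i0(2)[of k] i0(2)[of i] k fld[of k i] antisym[of k i] by auto
        then have "Q w i0 (w i0)" by (rule IH)
        then have "mor_eq (X i0) (w i0 \<circ>\<^sub>m \<xi> i0 i0) u" using i0(1) by (simp add: Q_def)
        then show ?thesis using wi[OF b] \<xi>_id[OF i0(1)] by (simp add: mor_eq_def mor_comp_def)
      qed
      consider "underS \<Lambda> i = {}" | "is_limit \<Lambda> i" | k where "is_succ \<Lambda> k i"
        by (auto simp: is_limit_def)
      then show ?thesis
      proof cases
        case 1
        then have "i = i0" using i0(2)[OF i] by (auto simp: underS_def)
        then show ?thesis
          using u eq 1 \<xi>_id[OF i0(1)] by (intro exI[of _ u]) (auto simp: Q_def underS_def mor_eq_def mor_comp_def)
      next
        case 2
        have D: "k \<in> underS \<Lambda> i \<longleftrightarrow> (k, i) \<in> \<Lambda> - Id" for k by (auto simp: underS_def)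
        obtain t where t: "fmor R (X i) W t" "\<And>k. k \<in> underS \<Lambda> i \<Longrightarrow> mor_eq (X k) (t \<circ>\<^sub>m \<xi> k i) (w k)"
          "mor_eq (X i) (q \<circ>\<^sub>m t) (v \<circ>\<^sub>m c i)"
        proof -
          have "mor_eq (X k) (q \<circ>\<^sub>m w k) (v \<circ>\<^sub>m c i \<circ>\<^sub>m \<xi> k i)" if "k \<in> underS \<Lambda> i" for k
            using qw[of k] that c\<xi>[of k i] unfolding D by (simp add: mor_eq_def mor_comp_def)
          then have "\<exists>t. fmor R (X i) W t \<and> (\<forall>k\<in>underS \<Lambda> i. mor_eq (X k) (t \<circ>\<^sub>m \<xi> k i) (w k)) \<and>
              mor_eq (X i) (q \<circ>\<^sub>m t) (v \<circ>\<^sub>m c i)"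
            by (intro colimit_lift[OF lim[OF i 2] e q fmor_comp[OF c[OF i] v]]) (simp_all add: D w ww)
          then show ?thesis using that by blast
        qed
        obtain k where "k \<in> underS \<Lambda> i" using 2 by (auto simp: is_limit_def)
        then have "mor_eq (X i0) (t \<circ>\<^sub>m \<xi> i0 i) u" using bots t(2) unfolding D by blast
        then show ?thesis using t unfolding D by (intro exI[of _ t]) (simp add: Q_def)
      next
        case 3
        have ki: "(k, i) \<in> \<Lambda> - Id" and least: "\<And>l. (k, l) \<in> \<Lambda> \<Longrightarrow> l \<noteq> k \<Longrightarrow> (i, l) \<in> \<Lambda>"
          using 3 by (auto simp: is_succ_def aboveS_def)
        have "mor_eq (X k) (v \<circ>\<^sub>m c i \<circ>\<^sub>m \<xi> k i) (q \<circ>\<^sub>m w k)"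
          using qw[OF ki] c\<xi>[of k i] ki by (simp add: mor_eq_def mor_comp_def)
        then obtain t where t: "fmor R (X i) W t" "mor_eq (X k) (t \<circ>\<^sub>m \<xi> k i) (w k)" "mor_eq (X i) (q \<circ>\<^sub>m t) (v \<circ>\<^sub>m c i)"
          using L[OF 3] w[OF ki] fmor_comp[OF c[OF i] v] unfolding lifts_def by blast
        have tl: "mor_eq (X l) (t \<circ>\<^sub>m \<xi> l i) (w l)" if l: "(l, i) \<in> \<Lambda> - Id" for l
        proof (rule mor_eqI)
          fix n x assume x: "x \<in> cx_carrier (X l) n"
          \<comment> \<open>Otherwise l lies strictly above k, hence at or above its successor i,
            contrary to l being strictly below i.\<close>
          have lk: "(l, k) \<in> \<Lambda>"
            using total[of l k] least[of l] refl[of k] fld[of l i] fld[of k i] l ki antisym[of l i] by blast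
          have "(t \<circ>\<^sub>m \<xi> l i) n x = t n (\<xi> k i n (\<xi> l k n x))"
            using \<xi>\<xi>[OF lk _ x, of i] ki by (simp add: mor_comp_def)
          also have "\<dots> = w k n (\<xi> l k n x)"
            using mor_eqD[OF t(2) fmor_closed[OF \<xi>[OF lk] x]] by (simp add: mor_comp_def)
          also have "\<dots> = w l n x"
            using mor_eqD[OF ww[OF lk ki] x] by (simp add: mor_comp_def)
          finally show "(t \<circ>\<^sub>m \<xi> l i) n x = w l n x" .
        qed
        then show ?thesis using t bots[OF tl ki] by (intro exI[of _ t]) (simp add: Q_def)
      qed
    qed
  qed
  then obtain w where w: "\<And>i. Q w i (w i)" by blast
  have "mor_eq (X i) (w j \<circ>\<^sub>m \<xi> i j) (w i)" if ij: "(i, j) \<in> \<Lambda>" for i j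
    using w[of j] fld[OF ij] ij \<xi>_id[of i] by (cases "i = j") (auto simp: Q_def mor_eq_def mor_comp_def)
  then have "\<exists>t. fmor R Y W t \<and> (\<forall>i\<in>Field \<Lambda>. mor_eq (X i) (t \<circ>\<^sub>m c i) (w i)) \<and> mor_eq Y (q \<circ>\<^sub>m t) v"
    by (intro colimit_lift[OF co e q v]) (use w in \<open>auto simp: Q_def\<close>)
  then obtain t where t: "fmor R Y W t" "mor_eq (X i0) (t \<circ>\<^sub>m c i0) (w i0)" "mor_eq Y (q \<circ>\<^sub>m t) v"
    using i0(1) by blast
  have "mor_eq (X i0) (w i0 \<circ>\<^sub>m \<xi> i0 i0) u" using w[of i0] i0(1) by (simp add: Q_def)
  then have "mor_eq (X i0) (t \<circ>\<^sub>m c i0) u"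
    using t(2) \<xi>_id[OF i0(1)] by (simp add: mor_eq_def mor_comp_def)
  then show "\<exists>h. fmor R Y W h \<and> mor_eq (X i0) (h \<circ>\<^sub>m c i0) u \<and> mor_eq Y (q \<circ>\<^sub>m h) v"
    using t by blast
qed


section \<open>Tensor products\<close>

subsection \<open>Free modules and universal properties\<close>

lemma free_module_simps:
  "\<phi> \<in> carrier (free_module R G) \<longleftrightarrow> (\<forall>g\<in>G. \<phi> g \<in> carrier R) \<and> (\<forall>g. g \<notin> G \<longrightarrow> \<phi> g = \<zero>\<^bsub>R\<^esub>) \<and>
     finite {g. \<phi> g \<noteq> \<zero>\<^bsub>R\<^esub>}"
  "\<zero>\<^bsub>free_module R G\<^esub> = (\<lambda>_. \<zero>\<^bsub>R\<^esub>)"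
  "\<phi> \<oplus>\<^bsub>free_module R G\<^esub> \<psi> = (\<lambda>g. \<phi> g \<oplus>\<^bsub>R\<^esub> \<psi> g)"
  "a \<odot>\<^bsub>free_module R G\<^esub> \<phi> = (\<lambda>g. a \<otimes>\<^bsub>R\<^esub> \<phi> g)"
  by (simp_all add: free_module_def)

lemma free_module_coeff: "cring R \<Longrightarrow> \<phi> \<in> carrier (free_module R G) \<Longrightarrow> \<phi> g \<in> carrier R"
  by (cases "g \<in> G") (auto simp: free_module_simps cring.cring_simprules)

lemma module_free_module:
  assumes "cring R"
  shows "module R (free_module R G)"
proof -
  interpret cring R by fact
  let ?F = "free_module R G"
  note coeff = free_module_coeff[OF assms, where G = G]
  have supp: "finite {g. f g \<noteq> \<zero>\<^bsub>R\<^esub>}" if "\<phi> \<in> carrier ?F" "\<And>g. \<phi> g = \<zero>\<^bsub>R\<^esub> \<Longrightarrow> f g = \<zero>\<^bsub>R\<^esub>" for f \<phi>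
    by (rule finite_subset[of _ "{g. \<phi> g \<noteq> \<zero>\<^bsub>R\<^esub>}"]) (use that in \<open>auto simp: free_module_simps\<close>)
  have add: "\<phi> \<oplus>\<^bsub>?F\<^esub> \<psi> \<in> carrier ?F" if \<phi>: "\<phi> \<in> carrier ?F" and \<psi>: "\<psi> \<in> carrier ?F" for \<phi> \<psi>
  proof -
    have "finite {g. \<phi> g \<oplus>\<^bsub>R\<^esub> \<psi> g \<noteq> \<zero>\<^bsub>R\<^esub>}"
      by (rule finite_subset[of _ "{g. \<phi> g \<noteq> \<zero>\<^bsub>R\<^esub>} \<union> {g. \<psi> g \<noteq> \<zero>\<^bsub>R\<^esub>}"])
        (use \<phi> \<psi> in \<open>auto simp: free_module_simps\<close>)
    then show ?thesis using \<phi> \<psi> by (auto simp: free_module_simps)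
  qed
  have smult: "a \<odot>\<^bsub>?F\<^esub> \<phi> \<in> carrier ?F" if a: "a \<in> carrier R" and \<phi>: "\<phi> \<in> carrier ?F" for a \<phi>
    using supp[OF \<phi>, of "\<lambda>g. a \<otimes>\<^bsub>R\<^esub> \<phi> g"] \<phi> a by (auto simp: free_module_simps)
  have "abelian_group ?F"
  proof (rule abelian_groupI)
    fix \<phi> assume \<phi>: "\<phi> \<in> carrier ?F"
    have "(\<lambda>g. \<ominus>\<^bsub>R\<^esub> \<phi> g) \<in> carrier ?F"
      using supp[OF \<phi>, of "\<lambda>g. \<ominus>\<^bsub>R\<^esub> \<phi> g"] \<phi> by (auto simp: free_module_simps)
    then show "\<exists>\<psi>\<in>carrier ?F. \<psi> \<oplus>\<^bsub>?F\<^esub> \<phi> = \<zero>\<^bsub>?F\<^esub>"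
      by (rule bexI[rotated]) (use coeff[OF \<phi>] in \<open>auto simp: free_module_simps l_neg\<close>)
  next
    show "\<zero>\<^bsub>?F\<^esub> \<in> carrier ?F" by (simp add: free_module_simps)
  qed (use add coeff in \<open>simp_all add: free_module_simps(2,3) a_ac\<close>)
  then show ?thesis
    by (intro moduleI assms smult)
      (use coeff in \<open>simp_all add: free_module_simps(2-4) l_distr r_distr m_assoc\<close>)
qed

lemma free_gen_closed: "cring R \<Longrightarrow> g \<in> G \<Longrightarrow> free_gen R g \<in> carrier (free_module R G)"
  by (auto simp: free_module_simps free_gen_def cring.cring_simprules)

context
  fixes R :: "('r, 'm) ring_scheme" and G :: "'g set" and M :: "('r, 'a) module" and h :: "'g \<Rightarrow> 'a"
  assumes M: "module R M" and h: "h \<in> G \<rightarrow> carrier M"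
begin

interpretation M: module R M by (rule M)

text \<open>The sum in \<open>free_lift\<close> runs over the support, which varies with \<phi>.
  Additivity needs one finite index set for both arguments.\<close>

lemma free_lift_on:
  assumes \<phi>: "\<phi> \<in> carrier (free_module R G)" and A: "finite A" "A \<subseteq> G" "{g. \<phi> g \<noteq> \<zero>\<^bsub>R\<^esub>} \<subseteq> A"
  shows "free_lift R M h \<phi> = (\<Oplus>\<^bsub>M\<^esub>g\<in>A. \<phi> g \<odot>\<^bsub>M\<^esub> h g)"
  unfolding free_lift_def
  by (rule M.add.finprod_mono_neutral_cong_left[OF A(1,3)])
    (use h A free_module_coeff[OF M.R.is_cring \<phi>] in \<open>auto simp: Pi_iff subset_iff\<close>)

lemma support_subset: "\<phi> \<in> carrier (free_module R G) \<Longrightarrow> {g. \<phi> g \<noteq> \<zero>\<^bsub>R\<^esub>} \<subseteq> G"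
  by (auto simp: free_module_simps)

lemma linear_free_lift: "linear_map R (free_module R G) M (free_lift R M h)"
proof (rule linear_mapI)
  interpret F: module R "free_module R G" by (rule module_free_module[OF M.R.is_cring])
  note coeff = free_module_coeff[OF M.R.is_cring, where G = G]
  fix \<phi> assume \<phi>: "\<phi> \<in> carrier (free_module R G)"
  let ?A = "{g. \<phi> g \<noteq> \<zero>\<^bsub>R\<^esub>}"
  have A: "finite ?A" "?A \<subseteq> G" using \<phi> support_subset by (auto simp: free_module_simps)
  have cl: "(\<lambda>g. \<phi> g \<odot>\<^bsub>M\<^esub> h g) \<in> X \<rightarrow> carrier M" if "X \<subseteq> G" "\<phi> \<in> carrier (free_module R G)" for \<phi> X
    using h that coeff by (auto simp: Pi_iff)
  show "free_lift R M h \<phi> \<in> carrier M"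
    unfolding free_lift_def by (rule M.finsum_closed[OF cl[OF A(2) \<phi>]])
  show "free_lift R M h (a \<odot>\<^bsub>free_module R G\<^esub> \<phi>) = a \<odot>\<^bsub>M\<^esub> free_lift R M h \<phi>" if a: "a \<in> carrier R" for a
  proof -
    have "free_lift R M h (a \<odot>\<^bsub>free_module R G\<^esub> \<phi>) = (\<Oplus>\<^bsub>M\<^esub>g\<in>?A. (a \<odot>\<^bsub>free_module R G\<^esub> \<phi>) g \<odot>\<^bsub>M\<^esub> h g)"
      by (rule free_lift_on[OF F.smult_closed[OF a \<phi>] A]) (use a in \<open>auto simp: free_module_simps\<close>)
    also have "\<dots> = (\<Oplus>\<^bsub>M\<^esub>g\<in>?A. a \<odot>\<^bsub>M\<^esub> (\<phi> g \<odot>\<^bsub>M\<^esub> h g))"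
      by (rule M.finsum_cong') (use a h A coeff[OF \<phi>] in \<open>auto simp: free_module_simps(4) M.smult_assoc1 Pi_iff subset_iff\<close>)
    also have "\<dots> = a \<odot>\<^bsub>M\<^esub> free_lift R M h \<phi>"
      unfolding free_lift_def by (rule M.finsum_smult_ldistr[OF A(1) a cl[OF A(2) \<phi>], symmetric])
    finally show ?thesis .
  qed
  fix \<psi> assume \<psi>: "\<psi> \<in> carrier (free_module R G)"
  let ?B = "?A \<union> {g. \<psi> g \<noteq> \<zero>\<^bsub>R\<^esub>}"
  have B: "finite ?B" "?B \<subseteq> G" using A \<psi> support_subset by (auto simp: free_module_simps)
  have "free_lift R M h (\<phi> \<oplus>\<^bsub>free_module R G\<^esub> \<psi>) = (\<Oplus>\<^bsub>M\<^esub>g\<in>?B. (\<phi> \<oplus>\<^bsub>free_module R G\<^esub> \<psi>) g \<odot>\<^bsub>M\<^esub> h g)"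
    by (rule free_lift_on[OF F.a_closed[OF \<phi> \<psi>] B]) (auto simp: free_module_simps)
  also have "\<dots> = (\<Oplus>\<^bsub>M\<^esub>g\<in>?B. \<phi> g \<odot>\<^bsub>M\<^esub> h g \<oplus>\<^bsub>M\<^esub> \<psi> g \<odot>\<^bsub>M\<^esub> h g)"
    by (rule M.finsum_cong') (use h B coeff[OF \<phi>] coeff[OF \<psi>] in \<open>auto simp: free_module_simps(3) M.smult_l_distr Pi_iff subset_iff\<close>)
  also have "\<dots> = (\<Oplus>\<^bsub>M\<^esub>g\<in>?B. \<phi> g \<odot>\<^bsub>M\<^esub> h g) \<oplus>\<^bsub>M\<^esub> (\<Oplus>\<^bsub>M\<^esub>g\<in>?B. \<psi> g \<odot>\<^bsub>M\<^esub> h g)"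
    by (rule M.finsum_addf[OF cl[OF B(2) \<phi>] cl[OF B(2) \<psi>]])
  also have "\<dots> = free_lift R M h \<phi> \<oplus>\<^bsub>M\<^esub> free_lift R M h \<psi>"
    by (subst (1 2) free_lift_on[OF _ B]) (use \<phi> \<psi> in auto)
  finally show "free_lift R M h (\<phi> \<oplus>\<^bsub>free_module R G\<^esub> \<psi>) = free_lift R M h \<phi> \<oplus>\<^bsub>M\<^esub> free_lift R M h \<psi>" .
qed

lemma free_lift_gen: "g \<in> G \<Longrightarrow> free_lift R M h (free_gen R g) = h g"
proof -
  assume g: "g \<in> G"
  then have hg: "h g \<in> carrier M" using h by auto
  have "free_lift R M h (free_gen R g) = (\<Oplus>\<^bsub>M\<^esub>g'\<in>{g}. free_gen R g g' \<odot>\<^bsub>M\<^esub> h g')"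
    by (rule free_lift_on[OF free_gen_closed[OF M.R.is_cring g]]) (use g in \<open>auto simp: free_gen_def\<close>)
  also have "\<dots> = h g" using hg by (simp add: free_gen_def)
  finally show ?thesis .
qed

end

text \<open>Induction on a finite set containing the support, clearing one coefficient at a
  time.\<close>

lemma free_module_in_submodule:
  assumes R: "cring R" and H: "submodule H R (free_module R G)" and gen: "\<And>g. g \<in> G \<Longrightarrow> free_gen R g \<in> H"
    and \<phi>: "\<phi> \<in> carrier (free_module R G)"
  shows "\<phi> \<in> H"
proof -
  interpret cring R by fact
  interpret F: module R "free_module R G" by (rule module_free_module[OF R])
  have "finite A \<Longrightarrow> \<phi> \<in> carrier (free_module R G) \<Longrightarrow> {g. \<phi> g \<noteq> \<zero>\<^bsub>R\<^esub>} \<subseteq> A \<Longrightarrow> \<phi> \<in> H" for A \<phi>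
  proof (induction A arbitrary: \<phi> rule: finite_induct)
    case empty
    then have "\<phi> = \<zero>\<^bsub>free_module R G\<^esub>" by (auto simp: free_module_simps)
    then show ?case using F.submodule_zero[OF H] by simp
  next
    case (insert g A)
    note \<phi> = insert.prems(1)
    let ?\<psi> = "\<phi>(g := \<zero>\<^bsub>R\<^esub>)"
    have "finite {g'. ?\<psi> g' \<noteq> \<zero>\<^bsub>R\<^esub>}"
      by (rule finite_subset[of _ "{g. \<phi> g \<noteq> \<zero>\<^bsub>R\<^esub>}"]) (use \<phi> in \<open>auto simp: free_module_simps\<close>)
    then have \<psi>: "?\<psi> \<in> carrier (free_module R G)" using \<phi> by (auto simp: free_module_simps)
    have \<psi>H: "?\<psi> \<in> H" by (rule insert.IH[OF \<psi>]) (use insert.prems in auto)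
    show ?case
    proof (cases "g \<in> G")
      case True
      have "\<phi> g \<odot>\<^bsub>free_module R G\<^esub> free_gen R g \<in> H"
        by (rule F.submoduleE(4)[OF H free_module_coeff[OF R \<phi>] gen[OF True]])
      moreover have "\<phi> = ?\<psi> \<oplus>\<^bsub>free_module R G\<^esub> \<phi> g \<odot>\<^bsub>free_module R G\<^esub> free_gen R g"
        using free_module_coeff[OF R \<phi>] by (auto simp: free_module_simps(3,4) free_gen_def fun_eq_iff)
      ultimately show ?thesis using \<psi>H F.submoduleE(5)[OF H] by metis
    next
      case False
      then have "?\<psi> = \<phi>" using \<phi> by (auto simp: free_module_simps)
      then show ?thesis using \<psi>H by simp
    qed
  qed
  then show ?thesis using \<phi> by (auto simp: free_module_simps)
qed

lemma submodule_span_minimal: "X \<subseteq> N \<Longrightarrow> submodule N R M \<Longrightarrow> submodule_span R M X \<subseteq> N"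
  by (rule hull_minimal)

lemma submodule_submodule_span:
  fixes M :: "('r, 'a) module"
  assumes M: "module R M" and X: "X \<subseteq> carrier M"
  shows "submodule (submodule_span R M X) R M"
proof -
  interpret M: module R M by fact
  show ?thesis
  proof (rule M.submoduleI)
    show "submodule_span R M X \<subseteq> carrier M"
      by (rule submodule_span_minimal[OF X M.carrier_is_submodule])
  qed (auto simp: hull_def M.submodule_zero M.submoduleE)
qed

lemma quot_lift:
  assumes M: "module R M" and N: "submodule N R M" and P: "module R P"
    and L: "linear_map R M P L" and LN: "\<And>x. x \<in> N \<Longrightarrow> L x = \<zero>\<^bsub>P\<^esub>"
  shows "\<exists>\<phi>. linear_map R (quot_module M N) P \<phi> \<and> (\<forall>x\<in>carrier M. \<phi> (N +>\<^bsub>M\<^esub> x) = L x)"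
proof -
  interpret M: module R M by fact
  interpret P: module R P by fact
  \<comment> \<open>Any representative will do, because L vanishes on N.\<close>
  define \<phi> where "\<phi> C = L (SOME x. x \<in> C)" for C
  have \<phi>: "\<phi> (N +>\<^bsub>M\<^esub> x) = L x" if x: "x \<in> carrier M" for x
  proof -
    let ?y = "SOME y. y \<in> N +>\<^bsub>M\<^esub> x"
    have "?y \<in> N +>\<^bsub>M\<^esub> x" by (rule someI[of "\<lambda>y. y \<in> N +>\<^bsub>M\<^esub> x" x], rule coset_self[OF M N x])
    then have yx: "?y \<in> carrier M" "N +>\<^bsub>M\<^esub> ?y = N +>\<^bsub>M\<^esub> x"
      using coset_repr[OF M N x] by blast+
    then have y: "?y \<in> carrier M" "?y \<ominus>\<^bsub>M\<^esub> x \<in> N"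
      using coset_eq_iff[OF M N yx(1) x] by simp_all
    have "L ?y \<ominus>\<^bsub>P\<^esub> L x = \<zero>\<^bsub>P\<^esub>"
      using LN[OF y(2)] linear_map_minus[OF M P L y(1) x] by simp
    then have "L ?y = L x"
      using linear_map_closed[OF L] y(1) x by (simp add: P.minus_eq_zero_iff)
    then show ?thesis by (simp add: \<phi>_def)
  qed
  have "linear_map R (quot_module M N) P \<phi>"
    by (rule linear_mapI)
      (auto simp: quot_carrier[OF M N] quot_add[OF M N] quot_smult[OF M N] \<phi> linear_map_closed[OF L]
        linear_map_add[OF L] linear_map_smult[OF L])
  then show ?thesis using \<phi> by blast
qed

text \<open>The maps defining the differential and \<^const>\<open>tensor_mor\<close> are only known to land in the
  quotient, not to respect the relations; a union of cosets that is a coset is a single one.\<close>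

lemma quot_map_coset_of_closed:
  fixes M :: "('r, 'a) module"
  assumes M: "module R M" and N: "submodule N R M" and M': "module R M'" and N': "submodule N' R M'"
    and x: "x \<in> carrier M" and hx: "h x \<in> carrier M'"
    and cl: "quot_map M' N' h (N +>\<^bsub>M\<^esub> x) \<in> carrier (quot_module M' N')"
  shows "quot_map M' N' h (N +>\<^bsub>M\<^esub> x) = N' +>\<^bsub>M'\<^esub> h x"
proof -
  obtain c where c: "c \<in> carrier M'" "quot_map M' N' h (N +>\<^bsub>M\<^esub> x) = N' +>\<^bsub>M'\<^esub> c"
    using cl by (auto simp: quot_carrier[OF M' N'])
  have "h x \<in> quot_map M' N' h (N +>\<^bsub>M\<^esub> x)"
    unfolding quot_map_def using coset_self[OF M N x] coset_self[OF M' N' hx] by blast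
  then show ?thesis using coset_repr[OF M' N' c(1)] c(2) by simp
qed

subsection \<open>Pure tensors\<close>

context
  fixes R :: "('r, 'm) ring_scheme" and A :: "('r, 'a) fcomplex" and B :: "('r, 'b) fcomplex"
  assumes A: "filtered_complex R A" and B: "filtered_complex R B"
begin

interpretation A: filtered_complex R A by (rule A)
interpretation B: filtered_complex R B by (rule B)
interpretation F: module R "tensor_free R A B n" for n by (rule module_free_module[OF A.cx.R.is_cring])

lemma gen_closed: "a \<in> cx_carrier A i \<Longrightarrow> b \<in> cx_carrier B (n - i) \<Longrightarrow> free_gen R (i, a, b) \<in> carrier (tensor_free R A B n)"
  by (rule free_gen_closed[OF A.cx.R.is_cring]) (simp add: tensor_gens_def)

lemma submodule_tensor_rels: "submodule (tensor_rels R A B n) R (tensor_free R A B n)"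
  unfolding tensor_rels_def Let_def by (rule submodule_submodule_span[OF F.module_axioms]) (auto simp: gen_closed)

lemma tensor_rel:
  "a \<in> cx_carrier A i \<Longrightarrow> a' \<in> cx_carrier A i \<Longrightarrow> b \<in> cx_carrier B (n - i) \<Longrightarrow>
    free_gen R (i, a \<oplus>\<^bsub>cx_mod A i\<^esub> a', b) \<ominus>\<^bsub>tensor_free R A B n\<^esub>
      (free_gen R (i, a, b) \<oplus>\<^bsub>tensor_free R A B n\<^esub> free_gen R (i, a', b)) \<in> tensor_rels R A B n"
  "a \<in> cx_carrier A i \<Longrightarrow> b \<in> cx_carrier B (n - i) \<Longrightarrow> b' \<in> cx_carrier B (n - i) \<Longrightarrow>
    free_gen R (i, a, b \<oplus>\<^bsub>cx_mod B (n - i)\<^esub> b') \<ominus>\<^bsub>tensor_free R A B n\<^esub>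
      (free_gen R (i, a, b) \<oplus>\<^bsub>tensor_free R A B n\<^esub> free_gen R (i, a, b')) \<in> tensor_rels R A B n"
  "c \<in> carrier R \<Longrightarrow> a \<in> cx_carrier A i \<Longrightarrow> b \<in> cx_carrier B (n - i) \<Longrightarrow>
    free_gen R (i, c \<odot>\<^bsub>cx_mod A i\<^esub> a, b) \<ominus>\<^bsub>tensor_free R A B n\<^esub>
      c \<odot>\<^bsub>tensor_free R A B n\<^esub> free_gen R (i, a, b) \<in> tensor_rels R A B n"
  "c \<in> carrier R \<Longrightarrow> a \<in> cx_carrier A i \<Longrightarrow> b \<in> cx_carrier B (n - i) \<Longrightarrow>
    free_gen R (i, a, c \<odot>\<^bsub>cx_mod B (n - i)\<^esub> b) \<ominus>\<^bsub>tensor_free R A B n\<^esub>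
      c \<odot>\<^bsub>tensor_free R A B n\<^esub> free_gen R (i, a, b) \<in> tensor_rels R A B n"
  unfolding tensor_rels_def Let_def by (rule hull_inc, blast)+

lemmas tensor_mod_facts = F.module_axioms submodule_tensor_rels

lemma pure_tensor_closed:
  "a \<in> cx_carrier A i \<Longrightarrow> b \<in> cx_carrier B (n - i) \<Longrightarrow> pure_tensor R A B n i a b \<in> carrier (tensor_mod R A B n)"
  unfolding tensor_mod_def pure_tensor_def quot_carrier[OF tensor_mod_facts] by (intro imageI gen_closed)

lemma linear_pure_tensor_left:
  assumes b: "b \<in> cx_carrier B (n - i)"
  shows "linear_map R (cx_mod A i) (tensor_mod R A B n) (\<lambda>a. pure_tensor R A B n i a b)"
proof (rule linear_mapI)
  show "pure_tensor R A B n i a b \<in> carrier (tensor_mod R A B n)" if "a \<in> cx_carrier A i" for a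
    using pure_tensor_closed that b .
  show "pure_tensor R A B n i (a \<oplus>\<^bsub>cx_mod A i\<^esub> a') b =
      pure_tensor R A B n i a b \<oplus>\<^bsub>tensor_mod R A B n\<^esub> pure_tensor R A B n i a' b"
    if "a \<in> cx_carrier A i" "a' \<in> cx_carrier A i" for a a'
    using that b tensor_rel(1)[of a i a' b n] gen_closed[OF _ b]
    by (simp add: tensor_mod_def pure_tensor_def quot_add[OF tensor_mod_facts] coset_eq_iff[OF tensor_mod_facts])
  show "pure_tensor R A B n i (c \<odot>\<^bsub>cx_mod A i\<^esub> a) b = c \<odot>\<^bsub>tensor_mod R A B n\<^esub> pure_tensor R A B n i a b"
    if "c \<in> carrier R" "a \<in> cx_carrier A i" for a c
    using that b tensor_rel(3)[of c a i b n] gen_closed[OF _ b]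
    by (simp add: tensor_mod_def pure_tensor_def quot_smult[OF tensor_mod_facts] coset_eq_iff[OF tensor_mod_facts])
qed

lemma linear_pure_tensor_right:
  assumes a: "a \<in> cx_carrier A i"
  shows "linear_map R (cx_mod B (n - i)) (tensor_mod R A B n) (pure_tensor R A B n i a)"
proof (rule linear_mapI)
  show "pure_tensor R A B n i a b \<in> carrier (tensor_mod R A B n)" if "b \<in> cx_carrier B (n - i)" for b
    using pure_tensor_closed a that .
  show "pure_tensor R A B n i a (b \<oplus>\<^bsub>cx_mod B (n - i)\<^esub> b') =
      pure_tensor R A B n i a b \<oplus>\<^bsub>tensor_mod R A B n\<^esub> pure_tensor R A B n i a b'"
    if "b \<in> cx_carrier B (n - i)" "b' \<in> cx_carrier B (n - i)" for b b'
    using that a tensor_rel(2)[of a i b n b'] gen_closed[OF a]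
    by (simp add: tensor_mod_def pure_tensor_def quot_add[OF tensor_mod_facts] coset_eq_iff[OF tensor_mod_facts])
  show "pure_tensor R A B n i a (c \<odot>\<^bsub>cx_mod B (n - i)\<^esub> b) = c \<odot>\<^bsub>tensor_mod R A B n\<^esub> pure_tensor R A B n i a b"
    if "c \<in> carrier R" "b \<in> cx_carrier B (n - i)" for b c
    using that a tensor_rel(4)[of c a i b n] gen_closed[OF a]
    by (simp add: tensor_mod_def pure_tensor_def quot_smult[OF tensor_mod_facts] coset_eq_iff[OF tensor_mod_facts])
qed

text \<open>The universal property of the tensor product in degree n. The relations form a span, so
  it suffices that the kernel of the lift to the free module contains the four generating
  families.\<close>

lemma tensor_lift:
  assumes N: "module R N"
    and left: "\<And>i b. b \<in> cx_carrier B (n - i) \<Longrightarrow> linear_map R (cx_mod A i) N (\<lambda>a. \<beta> i a b)"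
    and right: "\<And>i a. a \<in> cx_carrier A i \<Longrightarrow> linear_map R (cx_mod B (n - i)) N (\<beta> i a)"
  shows "\<exists>\<phi>. linear_map R (tensor_mod R A B n) N \<phi> \<and>
    (\<forall>i. \<forall>a\<in>cx_carrier A i. \<forall>b\<in>cx_carrier B (n - i). \<phi> (pure_tensor R A B n i a b) = \<beta> i a b)"
proof -
  interpret N: module R N by fact
  let ?F = "tensor_free R A B n" and ?\<beta> = "\<lambda>(i, a, b). \<beta> i a b"
  define L where "L = free_lift R N ?\<beta>"
  have \<beta>: "\<beta> i a b \<in> carrier N" if "a \<in> cx_carrier A i" "b \<in> cx_carrier B (n - i)" for i a b
    using linear_map_closed[OF left[OF that(2)] that(1)] .
  have \<beta>': "?\<beta> \<in> tensor_gens A B n \<rightarrow> carrier N" using \<beta> by (auto simp: tensor_gens_def)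
  have L: "linear_map R ?F N L" unfolding L_def by (rule linear_free_lift[OF N \<beta>'])
  have Lg: "L (free_gen R (i, a, b)) = \<beta> i a b" if "a \<in> cx_carrier A i" "b \<in> cx_carrier B (n - i)" for i a b
    using free_lift_gen[OF N \<beta>', of "(i, a, b)"] that by (simp add: L_def tensor_gens_def)
  have sub0: "submodule {\<zero>\<^bsub>N\<^esub>} R N" by (rule N.submoduleI) auto
  have "tensor_rels R A B n \<subseteq> {x \<in> carrier ?F. L x \<in> {\<zero>\<^bsub>N\<^esub>}}"
    unfolding tensor_rels_def Let_def
  proof (rule submodule_span_minimal[OF _ submodule_vimage[OF F.module_axioms N L sub0]], intro Un_least subsetI, goal_cases)
    case (1 x)
    then obtain i a a' b where ab: "a \<in> cx_carrier A i" "a' \<in> cx_carrier A i" "b \<in> cx_carrier B (n - i)"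
      and x: "x = free_gen R (i, a \<oplus>\<^bsub>cx_mod A i\<^esub> a', b) \<ominus>\<^bsub>?F\<^esub> (free_gen R (i, a, b) \<oplus>\<^bsub>?F\<^esub> free_gen R (i, a', b))" by blast
    show ?case using ab unfolding x
      by (simp add: gen_closed linear_map_minus[OF F.module_axioms N L] linear_map_add[OF L] Lg
        linear_map_add[OF left] \<beta>)
  next
    case (2 x)
    then obtain i a b b' where ab: "a \<in> cx_carrier A i" "b \<in> cx_carrier B (n - i)" "b' \<in> cx_carrier B (n - i)"
      and x: "x = free_gen R (i, a, b \<oplus>\<^bsub>cx_mod B (n - i)\<^esub> b') \<ominus>\<^bsub>?F\<^esub> (free_gen R (i, a, b) \<oplus>\<^bsub>?F\<^esub> free_gen R (i, a, b'))" by blast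
    show ?case using ab unfolding x
      by (simp add: gen_closed linear_map_minus[OF F.module_axioms N L] linear_map_add[OF L] Lg
        linear_map_add[OF right] \<beta>)
  next
    case (3 x)
    then obtain c i a b where ab: "c \<in> carrier R" "a \<in> cx_carrier A i" "b \<in> cx_carrier B (n - i)"
      and x: "x = free_gen R (i, c \<odot>\<^bsub>cx_mod A i\<^esub> a, b) \<ominus>\<^bsub>?F\<^esub> c \<odot>\<^bsub>?F\<^esub> free_gen R (i, a, b)" by blast
    show ?case using ab unfolding x
      by (simp add: gen_closed linear_map_minus[OF F.module_axioms N L] linear_map_smult[OF L] Lg
        linear_map_smult[OF left] \<beta>)
  next
    case (4 x)
    then obtain c i a b where ab: "c \<in> carrier R" "a \<in> cx_carrier A i" "b \<in> cx_carrier B (n - i)"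
      and x: "x = free_gen R (i, a, c \<odot>\<^bsub>cx_mod B (n - i)\<^esub> b) \<ominus>\<^bsub>?F\<^esub> c \<odot>\<^bsub>?F\<^esub> free_gen R (i, a, b)" by blast
    show ?case using ab unfolding x
      by (simp add: gen_closed linear_map_minus[OF F.module_axioms N L] linear_map_smult[OF L] Lg
        linear_map_smult[OF right] \<beta>)
  qed
  then obtain \<phi> where \<phi>: "linear_map R (quot_module ?F (tensor_rels R A B n)) N \<phi>"
    "\<And>x. x \<in> carrier ?F \<Longrightarrow> \<phi> (tensor_rels R A B n +>\<^bsub>?F\<^esub> x) = L x"
    using quot_lift[OF tensor_mod_facts N L] by blast
  show ?thesis
    by (rule exI[of _ \<phi>]) (use \<phi> gen_closed Lg in \<open>simp add: tensor_mod_def pure_tensor_def\<close>)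
qed

text \<open>That a tensor product is again a filtered complex enters as a hypothesis. In the
  application it comes from \<open>is_pushout\<close>, whose \<open>fmor\<close> conditions include
  it for both tensor products.\<close>

lemma module_tensor_mod: "filtered_complex R (tensor R A B) \<Longrightarrow> module R (tensor_mod R A B n)"
  using filtered_complex.module_cx[of R "tensor R A B" n] by (simp add: tensor_def)

text \<open>Pulled back to the free module, the difference of f and g has a submodule as its kernel,
  and that submodule contains every generator.\<close>

lemma tensor_mod_eqI:
  assumes T: "module R (tensor_mod R A B n)" and N: "module R N"
    and f: "linear_map R (tensor_mod R A B n) N f" and g: "linear_map R (tensor_mod R A B n) N g"
    and eq: "\<And>i a b. a \<in> cx_carrier A i \<Longrightarrow> b \<in> cx_carrier B (n - i) \<Longrightarrow>
      f (pure_tensor R A B n i a b) = g (pure_tensor R A B n i a b)"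
    and t: "t \<in> carrier (tensor_mod R A B n)"
  shows "f t = g t"
proof -
  interpret N: module R N by fact
  let ?F = "tensor_free R A B n" and ?\<pi> = "\<lambda>x. tensor_rels R A B n +>\<^bsub>tensor_free R A B n\<^esub> x"
  have \<pi>: "linear_map R ?F (tensor_mod R A B n) ?\<pi>"
    unfolding tensor_mod_def by (rule quot_proj[OF tensor_mod_facts])
  have lin: "linear_map R ?F N (\<lambda>x. f (?\<pi> x) \<ominus>\<^bsub>N\<^esub> g (?\<pi> x))"
    by (intro linear_map_fun_minus[OF F.module_axioms N] linear_map_comp[OF \<pi> f] linear_map_comp[OF \<pi> g])
  have sub0: "submodule {\<zero>\<^bsub>N\<^esub>} R N" by (rule N.submoduleI) auto
  let ?H = "{x \<in> carrier ?F. f (?\<pi> x) \<ominus>\<^bsub>N\<^esub> g (?\<pi> x) \<in> {\<zero>\<^bsub>N\<^esub>}}"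
  have H: "x \<in> ?H" if "x \<in> carrier ?F" for x
  proof (rule free_module_in_submodule[OF A.cx.R.is_cring _ _ that])
    show "submodule ?H R ?F" by (rule submodule_vimage[OF F.module_axioms N lin sub0])
    fix y assume "y \<in> tensor_gens A B n"
    then obtain i a b where y: "y = (i, a, b)" "a \<in> cx_carrier A i" "b \<in> cx_carrier B (n - i)"
      by (auto simp: tensor_gens_def)
    then show "free_gen R y \<in> ?H"
      using eq[OF y(2,3)] linear_map_closed[OF g pure_tensor_closed[OF y(2,3)]] gen_closed[OF y(2,3)]
      by (simp add: pure_tensor_def)
  qed
  obtain x where x: "x \<in> carrier ?F" "t = ?\<pi> x"
    using t by (auto simp: tensor_mod_def quot_carrier[OF tensor_mod_facts])
  then have "f t \<ominus>\<^bsub>N\<^esub> g t = \<zero>\<^bsub>N\<^esub>" using H[OF x(1)] by simp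
  then show ?thesis
    using linear_map_closed[OF f t] linear_map_closed[OF g t] by (simp add: N.minus_eq_zero_iff)
qed

lemma tensor_simps [simp]: "cx_mod (tensor R A B) n = tensor_mod R A B n"
  by (simp add: tensor_def)

lemma pure_tensor_F:
  "a \<in> cx_F A q i \<Longrightarrow> b \<in> cx_F B (p - q) (n - i) \<Longrightarrow> pure_tensor R A B n i a b \<in> cx_F (tensor R A B) p n"
  unfolding tensor_def fcomplex.simps by (rule hull_inc) blast

text \<open>The filtration of a tensor product is a span of pure tensors, so the preimage of K
  contains it once it contains those.\<close>

lemma tensor_F_map:
  assumes T: "module R (tensor_mod R A B n)" and N: "module R N" and f: "linear_map R (tensor_mod R A B n) N f"
    and K: "submodule K R N"
    and pure: "\<And>i q a b. a \<in> cx_F A q i \<Longrightarrow> b \<in> cx_F B (p - q) (n - i) \<Longrightarrow> f (pure_tensor R A B n i a b) \<in> K"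
    and t: "t \<in> cx_F (tensor R A B) p n"
  shows "f t \<in> K"
proof -
  have "cx_F (tensor R A B) p n \<subseteq> {t \<in> carrier (tensor_mod R A B n). f t \<in> K}"
    unfolding tensor_def fcomplex.simps
    by (rule submodule_span_minimal[OF _ submodule_vimage[OF T N f K]])
      (use pure A.F_carrier B.F_carrier pure_tensor_closed in blast)
  then show ?thesis using t by blast
qed

lemma koszul_closed: "koszul_sign R i \<in> carrier R"
  by (simp add: koszul_sign_def)

text \<open>Compatibility of d with the relations is not checked by hand: the hypothesis
  \<open>T\<close> ensures that the value is a single coset, which is then read off at the
  representative \<open>free_gen R (i, a, b)\<close>.\<close>

lemma tensor_d_pure:
  assumes T: "filtered_complex R (tensor R A B)" and a: "a \<in> cx_carrier A i" and b: "b \<in> cx_carrier B (n - i)"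
  shows "cx_d (tensor R A B) n (pure_tensor R A B n i a b) =
    pure_tensor R A B (n + 1) (i + 1) (cx_d A i a) b \<oplus>\<^bsub>tensor_mod R A B (n + 1)\<^esub>
    koszul_sign R i \<odot>\<^bsub>tensor_mod R A B (n + 1)\<^esub> pure_tensor R A B (n + 1) i a (cx_d B (n - i) b)"
proof -
  let ?F = "tensor_free R A B n" and ?F' = "tensor_free R A B (n + 1)"
  let ?h = "\<lambda>(i, a, b). free_gen R (i + 1, cx_d A i a, b) \<oplus>\<^bsub>?F'\<^esub>
             koszul_sign R i \<odot>\<^bsub>?F'\<^esub> free_gen R (i, a, cx_d B (n - i) b)"
  have g1: "free_gen R (i + 1, cx_d A i a, b) \<in> carrier ?F'" if "a \<in> cx_carrier A i" "b \<in> cx_carrier B (n - i)" for i a b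
    by (rule gen_closed) (use that in simp_all)
  have g2: "free_gen R (i, a, cx_d B (n - i) b) \<in> carrier ?F'" if "a \<in> cx_carrier A i" "b \<in> cx_carrier B (n - i)" for i a b
    by (rule gen_closed) (use that B.d_closed[OF that(2)] in \<open>simp_all add: algebra_simps\<close>)
  have h: "?h \<in> tensor_gens A B n \<rightarrow> carrier ?F'"
  proof (rule funcsetI)
    fix x assume "x \<in> tensor_gens A B n"
    then obtain i a b where x: "x = (i, a, b)" "a \<in> cx_carrier A i" "b \<in> cx_carrier B (n - i)"
      by (auto simp: tensor_gens_def)
    show "?h x \<in> carrier ?F'"
      unfolding x(1) prod.case
      by (intro F.a_closed F.smult_closed koszul_closed g1[OF x(2,3)] g2[OF x(2,3)])
  qed
  have hg: "free_lift R ?F' ?h (free_gen R (i, a, b)) = free_gen R (i + 1, cx_d A i a, b) \<oplus>\<^bsub>?F'\<^esub>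
             koszul_sign R i \<odot>\<^bsub>?F'\<^esub> free_gen R (i, a, cx_d B (n - i) b)"
    using free_lift_gen[OF F.module_axioms h, of "(i, a, b)"] a b by (simp add: tensor_gens_def)
  have d: "cx_d (tensor R A B) n = quot_map ?F' (tensor_rels R A B (n + 1)) (free_lift R ?F' ?h)"
    by (simp add: tensor_def Let_def)
  have "cx_d (tensor R A B) n (pure_tensor R A B n i a b) \<in> carrier (tensor_mod R A B (n + 1))"
    using filtered_complex.d_closed[OF T, of "pure_tensor R A B n i a b" n] pure_tensor_closed[OF a b] by simp
  then have "cx_d (tensor R A B) n (pure_tensor R A B n i a b) =
      tensor_rels R A B (n + 1) +>\<^bsub>?F'\<^esub> free_lift R ?F' ?h (free_gen R (i, a, b))"
    unfolding d pure_tensor_def tensor_mod_def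
    by (intro quot_map_coset_of_closed[OF tensor_mod_facts tensor_mod_facts gen_closed[OF a b]])
      (simp_all only: hg F.a_closed F.smult_closed g1[OF a b] g2[OF a b] koszul_closed)
  then show ?thesis unfolding hg
    using g1[OF a b] g2[OF a b] koszul_closed[of i]
    by (simp add: tensor_mod_def pure_tensor_def quot_add[OF tensor_mod_facts] quot_smult[OF tensor_mod_facts])
qed

end

lemma tensor_mor_pure:
  assumes f: "fmor R A A' f" and B: "filtered_complex R B"
    and fm: "fmor R (tensor R A B) (tensor R A' B) (tensor_mor R A' B f mor_id)"
    and a: "a \<in> cx_carrier A i" and b: "b \<in> cx_carrier B (n - i)"
  shows "tensor_mor R A' B f mor_id n (pure_tensor R A B n i a b) = pure_tensor R A' B n i (f i a) b"
proof -
  interpret f: filtered_map R A A' f by (rule filtered_mapI[OF f])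
  note AB = f.A.filtered_complex_axioms B and AB' = f.B.filtered_complex_axioms B
  let ?F = "tensor_free R A B n" and ?F' = "tensor_free R A' B n"
  let ?h = "\<lambda>(i, a, b). free_gen R (i, f i a, mor_id (n - i) b)"
  note F = module_free_module[OF f.A.cx.R.is_cring]
  have h: "?h \<in> tensor_gens A B n \<rightarrow> carrier ?F'"
  proof (rule funcsetI)
    fix x assume "x \<in> tensor_gens A B n"
    then obtain i a b where x: "x = (i, a, b)" "a \<in> cx_carrier A i" "b \<in> cx_carrier B (n - i)"
      by (auto simp: tensor_gens_def)
    show "?h x \<in> carrier ?F'"
      unfolding x(1) prod.case mor_id_def by (intro gen_closed[OF AB'] f.closed x(2,3))
  qed
  have hg: "free_lift R ?F' ?h (free_gen R (i, a, b)) = free_gen R (i, f i a, b)"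
    using free_lift_gen[OF F h, of "(i, a, b)"] a b by (simp add: tensor_gens_def mor_id_def)
  have "tensor_mor R A' B f mor_id n (pure_tensor R A B n i a b) \<in> carrier (tensor_mod R A' B n)"
    using fmor_closed[OF fm, of "pure_tensor R A B n i a b" n] pure_tensor_closed[OF AB a b]
    by (simp add: tensor_def)
  then have "tensor_mor R A' B f mor_id n (pure_tensor R A B n i a b) =
      tensor_rels R A' B n +>\<^bsub>?F'\<^esub> free_lift R ?F' ?h (free_gen R (i, a, b))"
    unfolding tensor_mor_def pure_tensor_def tensor_mod_def
    by (intro quot_map_coset_of_closed[OF F submodule_tensor_rels[OF AB] F submodule_tensor_rels[OF AB']
        gen_closed[OF AB a b]]) (simp_all only: hg gen_closed[OF AB' f.closed[OF a] b])
  then show ?thesis by (simp only: hg pure_tensor_def)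
qed


text \<open>The new data are \<rho> \<otimes> id and h \<otimes> id. As h acts on the left factor,
  it carries no sign of its own, and every required equation is between linear maps, hence can be
  checked on pure tensors.\<close>

lemma (in def_retract) strong_def_retract_tensor:
  assumes M: "filtered_complex R M"
    and T: "fmor R (tensor R A M) (tensor R B M) (tensor_mor R B M g mor_id)"
  shows "\<exists>\<rho>' h'. strong_def_retract R r (tensor R A M) (tensor R B M) (tensor_mor R B M g mor_id) \<rho>' h'"
proof -
  interpret M: filtered_complex R M by fact
  let ?AM = "tensor R A M" and ?BM = "tensor R B M"
  let ?T = "tensor_mor R B M g mor_id"
  let ?pA = "pure_tensor R A M" and ?pB = "pure_tensor R B M"
  interpret T: filtered_map R ?AM ?BM ?T by (rule filtered_mapI[OF T])
  note A = g.A.filtered_complex_axioms and B = g.B.filtered_complex_axioms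
  note AM = T.A.filtered_complex_axioms and BM = T.B.filtered_complex_axioms
  note simpsA [simp] = tensor_simps[OF A M] and simpsB [simp] = tensor_simps[OF B M]
  have mA: "module R (tensor_mod R A M n)" and mB: "module R (tensor_mod R B M n)" for n
    by (rule module_tensor_mod[OF A M AM] module_tensor_mod[OF B M BM])+
  note pA = pure_tensor_closed[OF A M] and pB = pure_tensor_closed[OF B M]
  note lA = linear_pure_tensor_left[OF A M] and lB = linear_pure_tensor_left[OF B M]
  note rA = linear_pure_tensor_right[OF A M] and rB = linear_pure_tensor_right[OF B M]
  have "\<forall>n. \<exists>\<phi>. linear_map R (tensor_mod R B M n) (tensor_mod R A M n) \<phi> \<and>
      (\<forall>i. \<forall>b\<in>cx_carrier B i. \<forall>m\<in>cx_carrier M (n - i). \<phi> (?pB n i b m) = ?pA n i (\<rho> i b) m)"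
    by (intro allI tensor_lift[OF B M] mA linear_map_comp[OF \<rho>.linear lA] rA \<rho>.closed)
  then obtain \<rho>' where \<rho>'_lin: "\<And>n. linear_map R (tensor_mod R B M n) (tensor_mod R A M n) (\<rho>' n)"
    and \<rho>'_pure: "\<And>n i b m. b \<in> cx_carrier B i \<Longrightarrow> m \<in> cx_carrier M (n - i) \<Longrightarrow>
        \<rho>' n (?pB n i b m) = ?pA n i (\<rho> i b) m"
    by metis
  have "\<exists>\<phi>. linear_map R (tensor_mod R B M n) (tensor_mod R B M (n - 1)) \<phi> \<and>
      (\<forall>i. \<forall>b\<in>cx_carrier B i. \<forall>m\<in>cx_carrier M (n - i). \<phi> (?pB n i b m) = ?pB (n - 1) (i - 1) (h i b) m)" for n
  proof (rule tensor_lift[OF B M mB])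
    fix i
    \<comment> \<open>h lowers the total degree and the degree of the left factor alike, so the
      right factor keeps its degree.\<close>
    have e: "n - 1 - (i - 1) = n - i" by simp
    show "linear_map R (cx_mod B i) (tensor_mod R B M (n - 1)) (\<lambda>b. ?pB (n - 1) (i - 1) (h i b) m)"
      if "m \<in> cx_carrier M (n - i)" for m
      by (rule linear_map_comp[OF linear_h lB]) (use that in \<open>simp only: e\<close>)
    show "linear_map R (cx_mod M (n - i)) (tensor_mod R B M (n - 1)) (?pB (n - 1) (i - 1) (h i b))"
      if "b \<in> cx_carrier B i" for b
      using rB[OF h_closed[OF that], of "n - 1"] by (simp only: e)
  qed
  then obtain h' where h'_lin: "\<And>n. linear_map R (tensor_mod R B M n) (tensor_mod R B M (n - 1)) (h' n)"
    and h'_pure: "\<And>n i b m. b \<in> cx_carrier B i \<Longrightarrow> m \<in> cx_carrier M (n - i) \<Longrightarrow>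
        h' n (?pB n i b m) = ?pB (n - 1) (i - 1) (h i b) m"
    by metis
  have h'_lin_succ: "linear_map R (tensor_mod R B M (n + 1)) (tensor_mod R B M n) (h' (n + 1))" for n
    using h'_lin[of "n + 1"] by simp
  have h'_pure_succ: "h' (n + 1) (?pB (n + 1) i b m) = ?pB n (i - 1) (h i b) m"
    if "b \<in> cx_carrier B i" "m \<in> cx_carrier M (n + 1 - i)" for n i b m
    using h'_pure[OF that] by simp
  have T_pure: "?T n (?pA n i a m) = ?pB n i (g i a) m"
    if "a \<in> cx_carrier A i" "m \<in> cx_carrier M (n - i)" for n i a m
    by (rule tensor_mor_pure[OF g.fmor M T that])
  note dA = tensor_d_pure[OF A M AM] and dB = tensor_d_pure[OF B M BM]
  have linT: "linear_map R (tensor_mod R A M n) (tensor_mod R B M n) (?T n)" for n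
    using T.linear[of n] by simp
  have lindA: "linear_map R (tensor_mod R A M n) (tensor_mod R A M (n + 1)) (cx_d ?AM n)" for n
    using T.A.linear_d[of n] by simp
  have lindB: "linear_map R (tensor_mod R B M n) (tensor_mod R B M (n + 1)) (cx_d ?BM n)" for n
    using T.B.linear_d[of n] by simp
  have lindB_pred: "linear_map R (tensor_mod R B M (n - 1)) (tensor_mod R B M n) (cx_d ?BM (n - 1))" for n
    using T.B.linear_d_pred[of n] by simp
  note K = koszul_closed[OF B M]
  have dM: "cx_d M (n - i) m \<in> cx_carrier M (n + 1 - i)" if "m \<in> cx_carrier M (n - i)" for n i m
    using M.d_closed[OF that] by (simp add: algebra_simps)
  have \<rho>': "fmor R ?BM ?AM \<rho>'"
  proof (rule fmorI[OF BM AM])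
    show "linear_map R (cx_mod ?BM n) (cx_mod ?AM n) (\<rho>' n)" for n using \<rho>'_lin by simp
    show "\<rho>' (n + 1) (cx_d ?BM n t) = cx_d ?AM n (\<rho>' n t)" if "t \<in> cx_carrier ?BM n" for n t
    proof (rule tensor_mod_eqI[OF B M mB mA linear_map_comp[OF lindB \<rho>'_lin] linear_map_comp[OF \<rho>'_lin lindA]])
      show "t \<in> carrier (tensor_mod R B M n)" using that by simp
      fix i b m assume b: "b \<in> cx_carrier B i" and m: "m \<in> cx_carrier M (n - i)"
      have m': "m \<in> cx_carrier M (n + 1 - (i + 1))" using m by simp
      show "\<rho>' (n + 1) (cx_d ?BM n (?pB n i b m)) = cx_d ?AM n (\<rho>' n (?pB n i b m))"
        unfolding dB[OF b m] \<rho>'_pure[OF b m] dA[OF \<rho>.closed[OF b] m]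
          linear_map_add[OF \<rho>'_lin pB[OF g.B.d_closed[OF b] m'] module.smult_closed[OF mB K pB[OF b dM[OF m]]]]
          linear_map_smult[OF \<rho>'_lin K pB[OF b dM[OF m]]] \<rho>'_pure[OF g.B.d_closed[OF b] m'] \<rho>'_pure[OF b dM[OF m]]
          \<rho>.d[OF b] ..
    qed
    show "\<rho>' n t \<in> cx_F ?AM p n" if "t \<in> cx_F ?BM p n" for p n t
    proof (rule tensor_F_map[OF B M mB mA \<rho>'_lin _ _ that])
      show "submodule (cx_F ?AM p n) R (tensor_mod R A M n)" using T.A.submodule_F[of p n] by simp
      fix i q b m assume b: "b \<in> cx_F B q i" and m: "m \<in> cx_F M (p - q) (n - i)"
      show "\<rho>' n (?pB n i b m) \<in> cx_F ?AM p n"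
        unfolding \<rho>'_pure[OF g.B.F_carrier[OF b] M.F_carrier[OF m]]
        by (rule pure_tensor_F[OF A M \<rho>.F[OF b] m])
    qed
  qed
  have h'_F: "h' n t \<in> cx_F ?BM (p + int r) (n - 1)" if "t \<in> cx_F ?BM p n" for p n t
  proof (rule tensor_F_map[OF B M mB mB h'_lin _ _ that])
    show "submodule (cx_F ?BM (p + int r) (n - 1)) R (tensor_mod R B M (n - 1))"
      using T.B.submodule_F[of "p + int r" "n - 1"] by simp
    fix i q b m assume b: "b \<in> cx_F B q i" and m: "m \<in> cx_F M (p - q) (n - i)"
    \<comment> \<open>The left factor absorbs the whole shift: (p + r) - (q + r) = p - q is still
      the level of m.\<close>
    show "h' n (?pB n i b m) \<in> cx_F ?BM (p + int r) (n - 1)"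
      unfolding h'_pure[OF g.B.F_carrier[OF b] M.F_carrier[OF m]]
      by (rule pure_tensor_F[OF B M h_F[OF b]]) (use m in simp)
  qed
  have \<rho>'T: "\<rho>' n (?T n t) = t" if t: "t \<in> carrier (tensor_mod R A M n)" for n t
    by (rule tensor_mod_eqI[OF A M mA mA linear_map_comp[OF linT \<rho>'_lin] linear_map_id _ t])
      (simp add: T_pure \<rho>'_pure \<rho>_g)
  have h'T: "h' n (?T n t) = \<zero>\<^bsub>tensor_mod R B M (n - 1)\<^esub>" if t: "t \<in> carrier (tensor_mod R A M n)" for n t
  proof (rule tensor_mod_eqI[OF A M mA mB linear_map_comp[OF linT h'_lin] linear_map_const_zero[OF mA mB] _ t])
    fix i a m assume a: "a \<in> cx_carrier A i" and m: "m \<in> cx_carrier M (n - i)"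
    have m': "m \<in> cx_carrier M (n - 1 - (i - 1))" using m by simp
    show "h' n (?T n (?pA n i a m)) = \<zero>\<^bsub>tensor_mod R B M (n - 1)\<^esub>"
      unfolding T_pure[OF a m] h'_pure[OF g.closed[OF a] m] h_g[OF a]
      by (rule linear_map_zero[OF g.B.module_cx mB lB[OF m']])
  qed
  have homotopy': "?T n (\<rho>' n t) \<oplus>\<^bsub>tensor_mod R B M n\<^esub>
      (cx_d ?BM (n - 1) (h' n t) \<oplus>\<^bsub>tensor_mod R B M n\<^esub> h' (n + 1) (cx_d ?BM n t)) = t"
    if t: "t \<in> carrier (tensor_mod R B M n)" for n t
  proof (rule tensor_mod_eqI[OF B M mB mB _ linear_map_id _ t])
    interpret N: module R "tensor_mod R B M n" by (rule mB)
    show "linear_map R (tensor_mod R B M n) (tensor_mod R B M n) (\<lambda>t. ?T n (\<rho>' n t) \<oplus>\<^bsub>tensor_mod R B M n\<^esub>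
      (cx_d ?BM (n - 1) (h' n t) \<oplus>\<^bsub>tensor_mod R B M n\<^esub> h' (n + 1) (cx_d ?BM n t)))"
      by (intro linear_map_fun_add mB linear_map_comp[OF \<rho>'_lin linT] linear_map_comp[OF h'_lin lindB_pred]
        linear_map_comp[OF lindB h'_lin_succ])
    fix i b m assume b: "b \<in> cx_carrier B i" and m: "m \<in> cx_carrier M (n - i)"
    have m1: "m \<in> cx_carrier M (n - 1 - (i - 1))" and m2: "m \<in> cx_carrier M (n + 1 - (i + 1))" using m by simp_all
    have dm: "cx_d M (n - i) m \<in> cx_carrier M (n - (i - 1))" using dM[OF m] by (simp add: algebra_simps)
    let ?k = "koszul_sign R i" and ?x = "?pB n (i - 1) (h i b) (cx_d M (n - i) m)"
    have x: "?x \<in> carrier (tensor_mod R B M n)" by (rule pB[OF h_closed[OF b] dm])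
    \<comment> \<open>The cross term h b \<otimes> d m occurs in d h' with the sign of i - 1 and in
      h' d with the sign of i. These are opposite, so the two cancel and the homotopy formula for b
      remains.\<close>
    have sign: "koszul_sign R (i - 1) \<odot>\<^bsub>tensor_mod R B M n\<^esub> ?x = \<ominus>\<^bsub>tensor_mod R B M n\<^esub> (?k \<odot>\<^bsub>tensor_mod R B M n\<^esub> ?x)"
    proof -
      have "koszul_sign R (i - 1) = \<ominus>\<^bsub>R\<^esub> ?k" by (auto simp: koszul_sign_def)
      then show ?thesis using N.smult_l_minus[OF K x] by simp
    qed
    have e1: "cx_d ?BM (n - 1) (h' n (?pB n i b m)) =
        ?pB n i (cx_d B (i - 1) (h i b)) m \<oplus>\<^bsub>tensor_mod R B M n\<^esub> \<ominus>\<^bsub>tensor_mod R B M n\<^esub> (?k \<odot>\<^bsub>tensor_mod R B M n\<^esub> ?x)"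
      using dB[OF h_closed[OF b] m1] unfolding h'_pure[OF b m] by (simp add: sign)
    have e2: "h' (n + 1) (cx_d ?BM n (?pB n i b m)) =
        ?pB n i (h (i + 1) (cx_d B i b)) m \<oplus>\<^bsub>tensor_mod R B M n\<^esub> ?k \<odot>\<^bsub>tensor_mod R B M n\<^esub> ?x"
      unfolding dB[OF b m]
          linear_map_add[OF h'_lin_succ pB[OF g.B.d_closed[OF b] m2] module.smult_closed[OF mB K pB[OF b dM[OF m]]]]
          linear_map_smult[OF h'_lin_succ K pB[OF b dM[OF m]]] h'_pure_succ[OF g.B.d_closed[OF b] m2] h'_pure_succ[OF b dM[OF m]]
      by simp
    let ?u = "?pB n i (g i (\<rho> i b)) m" and ?v = "?pB n i (cx_d B (i - 1) (h i b)) m"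
      and ?w = "?pB n i (h (i + 1) (cx_d B i b)) m" and ?y = "?k \<odot>\<^bsub>tensor_mod R B M n\<^esub> ?x"
    have c: "?u \<in> carrier (tensor_mod R B M n)" "?v \<in> carrier (tensor_mod R B M n)" "?w \<in> carrier (tensor_mod R B M n)"
      "?y \<in> carrier (tensor_mod R B M n)"
      using b m x K by (auto intro!: pB)
    have "?u \<oplus>\<^bsub>tensor_mod R B M n\<^esub> ((?v \<oplus>\<^bsub>tensor_mod R B M n\<^esub> \<ominus>\<^bsub>tensor_mod R B M n\<^esub> ?y) \<oplus>\<^bsub>tensor_mod R B M n\<^esub> (?w \<oplus>\<^bsub>tensor_mod R B M n\<^esub> ?y))
        = ?u \<oplus>\<^bsub>tensor_mod R B M n\<^esub> (?v \<oplus>\<^bsub>tensor_mod R B M n\<^esub> ?w)"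
      using c by algebra
    also have "\<dots> = ?pB n i (g i (\<rho> i b) \<oplus>\<^bsub>cx_mod B i\<^esub> (cx_d B (i - 1) (h i b) \<oplus>\<^bsub>cx_mod B i\<^esub> h (i + 1) (cx_d B i b))) m"
      using b by (simp add: linear_map_add[OF lB[OF m]])
    also have "\<dots> = ?pB n i b m" by (simp only: homotopy[OF b])
    finally show "?T n (\<rho>' n (?pB n i b m)) \<oplus>\<^bsub>tensor_mod R B M n\<^esub>
      (cx_d ?BM (n - 1) (h' n (?pB n i b m)) \<oplus>\<^bsub>tensor_mod R B M n\<^esub> h' (n + 1) (cx_d ?BM n (?pB n i b m))) = ?pB n i b m"
      unfolding e1 e2 \<rho>'_pure[OF b m] T_pure[OF \<rho>.closed[OF b] m] .
  qed
  have \<rho>'T_eq: "mor_eq ?AM (\<rho>' \<circ>\<^sub>m ?T) mor_id"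
    using \<rho>'T by (intro mor_eqI) (simp add: mor_comp_def mor_id_def[of _ x for x])
  have "strong_def_retract R r ?AM ?BM ?T \<rho>' h'"
    unfolding strong_def_retract_def simpsA simpsB
    using T \<rho>' \<rho>'T_eq h'_lin h'_F h'T homotopy' by blast
  then show ?thesis by blast
qed

section \<open>The monoid axiom\<close>

lemma lifts_pushout_of_acof_tensor:
  fixes X Y V :: "('r, 'u) fcomplex"
  assumes inf: "infinite (UNIV :: 'u set)" and S: "S \<subseteq> {0..r}" "r \<in> S"
    and f: "pushout_of_acof_tensor R r S X Y f" and c: "fmor R U V c"
    and e: "inj (e :: 'w \<times> 'u \<times> 'u \<Rightarrow> 'u)"
  shows "lifts R X Y f (mapping_path r (U :: ('r, 'w) fcomplex) V c) V mapping_path_proj"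
proof -
  obtain A B :: "('r, 'u) fcomplex" and M :: "('r, 'u) fcomplex" and g k k'
    where g: "acyclic_cofibration R r S A B g" and M: "filtered_complex R M"
      and po: "is_pushout R (tensor R A M) (tensor R B M) X Y (tensor_mor R B M g mor_id) k f k'"
    using f unfolding pushout_of_acof_tensor_def by blast
  obtain \<rho> h where "strong_def_retract R r A B g \<rho> h"
    using acyclic_cofibration_strong_def_retract[OF inf S g] by blast
  then interpret g: def_retract R r A B g \<rho> h by (rule def_retractI)
  have "fmor R (tensor R A M) (tensor R B M) (tensor_mor R B M g mor_id)"
    using po by (simp add: is_pushout_def)
  then obtain \<rho>' h' where "strong_def_retract R r (tensor R A M) (tensor R B M) (tensor_mor R B M g mor_id) \<rho>' h'"
    using g.strong_def_retract_tensor[OF M] by blast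
  then interpret T: def_retract R r "tensor R A M" "tensor R B M" "tensor_mor R B M g mor_id" \<rho>' h'
    by (rule def_retractI)
  interpret c: filtered_map R U V c by (rule filtered_mapI[OF c])
  show ?thesis
    by (rule lifts_pushout[OF po e c.fmor_mapping_path_proj T.lifts_mapping_path[OF c]])
qed

theorem corollary6p0p4:
  fixes R :: "('r, 'm) ring_scheme" and r :: nat and S :: "nat set"
  assumes "cring R"
    and "infinite (UNIV :: 'u set)"
    and "\<exists>e :: 'r \<Rightarrow> 'u. inj_on e (carrier R)"
    and "S \<subseteq> {0..r}" and "r \<in> S"
  shows "monoid_axiom R r S TYPE('u) TYPE('i)"
  unfolding monoid_axiom_def
proof (intro allI impI, elim conjE)
  fix \<Lambda> :: "'i rel" and X :: "'i \<Rightarrow> ('r, 'u) fcomplex" and \<xi> Y c i0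
  assume wo: "Well_order \<Lambda>" and i0: "i0 \<in> Field \<Lambda>" "\<forall>i\<in>Field \<Lambda>. (i0, i) \<in> \<Lambda>"
    and seq: "transfinite_sequence R (pushout_of_acof_tensor R r S) \<Lambda> X \<xi>"
    and co: "is_colimit R \<Lambda> (Field \<Lambda>) X \<xi> Y c"
  obtain e :: "'u \<times> 'u \<times> 'u \<Rightarrow> 'u" where e: "inj e" using infinite_UNIV_inj_triple[OF assms(2)] by blast
  have c: "fmor R (X i0) Y (c i0)" using co i0(1) by (simp add: is_colimit_def is_cocone_def)
  interpret c: filtered_map R "X i0" Y "c i0" by (rule filtered_mapI[OF c])
  \<comment> \<open>One test map serves all steps of the sequence: the mapping path projection of
    the composite itself.\<close>
  have "lifts R (X i0) Y (c i0) (mapping_path r (X i0) Y (c i0)) Y mapping_path_proj"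
  proof (rule lifts_transfinite_composition[OF wo i0(1) _ seq co e c.fmor_mapping_path_proj])
    fix i j assume "is_succ \<Lambda> i j"
    then have "pushout_of_acof_tensor R r S (X i) (X j) (\<xi> i j)"
      using seq by (simp add: transfinite_sequence_def)
    then show "lifts R (X i) (X j) (\<xi> i j) (mapping_path r (X i0) Y (c i0)) Y mapping_path_proj"
      by (rule lifts_pushout_of_acof_tensor[OF assms(2,4,5) _ c e])
  qed (use i0 in blast)
  \<comment> \<open>The same square as for acyclic cofibrations, now for the composite; its lift is
    turned back into a retraction with a homotopy.\<close>
  moreover have "mor_eq (X i0) (mor_id \<circ>\<^sub>m c i0) (mapping_path_proj \<circ>\<^sub>m mapping_path_incl Y (c i0))"
    by (simp add: mor_eq_def mor_comp_def mor_id_def mapping_path_proj_def mapping_path_incl_def)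
  ultimately obtain k where "fmor R Y (mapping_path r (X i0) Y (c i0)) k"
    "mor_eq (X i0) (k \<circ>\<^sub>m c i0) (mapping_path_incl Y (c i0))" "mor_eq Y (mapping_path_proj \<circ>\<^sub>m k) mor_id"
    using c.fmor_mapping_path_incl[of r] fmor_id[OF c.B.filtered_complex_axioms] unfolding lifts_def by blast
  then obtain \<rho> h where "strong_def_retract R r (X i0) Y (c i0) \<rho> h"
    using strong_def_retract_of_lift[OF c] by blast
  then interpret def_retract R r "X i0" Y "c i0" \<rho> h by (rule def_retractI)
  show "quasi_iso R r (X i0) Y (c i0)" by (rule quasi_iso)
qed

end
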